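(* Let $d\ge1$, let $\mathcal{H}^+=-\frac{1}{4\pi}\Delta+\pi|x|^2$ on $\mathbb{R}^d$ and $\mathcal{I}=(-\pi/4,\pi/4)$. There exists $V\in L^\infty_c(\mathcal{I}\times\mathbb{R}^d)$ such that $$\operatorname{Tr}\left(\int_{\mathcal{I}}e^{-it\mathcal{H}^+}V(t,x)e^{it\mathcal{H}^+}\,dt\right)^{d+1}=+\infty.$$
   Context: $L^\infty_c(\mathcal{I}\times\mathbb{R}^d)$ denotes the bounded measurable functions on $\mathcal{I}\times\mathbb{R}^d$ with compact support. For each $t$, $V(t,x)$ is identified with the operator of multiplication by $V(t,\cdot)$ on $L^2(\mathbb{R}^d)$, and $e^{it\mathcal{H}^+}$ is the unitary group on $L^2(\mathbb{R}^d)$ generated by the self-adjoint operator $\mathcal{H}^+$. The exponent $d+1$ is applied to the operator, i.e. the quantity is the trace of the $(d+1)$-th power. *)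

theory Defs
  imports "HOL-Analysis.Analysis"
begin

section \<open>The complex Hilbert space $L^2$\<close>

definition square_integrable :: "('a::euclidean_space \<Rightarrow> complex) \<Rightarrow> bool" where
  "square_integrable f \<longleftrightarrow>
     f \<in> borel_measurable borel \<and> integrable lborel (\<lambda>x. (cmod (f x))\<^sup>2)"

lemma square_integrable_zero: "square_integrable (\<lambda>_. 0)"
  by (simp add: square_integrable_def)

lemma square_integrable_mult_bounded:
  assumes "square_integrable f" "m \<in> borel_measurable borel" "\<And>x. cmod (m x) \<le> C"
  shows "square_integrable (\<lambda>x. m x * f x)"
  unfolding square_integrable_def
proof
  have [measurable]: "f \<in> borel_measurable borel" "m \<in> borel_measurable borel"
    using assms by (auto simp: square_integrable_def)
  show "(\<lambda>x. m x * f x) \<in> borel_measurable borel"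
    by measurable
  have "integrable lborel (\<lambda>x. C\<^sup>2 * (cmod (f x))\<^sup>2)"
    using assms by (auto simp: square_integrable_def)
  then show "integrable lborel (\<lambda>x. (cmod (m x * f x))\<^sup>2)"
  proof (rule Bochner_Integration.integrable_bound)
    show "AE x in lborel. norm ((cmod (m x * f x))\<^sup>2) \<le> norm (C\<^sup>2 * (cmod (f x))\<^sup>2)"
      using assms(3) by (auto simp: norm_mult power_mult_distrib intro!: mult_right_mono power_mono)
  qed simp
qed

lemma square_integrable_scale:
  "square_integrable f \<Longrightarrow> square_integrable (\<lambda>x. c * f x)"
  by (rule square_integrable_mult_bounded[where C = "cmod c"]) auto

lemma square_integrable_add:
  assumes "square_integrable f" "square_integrable g"
  shows "square_integrable (\<lambda>x. f x + g x)"
  unfolding square_integrable_def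
proof
  have [measurable]: "f \<in> borel_measurable borel" "g \<in> borel_measurable borel"
    using assms by (auto simp: square_integrable_def)
  show "(\<lambda>x. f x + g x) \<in> borel_measurable borel"
    by measurable
  have "integrable lborel (\<lambda>x. 2 * (cmod (f x))\<^sup>2 + 2 * (cmod (g x))\<^sup>2)"
    using assms by (auto simp: square_integrable_def)
  then show "integrable lborel (\<lambda>x. (cmod (f x + g x))\<^sup>2)"
  proof (rule Bochner_Integration.integrable_bound)
    have "(cmod (a + b))\<^sup>2 \<le> 2 * (cmod a)\<^sup>2 + 2 * (cmod b)\<^sup>2" for a b
    proof -
      have "(cmod (a + b))\<^sup>2 \<le> (cmod a + cmod b)\<^sup>2"
        by (intro power_mono norm_triangle_ineq) simp
      also have "\<dots> \<le> 2 * (cmod a)\<^sup>2 + 2 * (cmod b)\<^sup>2"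
        using sum_squares_bound[of "cmod a" "cmod b"] by (simp add: power2_sum)
      finally show ?thesis .
    qed
    then show "AE x in lborel.
        norm ((cmod (f x + g x))\<^sup>2) \<le> norm (2 * (cmod (f x))\<^sup>2 + 2 * (cmod (g x))\<^sup>2)"
      by auto
  qed simp
qed

lemma square_integrable_diff:
  "square_integrable f \<Longrightarrow> square_integrable g \<Longrightarrow> square_integrable (\<lambda>x. f x - g x)"
  using square_integrable_add[of f "\<lambda>x. (-1) * g x"] square_integrable_scale[of g "-1"] by simp

lemma borel_measurable_cnj [measurable]: "cnj \<in> borel_measurable borel"
  by (intro borel_measurable_continuous_onI continuous_intros)

lemma square_integrable_product:
  assumes "square_integrable f" "square_integrable g"
  shows "integrable lborel (\<lambda>x. cnj (f x) * g x)"
proof -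
  have [measurable]: "f \<in> borel_measurable borel" "g \<in> borel_measurable borel"
    using assms by (auto simp: square_integrable_def)
  have "integrable lborel (\<lambda>x. (cmod (f x))\<^sup>2 + (cmod (g x))\<^sup>2)"
    using assms by (auto simp: square_integrable_def)
  then show ?thesis
  proof (rule Bochner_Integration.integrable_bound)
    have "a * b \<le> \<bar>a\<^sup>2 + b\<^sup>2\<bar>" if "0 \<le> a" "0 \<le> b" for a b :: real
      using sum_squares_bound[of a b] that mult_nonneg_nonneg[of a b] by linarith
    then show "AE x in lborel. norm (cnj (f x) * g x) \<le> norm ((cmod (f x))\<^sup>2 + (cmod (g x))\<^sup>2)"
      by (simp add: norm_mult)
  qed (simp, measurable)
qed

definition L2_rel :: "('a::euclidean_space \<Rightarrow> complex) \<Rightarrow> ('a \<Rightarrow> complex) \<Rightarrow> bool" where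
  "L2_rel f g \<longleftrightarrow> square_integrable f \<and> square_integrable g \<and> (AE x in lborel. f x = g x)"

quotient_type (overloaded) 'a L2 = "'a::euclidean_space \<Rightarrow> complex" / partial: L2_rel
proof (rule part_equivpI)
  show "\<exists>f. L2_rel f (f :: 'a \<Rightarrow> complex)"
    using square_integrable_zero by (auto simp: L2_rel_def intro!: exI[of _ "\<lambda>_. 0"])
  show "symp (L2_rel :: ('a \<Rightarrow> complex) \<Rightarrow> _)"
    by (rule sympI) (auto simp: L2_rel_def elim: eventually_mono)
  show "transp (L2_rel :: ('a \<Rightarrow> complex) \<Rightarrow> _)"
    by (rule transpI) (auto simp: L2_rel_def elim: eventually_elim2)
qed

lift_definition cinner :: "'a::euclidean_space L2 \<Rightarrow> 'a L2 \<Rightarrow> complex" is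
  "\<lambda>f g. LINT x|lborel. cnj (f x) * g x"
proof -
  fix f f' g g' :: "'a \<Rightarrow> complex"
  assume *: "L2_rel f f'" "L2_rel g g'"
  then have [measurable]: "f \<in> borel_measurable borel" "f' \<in> borel_measurable borel"
      "g \<in> borel_measurable borel" "g' \<in> borel_measurable borel"
    by (auto simp: L2_rel_def square_integrable_def)
  show "(LINT x|lborel. cnj (f x) * g x) = (LINT x|lborel. cnj (f' x) * g' x)"
  proof (rule integral_cong_AE)
    show "AE x in lborel. cnj (f x) * g x = cnj (f' x) * g' x"
      using * by (auto simp: L2_rel_def elim: eventually_elim2)
  qed (simp_all, measurable)
qed

lift_definition scaleC :: "complex \<Rightarrow> 'a::euclidean_space L2 \<Rightarrow> 'a L2"  (infixr "*\<^sub>C" 75) is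
  "\<lambda>c f x. c * f x"
  by (auto simp: L2_rel_def square_integrable_scale elim: eventually_mono)

instantiation L2 :: (euclidean_space) real_vector
begin

lift_definition zero_L2 :: "'a L2" is "\<lambda>_. 0"
  by (simp add: L2_rel_def square_integrable_zero)

lift_definition plus_L2 :: "'a L2 \<Rightarrow> 'a L2 \<Rightarrow> 'a L2" is "\<lambda>f g x. f x + g x"
  by (auto simp: L2_rel_def square_integrable_add elim: eventually_elim2)

lift_definition minus_L2 :: "'a L2 \<Rightarrow> 'a L2 \<Rightarrow> 'a L2" is "\<lambda>f g x. f x - g x"
  by (auto simp: L2_rel_def square_integrable_diff elim: eventually_elim2)

definition uminus_L2 :: "'a L2 \<Rightarrow> 'a L2" where "uminus_L2 f = (-1) *\<^sub>C f"

definition scaleR_L2 :: "real \<Rightarrow> 'a L2 \<Rightarrow> 'a L2" where "scaleR_L2 r f = complex_of_real r *\<^sub>C f"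

instance
proof
  fix a b c :: "'a L2" and r s :: real
  show "a + b + c = a + (b + c)"
    by transfer (auto simp: L2_rel_def add.assoc square_integrable_add)
  show "a + b = b + a"
    by transfer (auto simp: L2_rel_def add.commute square_integrable_add)
  show "0 + a = a"
    by transfer (auto simp: L2_rel_def)
  show "- a + a = 0"
    unfolding uminus_L2_def
    by transfer (auto simp: L2_rel_def square_integrable_zero square_integrable_diff)
  show "a - b = a + - b"
    unfolding uminus_L2_def
    by transfer (auto simp: L2_rel_def square_integrable_diff)
  show "r *\<^sub>R (a + b) = r *\<^sub>R a + r *\<^sub>R b"
    unfolding scaleR_L2_def
    by transfer (auto simp: L2_rel_def ring_distribs square_integrable_add square_integrable_scale)
  show "(r + s) *\<^sub>R a = r *\<^sub>R a + s *\<^sub>R a"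
    unfolding scaleR_L2_def
    by transfer (auto simp: L2_rel_def ring_distribs square_integrable_add square_integrable_scale)
  show "r *\<^sub>R s *\<^sub>R a = (r * s) *\<^sub>R a"
    unfolding scaleR_L2_def
    by transfer (use square_integrable_scale in \<open>auto simp: L2_rel_def mult.assoc\<close>)
  show "1 *\<^sub>R a = a"
    unfolding scaleR_L2_def by transfer (auto simp: L2_rel_def)
qed

end

instantiation L2 :: (euclidean_space) real_inner
begin

definition inner_L2 :: "'a L2 \<Rightarrow> 'a L2 \<Rightarrow> real" where "inner_L2 f g = Re (cinner f g)"

definition norm_L2 :: "'a L2 \<Rightarrow> real" where "norm_L2 f = sqrt (inner f f)"

definition sgn_L2 :: "'a L2 \<Rightarrow> 'a L2" where "sgn_L2 f = f /\<^sub>R norm f"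

definition dist_L2 :: "'a L2 \<Rightarrow> 'a L2 \<Rightarrow> real" where "dist_L2 f g = norm (f - g)"

definition uniformity_L2 :: "('a L2 \<times> 'a L2) filter" where
  "uniformity_L2 = (INF e\<in>{0<..}. principal {(f, g). dist f g < e})"

definition open_L2 :: "'a L2 set \<Rightarrow> bool" where
  "open_L2 S = (\<forall>x\<in>S. \<forall>\<^sub>F (x', y) in uniformity. x' = x \<longrightarrow> y \<in> S)"

instance
proof
  fix a b c :: "'a L2" and r :: real
  show "inner a b = inner b a"
  proof -
    have "cinner a b = cnj (cinner b a)"
      by transfer (simp flip: Bochner_Integration.integral_cnj add: mult.commute)
    then show ?thesis by (simp add: inner_L2_def)
  qed
  show "inner (a + b) c = inner a c + inner b c"
    unfolding inner_L2_def
    by transfer (simp add: L2_rel_def ring_distribs square_integrable_product)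
  show "inner (r *\<^sub>R a) b = r * inner a b"
    unfolding inner_L2_def scaleR_L2_def
    by transfer (simp add: L2_rel_def mult.assoc)
  have sq: "Re (LINT x|lborel. cnj (f x) * f x) = (LINT x|lborel. (cmod (f x))\<^sup>2)"
    for f :: "'a \<Rightarrow> complex"
  proof -
    have "(LINT x|lborel. cnj (f x) * f x) = (LINT x|lborel. complex_of_real ((cmod (f x))\<^sup>2))"
      by (intro Bochner_Integration.integral_cong) (auto simp: complex_norm_square mult.commute simp del: of_real_power)
    also have "\<dots> = complex_of_real (LINT x|lborel. (cmod (f x))\<^sup>2)"
      by (rule integral_complex_of_real)
    finally show ?thesis by simp
  qed
  show "0 \<le> inner a a"
    unfolding inner_L2_def by transfer (simp add: sq)
  show "inner a a = 0 \<longleftrightarrow> a = 0"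
    unfolding inner_L2_def
  proof transfer
    fix f :: "'a \<Rightarrow> complex"
    assume "L2_rel f f"
    then have f: "square_integrable f" by (simp add: L2_rel_def)
    then have "(LINT x|lborel. (cmod (f x))\<^sup>2) = 0 \<longleftrightarrow> (AE x in lborel. (cmod (f x))\<^sup>2 = 0)"
      by (intro integral_nonneg_eq_0_iff_AE) (auto simp: square_integrable_def)
    then show "Re (LINT x|lborel. cnj (f x) * f x) = 0 \<longleftrightarrow> L2_rel f (\<lambda>_. 0)"
      using f by (simp add: sq L2_rel_def square_integrable_zero)
  qed
qed (simp_all add: norm_L2_def sgn_L2_def dist_L2_def uniformity_L2_def open_L2_def)

end

text \<open>The class of \<open>f\<close>; the value 0 for functions that are not square integrable is never used.\<close>

lift_definition to_L2 :: "('a::euclidean_space \<Rightarrow> complex) \<Rightarrow> 'a L2" is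
  "\<lambda>f. if square_integrable f then f else (\<lambda>_. 0)"
  by (auto simp: L2_rel_def square_integrable_zero)

text \<open>Multiplication by a bounded measurable function \<open>m\<close> (0 for all other \<open>m\<close>).\<close>

lift_definition mult_op :: "('a::euclidean_space \<Rightarrow> complex) \<Rightarrow> 'a L2 \<Rightarrow> 'a L2" is
  "\<lambda>m f. if m \<in> borel_measurable borel \<and> bounded (range m) then (\<lambda>x. m x * f x) else (\<lambda>_. 0)"
proof -
  fix m f g :: "'a \<Rightarrow> complex"
  assume fg: "L2_rel f g"
  let ?M = "\<lambda>h. if m \<in> borel_measurable borel \<and> bounded (range m)
    then (\<lambda>x. m x * h x) else (\<lambda>_. 0)"
  show "L2_rel (?M f) (?M g)"
  proof (cases "m \<in> borel_measurable borel \<and> bounded (range m)")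
    case True
    then obtain C where "\<And>x. cmod (m x) \<le> C" by (auto simp: bounded_iff)
    with True fg show ?thesis
      by (auto simp: L2_rel_def intro: square_integrable_mult_bounded elim: eventually_mono)
  qed (auto simp: L2_rel_def square_integrable_zero)
qed


section \<open>Operators on $L^2$\<close>

definition bounded_clinear :: "('a::euclidean_space L2 \<Rightarrow> 'a L2) \<Rightarrow> bool" where
  "bounded_clinear T \<longleftrightarrow> bounded_linear T \<and> (\<forall>c f. T (c *\<^sub>C f) = c *\<^sub>C T f)"

definition unitary :: "('a::euclidean_space L2 \<Rightarrow> 'a L2) \<Rightarrow> bool" where
  "unitary T \<longleftrightarrow> bounded_clinear T \<and> surj T \<and> (\<forall>f g. cinner (T f) (T g) = cinner f g)"

definition unitary_group :: "(real \<Rightarrow> 'a::euclidean_space L2 \<Rightarrow> 'a L2) \<Rightarrow> bool" where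
  "unitary_group U \<longleftrightarrow>
     (\<forall>t. unitary (U t)) \<and> U 0 = id \<and> (\<forall>s t. U (s + t) = U s \<circ> U t) \<and>
     (\<forall>f. continuous_on UNIV (\<lambda>t. U t f))"

text \<open>\<open>U t = exp (i t H)\<close>, where the (unbounded, self-adjoint) operator \<open>H\<close> is given by its
  graph. The equivalence says that \<open>H\<close>, with its domain, is the Stone generator of \<open>U\<close>;
  \<open>U\<close> is then uniquely determined by \<open>H\<close>.\<close>

definition unitary_group_generated_by ::
    "('a::euclidean_space L2 \<times> 'a L2) set \<Rightarrow> (real \<Rightarrow> 'a L2 \<Rightarrow> 'a L2) \<Rightarrow> bool" where
  "unitary_group_generated_by H U \<longleftrightarrow> unitary_group U \<and>
     (\<forall>u v. (u, v) \<in> H \<longleftrightarrow> ((\<lambda>t. (U t u - u) /\<^sub>R t) \<longlongrightarrow> \<i> *\<^sub>C v) (at 0))"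

definition positive_op :: "('a::euclidean_space L2 \<Rightarrow> 'a L2) \<Rightarrow> bool" where
  "positive_op T \<longleftrightarrow> bounded_clinear T \<and> (\<forall>f. cinner f (T f) \<in> \<real> \<and> 0 \<le> Re (cinner f (T f)))"

definition orthonormal :: "'a::euclidean_space L2 set \<Rightarrow> bool" where
  "orthonormal B \<longleftrightarrow> (\<forall>e\<in>B. \<forall>e'\<in>B. cinner e e' = (if e = e' then 1 else 0))"

definition orthonormal_basis :: "'a::euclidean_space L2 set \<Rightarrow> bool" where
  "orthonormal_basis B \<longleftrightarrow> orthonormal B \<and> (\<forall>f. (\<forall>e\<in>B. cinner e f = 0) \<longrightarrow> f = 0)"

text \<open>The trace of a positive operator, as an element of $[0,\infty]$. It does not depend on the
  orthonormal basis. It is not meaningful if the operator is not positive.\<close>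

definition op_trace :: "('a::euclidean_space L2 \<Rightarrow> 'a L2) \<Rightarrow> ennreal" where
  "op_trace T = (\<Sum>\<^sub>\<infinity>e\<in>(SOME B. orthonormal_basis B). ennreal (Re (cinner e (T e))))"

lemma cinner_commute: "cinner f g = cnj (cinner g f)"
  by transfer (simp flip: Bochner_Integration.integral_cnj add: mult.commute)

lemma cinner_scaleC_right: "cinner f (c *\<^sub>C g) = c * cinner f g"
  by transfer (simp add: L2_rel_def mult.left_commute)

lemma cinner_scaleC_left: "cinner (c *\<^sub>C f) g = cnj c * cinner f g"
  by (metis cinner_commute cinner_scaleC_right complex_cnj_mult)

lemma cinner_self: "cinner f f = complex_of_real ((norm f)\<^sup>2)"
proof -
  have "Im (cinner f f) = 0"
    using cinner_commute[of f f] by (metis complex_cnj_cancel_iff complex_cnj_cnj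
        Reals_cnj_iff complex_is_Real_iff)
  moreover have "Re (cinner f f) = (norm f)\<^sup>2"
    using power2_norm_eq_inner[of f] by (simp add: inner_L2_def)
  ultimately show ?thesis by (simp add: complex_eq_iff)
qed

lemma ex_orthonormal_basis: "\<exists>B. orthonormal_basis (B :: 'a::euclidean_space L2 set)"
proof -
  have "\<exists>M\<in>Collect orthonormal. \<forall>X\<in>Collect orthonormal. M \<subseteq> X \<longrightarrow> X = (M :: 'a L2 set)"
  proof (rule subset_Zorn')
    fix C :: "'a L2 set set"
    assume "subset.chain (Collect orthonormal) C"
    then have "\<And>X. X \<in> C \<Longrightarrow> orthonormal X" "\<And>X Y. X \<in> C \<Longrightarrow> Y \<in> C \<Longrightarrow> X \<subseteq> Y \<or> Y \<subseteq> X"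
      by (auto simp: subset_chain_def)
    then show "\<Union>C \<in> Collect orthonormal"
      unfolding orthonormal_def mem_Collect_eq by (meson UnionE subsetD)
  qed
  then obtain M :: "'a L2 set"
    where M: "orthonormal M" "\<And>X. orthonormal X \<Longrightarrow> M \<subseteq> X \<Longrightarrow> X = M"
    by auto
  have "f = 0" if f: "\<forall>e\<in>M. cinner e f = 0" for f
  proof (rule ccontr)
    assume "f \<noteq> 0"
    define g where "g = complex_of_real (inverse (norm f)) *\<^sub>C f"
    have g1: "cinner g g = 1"
      using \<open>f \<noteq> 0\<close>
      unfolding g_def cinner_scaleC_left cinner_scaleC_right
      by (simp add: cinner_self power2_eq_square field_simps)
    have g0: "cinner e g = 0" "cinner g e = 0" if "e \<in> M" for e
      using f that cinner_commute[of g e] by (auto simp: g_def cinner_scaleC_right)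
    have "orthonormal (insert g M)"
      using M(1) g0 g1 by (auto simp: orthonormal_def)
    then have "g \<in> M" using M(2) by blast
    then show False using g0 g1 by auto
  qed
  with M(1) show ?thesis by (auto simp: orthonormal_basis_def)
qed

text \<open>\<open>A\<close> is the integral of the operator family \<open>F\<close> over \<open>I\<close>, in the weak sense.
  There is at most one such \<open>A\<close>.\<close>

definition has_op_integral ::
    "(real \<Rightarrow> 'a::euclidean_space L2 \<Rightarrow> 'a L2) \<Rightarrow> ('a L2 \<Rightarrow> 'a L2) \<Rightarrow> real set \<Rightarrow> bool" where
  "has_op_integral F A I \<longleftrightarrow> bounded_clinear A \<and>
     (\<forall>f g. set_integrable lborel I (\<lambda>t. cinner g (F t f)) \<and>
            cinner g (A f) = (LINT t:I|lborel. cinner g (F t f)))"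


section \<open>The harmonic oscillator\<close>

definition partial_deriv :: "'a::euclidean_space \<Rightarrow> ('a \<Rightarrow> complex) \<Rightarrow> 'a \<Rightarrow> complex" where
  "partial_deriv b f x = vector_derivative (\<lambda>s. f (x + s *\<^sub>R b)) (at 0)"

primrec C_k :: "nat \<Rightarrow> ('a::euclidean_space \<Rightarrow> complex) \<Rightarrow> bool" where
  "C_k 0 f \<longleftrightarrow> continuous_on UNIV f"
| "C_k (Suc k) f \<longleftrightarrow> (\<forall>b\<in>Basis.
     (\<forall>x. (\<lambda>s::real. f (x + s *\<^sub>R b)) differentiable (at 0)) \<and> C_k k (partial_deriv b f))"

definition test_function :: "('a::euclidean_space \<Rightarrow> complex) \<Rightarrow> bool" where
  "test_function \<phi> \<longleftrightarrow> (\<forall>k. C_k k \<phi>) \<and> compact (closure {x. \<phi> x \<noteq> 0})"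

definition laplacian :: "('a::euclidean_space \<Rightarrow> complex) \<Rightarrow> 'a \<Rightarrow> complex" where
  "laplacian f x = (\<Sum>b\<in>Basis. partial_deriv b (partial_deriv b f) x)"

definition oscillator_expr :: "('a::euclidean_space \<Rightarrow> complex) \<Rightarrow> 'a \<Rightarrow> complex" where
  "oscillator_expr f x =
     - complex_of_real (1 / (4 * pi)) * laplacian f x + complex_of_real (pi * (norm x)\<^sup>2) * f x"

text \<open>The graph of the self-adjoint operator $-\frac{1}{4\pi}\Delta + \pi|x|^2$, as the adjoint of
  the differential expression on $C_c^\infty$: \<open>u\<close> is in the domain iff the expression applied to
  \<open>u\<close> in the sense of distributions is some \<open>v\<close> in $L^2$. Since the expression is essentially
  self-adjoint on $C_c^\infty$, this is also the closure and the only self-adjoint extension.\<close>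

definition oscillator :: "('a::euclidean_space L2 \<times> 'a L2) set" where
  "oscillator = {(u, v). \<forall>\<phi>. test_function \<phi> \<longrightarrow>
     cinner (to_L2 (oscillator_expr \<phi>)) u = cinner (to_L2 \<phi>) v}"


section \<open>Bounded potentials with compact support\<close>

text \<open>Functions on $I \times \mathbb{R}^d$ are extended by zero to $\mathbb{R} \times \mathbb{R}^d$;
  the support has to be a compact subset of \<open>I \<times> UNIV\<close>.\<close>

definition Linf_c :: "real set \<Rightarrow> (real \<times> 'a::euclidean_space \<Rightarrow> real) set" where
  "Linf_c I = {V. V \<in> borel_measurable borel \<and> bounded (range V) \<and>
     compact (closure {p. V p \<noteq> 0}) \<and> closure {p. V p \<noteq> 0} \<subseteq> I \<times> UNIV}"

end

theory Submission
  imports Defs "HOL-Probability.Distributions"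
begin

text \<open>The potential is the indicator function of \<open>[0, 1/2] \<times> cball 0 R\<close>, so that \<open>A = \<integral> U(-t) 1_B
  U(t) dt\<close> over \<open>[0, 1/2]\<close> with \<open>B = cball 0 R\<close>. Classically, the oscillator rotates phase space,
  \<open>x + i p \<mapsto> e^it (x + i p)\<close>, and \<open>A\<close> measures the time that an orbit spends over \<open>B\<close>. An orbit of
  momentum about \<open>n\<close> crosses \<open>B\<close> in a time of order \<open>1/n\<close>, and the points of phase space whose
  orbit meets \<open>B\<close> during \<open>[0, 1/2]\<close> while \<open>|p| \<approx> n\<close> fill a volume of order \<open>n^(d-1) * n\<close> per unit
  of \<open>n\<close>: the momentum lies on a sphere, and the position lies within a bounded distance of a
  segment of length of order \<open>n\<close> along the momentum. Hence \<open>Tr A^(d+1)\<close> is of the order of the sum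
  of \<open>n^d (1/n)^(d+1) = 1/n\<close>, which diverges.

  This is made rigorous with Gaussian coherent states. The packet with parameter \<open>w = a + i b\<close> has
  position \<open>a\<close> and momentum \<open>b\<close>, and \<open>U(t)\<close> maps it to a phase times the packet with parameter
  \<open>e^it w\<close> (\<open>unit_packet_flow\<close>); this is where the generator enters, through
  \<open>packet_in_oscillator\<close> and the differentiability in the mean of the explicit flow. Consequently
  \<open>\<langle>\<phi>, A \<phi>\<rangle> \<ge> c/n\<close> for a packet \<open>\<phi>\<close> of momentum about \<open>n\<close> whose orbit meets the origin nearly
  (\<open>ray_packet_time_average_ge\<close>). Such packets are taken from a lattice of phase space; their
  overlaps decay like a Gaussian, so by Schur's test they form a Bessel family with a bound
  independent of their number (\<open>bessel_family_ray_packet\<close>).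

  Three facts turn this into a lower bound for the trace. By convexity of the moments, \<open>\<langle>\<phi>, A^q \<phi>\<rangle> \<ge>
  \<langle>\<phi>, A \<phi>\<rangle>^q\<close> for unit vectors (\<open>power_inner_le_inner_funpow\<close>). For a Bessel family with bound
  \<open>K\<close>, the sum of the \<open>\<langle>\<phi>, A^q \<phi>\<rangle>\<close> is at most \<open>K\<close> times the trace in any orthonormal basis
  (\<open>sum_bessel_family_le_trace\<close>); this rests on the form of \<open>A^q\<close> being a square norm for even \<open>q\<close>
  and an integral of square norms for odd \<open>q\<close>. Finally, the number of packets with leading
  momentum \<open>n\<close> is at least \<open>n^d / 4\<close>, and the harmonic series diverges (\<open>sum_ray_index_ge\<close>). The
  construction of \<open>A\<close> as a Riemann integral and the expansion in a maximal orthonormal set both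
  need \<open>L\<^sup>2\<close> to be complete.\<close>

section \<open>Inner products on $L^2$\<close>

lemma cinner_add_right: "cinner f (g + h) = cinner f g + cinner f h"
  by transfer (simp add: L2_rel_def ring_distribs square_integrable_product)

lemma cinner_add_left: "cinner (f + g) h = cinner f h + cinner g h"
  by (metis cinner_add_right cinner_commute complex_cnj_add)

lemma scaleR_scaleC: "r *\<^sub>R f = complex_of_real r *\<^sub>C f"
  by (simp add: scaleR_L2_def)

lemma scaleC_scaleC [simp]: "a *\<^sub>C b *\<^sub>C f = (a * b) *\<^sub>C f"
  by transfer (use square_integrable_scale in \<open>auto simp: L2_rel_def mult.assoc\<close>)

lemma scaleC_add_right: "a *\<^sub>C (f + g) = a *\<^sub>C f + a *\<^sub>C g"
  by transfer (auto simp: L2_rel_def ring_distribs square_integrable_add square_integrable_scale)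

lemma scaleC_add_left: "(a + b) *\<^sub>C f = a *\<^sub>C f + b *\<^sub>C f"
  by transfer (auto simp: L2_rel_def ring_distribs square_integrable_add square_integrable_scale)

lemma scaleC_one [simp]: "1 *\<^sub>C f = f"
  by transfer (auto simp: L2_rel_def)

lemma scaleC_zero_right [simp]: "a *\<^sub>C 0 = 0"
  using scaleC_add_right[of a 0 0] by simp

lemma scaleC_zero_left [simp]: "0 *\<^sub>C f = 0"
  using scaleC_add_left[of 0 0 f] by simp

lemma cinner_zero [simp]: "cinner f 0 = 0" "cinner 0 f = 0"
  using cinner_add_right[of f 0 0] cinner_add_left[of 0 0 f] by simp_all

lemma cinner_minus_right: "cinner f (g - h) = cinner f g - cinner f h"
  using cinner_add_right[of f "g - h" h] by simp

lemma cinner_sum_right: "cinner f (\<Sum>i\<in>I. g i) = (\<Sum>i\<in>I. cinner f (g i))"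
  by (induction I rule: infinite_finite_induct) (auto simp: cinner_add_right)

lemma cinner_sum_left: "cinner (\<Sum>i\<in>I. g i) f = (\<Sum>i\<in>I. cinner (g i) f)"
  by (induction I rule: infinite_finite_induct) (auto simp: cinner_add_left)

lemma norm_scaleC [simp]: "norm (c *\<^sub>C f) = cmod c * norm f"
proof -
  have "complex_of_real ((norm (c *\<^sub>C f))\<^sup>2) = complex_of_real ((cmod c * norm f)\<^sup>2)"
    unfolding cinner_self[symmetric] cinner_scaleC_left cinner_scaleC_right
    using complex_norm_square[of c] by (simp add: cinner_self power_mult_distrib mult.commute)
  then have "(norm (c *\<^sub>C f))\<^sup>2 = (cmod c * norm f)\<^sup>2"
    using of_real_eq_iff by blast
  then show ?thesis by (simp add: power2_eq_iff_nonneg)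
qed

lemma Re_cinner: "Re (cinner f g) = inner f g"
  by (simp add: inner_L2_def)

lemma Re_cinner_self: "Re (cinner f f) = (norm f)\<^sup>2"
  by (simp add: cinner_self)

lemma cmod_cinner_commute: "cmod (cinner f g) = cmod (cinner g f)"
  by (metis cinner_commute complex_mod_cnj)

text \<open>Rotating one argument by a phase makes the complex product real, so the bound is the real
  Cauchy-Schwarz inequality.\<close>

lemma cmod_cinner_le: "cmod (cinner f g) \<le> norm f * norm g"
proof (cases "cinner f g = 0")
  case False
  define c where "c = cnj (sgn (cinner f g))"
  have c: "cmod c = 1" using False by (simp add: c_def norm_sgn)
  have "z * cnj z = complex_of_real (cmod z) * complex_of_real (cmod z)" for z
    by (metis complex_norm_square power2_eq_square of_real_power)
  then have "c * cinner f g = complex_of_real (cmod (cinner f g))"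
    using False by (simp add: c_def sgn_div_norm scaleR_conv_of_real mult.commute field_simps)
  then have "cinner f (c *\<^sub>C g) = complex_of_real (cmod (cinner f g))"
    by (simp add: cinner_scaleC_right)
  then have "cmod (cinner f g) = inner f (c *\<^sub>C g)"
    by (metis Re_cinner Re_complex_of_real)
  also have "\<dots> \<le> norm f * norm (c *\<^sub>C g)"
    by (rule norm_cauchy_schwarz)
  finally show ?thesis by (simp add: c)
qed simp

lemma bounded_linear_cinner_right: "bounded_linear (cinner f)"
proof (rule bounded_linear_intro[where K = "norm f"])
  show "norm (cinner f x) \<le> norm x * norm f" for x
    using cmod_cinner_le[of f x] by (simp add: mult.commute)
qed (auto simp: cinner_add_right scaleR_scaleC cinner_scaleC_right scaleR_conv_of_real)

lemma bounded_linear_scaleC: "bounded_linear ((*\<^sub>C) c)"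
  by (rule bounded_linear_intro[where K = "cmod c"])
    (auto simp: scaleC_add_right scaleR_scaleC mult.commute)

lemma cinner_to_L2:
  assumes "square_integrable f" "square_integrable g"
  shows "cinner (to_L2 f) (to_L2 g) = (LINT x|lborel. cnj (f x) * g x)"
  using assms(1,2) by (transfer fixing: f g) simp

lemma norm_to_L2:
  assumes "square_integrable f"
  shows "(norm (to_L2 f))\<^sup>2 = (LINT x|lborel. (cmod (f x))\<^sup>2)"
proof -
  have "cinner (to_L2 f) (to_L2 f) = (LINT x|lborel. complex_of_real ((cmod (f x))\<^sup>2))"
    unfolding cinner_to_L2[OF assms assms]
    by (intro Bochner_Integration.integral_cong) (auto simp: complex_norm_square mult.commute simp
        del: of_real_power)
  also have "\<dots> = complex_of_real (LINT x|lborel. (cmod (f x))\<^sup>2)"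
    by (rule integral_complex_of_real)
  finally show ?thesis
    unfolding cinner_self by (metis of_real_eq_iff)
qed

lemma to_L2_add:
  "square_integrable f \<Longrightarrow> square_integrable g \<Longrightarrow> to_L2 (\<lambda>x. f x + g x) = to_L2 f + to_L2 g"
  by (transfer fixing: f g) (simp add: square_integrable_add L2_rel_def)

lemma to_L2_diff:
  "square_integrable f \<Longrightarrow> square_integrable g \<Longrightarrow> to_L2 (\<lambda>x. f x - g x) = to_L2 f - to_L2 g"
  by (transfer fixing: f g) (simp add: square_integrable_diff L2_rel_def)

lemma to_L2_scaleC: "square_integrable f \<Longrightarrow> to_L2 (\<lambda>x. c * f x) = c *\<^sub>C to_L2 f"
  by (transfer fixing: f c) (simp add: square_integrable_scale L2_rel_def)

lemma L2_representative:
  obtains f where "square_integrable f" "F = to_L2 f"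
proof -
  obtain f where "L2_rel f f" "abs_L2 f = F"
    using Quotient3_L2 unfolding Quotient3_def by (metis Quotient3_L2 Quotient3_abs_rep
        Quotient3_rep_reflp)
  then have "square_integrable f" "F = to_L2 f"
    by (auto simp: L2_rel_def to_L2.abs_eq)
  then show thesis by (rule that)
qed

lemma mult_op_to_L2:
  assumes "m \<in> borel_measurable borel" "bounded (range m)" "square_integrable f"
  shows "mult_op m (to_L2 f) = to_L2 (\<lambda>x. m x * f x)"
proof -
  obtain C where C: "\<And>x. cmod (m x) \<le> C" using assms(2) by (auto simp: bounded_iff)
  have "square_integrable (\<lambda>x. m x * f x)"
    using square_integrable_mult_bounded[OF assms(3,1) C] .
  then show ?thesis
    using assms by (transfer fixing: m f) (simp add: L2_rel_def)
qed

section \<open>Completeness of $L^2$\<close>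

lemma nn_integral_to_L2:
  assumes "square_integrable f"
  shows "(\<integral>\<^sup>+x. ennreal ((cmod (f x))\<^sup>2) \<partial>lborel) = ennreal ((norm (to_L2 f))\<^sup>2)"
  unfolding norm_to_L2[OF assms]
  using assms by (intro nn_integral_eq_integral) (auto simp: square_integrable_def)

lemma Cauchy_imp_geometric_subsequence:
  fixes X :: "nat \<Rightarrow> 'a::real_normed_vector"
  assumes "Cauchy X"
  obtains r where "strict_mono r" "\<And>n. norm (X (r (Suc n)) - X (r n)) \<le> (1/2) ^ n"
proof -
  have "\<exists>N. \<forall>m\<ge>N. \<forall>n\<ge>N. norm (X m - X n) < (1/2) ^ k" for k :: nat
    using assms unfolding Cauchy_def dist_norm by (meson half_gt_zero_iff zero_less_one zero_less_power)
  then obtain N where N: "\<And>k m n. m \<ge> N k \<Longrightarrow> n \<ge> N k \<Longrightarrow> norm (X m - X n) < (1/2) ^ k"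
    by metis
  \<comment> \<open>The sum dominates each \<open>N k\<close> and is strictly monotone.\<close>
  define r where "r k = (\<Sum>j\<le>k. Suc (N j))" for k
  have "strict_mono r" by (rule strict_monoI_Suc) (simp add: r_def)
  moreover have "N k \<le> r k" for k
    unfolding r_def using member_le_sum[of k "{..k}" "\<lambda>j. Suc (N j)"] by simp
  then have "norm (X (r (Suc k)) - X (r k)) \<le> (1/2) ^ k" for k
    using N[of k "r (Suc k)" "r k"] \<open>strict_mono r\<close>
    by (meson le_trans less_imp_le strict_mono_Suc_iff)
  ultimately show thesis by (rule that)
qed

text \<open>For a sequence whose consecutive distances are at most \<open>2^-n\<close>, the series of \<open>2^n |f (n+1) -
  f n|^2\<close> has a finite integral, so almost everywhere its terms are bounded and the increments of
  \<open>f n x\<close> decay geometrically.\<close>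

lemma AE_convergent_if_geometric:
  fixes f :: "nat \<Rightarrow> 'a::euclidean_space \<Rightarrow> complex"
  assumes sq: "\<And>n. square_integrable (f n)"
    and le: "\<And>n. norm (to_L2 (f (Suc n)) - to_L2 (f n)) \<le> (1/2) ^ n"
  shows "AE x in lborel. convergent (\<lambda>n. f n x)"
proof -
  have [measurable]: "f n \<in> borel_measurable borel" for n
    using sq by (auto simp: square_integrable_def)
  \<comment> \<open>The squares have integrals at most \<open>4^-n\<close>, which leaves room for the weight \<open>2^n\<close>.\<close>
  let ?d = "\<lambda>n x. 2 ^ n * (cmod (f (Suc n) x - f n x))\<^sup>2"
  have "(\<integral>\<^sup>+x. ennreal (?d n x) \<partial>lborel) \<le> ennreal ((1/2) ^ n)" for n
  proof -
    have "(\<integral>\<^sup>+x. ennreal (?d n x) \<partial>lborel)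
        = ennreal (2 ^ n) * (\<integral>\<^sup>+x. ennreal ((cmod (f (Suc n) x - f n x))\<^sup>2) \<partial>lborel)"
      by (subst nn_integral_cmult[symmetric]) (auto simp: ennreal_mult'')
    also have "\<dots> = ennreal (2 ^ n * (norm (to_L2 (f (Suc n)) - to_L2 (f n)))\<^sup>2)"
      unfolding nn_integral_to_L2[OF square_integrable_diff[OF sq sq]] to_L2_diff[OF sq sq]
      by (rule ennreal_mult''[symmetric]) simp
    also have "\<dots> \<le> ennreal (2 ^ n * ((1/2) ^ n)\<^sup>2)"
      by (intro ennreal_leI mult_left_mono power_mono le) auto
    also have "2 ^ n * ((1/2) ^ n)\<^sup>2 = ((1/2) ^ n :: real)"
      by (simp add: power_divide power2_eq_square)
    finally show ?thesis .
  qed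
  then have "(\<Sum>n. \<integral>\<^sup>+x. ennreal (?d n x) \<partial>lborel) \<le> (\<Sum>n. ennreal ((1/2) ^ n))"
    by (intro suminf_le) auto
  also have "\<dots> = ennreal (\<Sum>n. (1/2) ^ n)"
    by (rule suminf_ennreal2) (auto intro: summable_geometric)
  also have "\<dots> < \<infinity>" by simp
  finally have "(\<integral>\<^sup>+x. (\<Sum>n. ennreal (?d n x)) \<partial>lborel) < \<infinity>"
    by (subst nn_integral_suminf) auto
  then have "AE x in lborel. (\<Sum>n. ennreal (?d n x)) \<noteq> \<infinity>"
    by (intro nn_integral_PInf_AE) auto
  then show ?thesis
  proof eventually_elim
    case (elim x)
    define c where "c = enn2real (\<Sum>n. ennreal (?d n x))"
    have c: "(\<Sum>n. ennreal (?d n x)) = ennreal c" "0 \<le> c"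
      unfolding c_def using elim by (simp_all add: less_top)
    have "cmod (f (Suc n) x - f n x) \<le> sqrt c * (sqrt (1/2)) ^ n" for n
    proof -
      have "ennreal (?d n x) \<le> ennreal c"
        using sum_le_suminf[of "\<lambda>n. ennreal (?d n x)" "{n}"] by (simp add: c(1))
      then have "?d n x \<le> c" using c(2) by (simp add: ennreal_le_iff)
      then have "(cmod (f (Suc n) x - f n x))\<^sup>2 \<le> c * (1/2) ^ n"
        by (simp add: power_divide field_simps)
      also have "c * (1/2) ^ n = (sqrt c * (sqrt (1/2)) ^ n)\<^sup>2"
      proof -
        have "((sqrt (1/2)) ^ n)\<^sup>2 = (1/2 :: real) ^ n"
          unfolding power_even_eq[symmetric] power_mult by simp
        then show ?thesis using c(2) by (simp add: power_mult_distrib)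
      qed
      finally show ?thesis
        by (rule power2_le_imp_le) (use c(2) in auto)
    qed
    moreover have "summable (\<lambda>n. sqrt c * (sqrt (1/2)) ^ n)"
      by (intro summable_mult summable_geometric) (simp add: real_sqrt_divide)
    ultimately have "summable (\<lambda>n. f (Suc n) x - f n x)"
      using summable_comparison_test'[of "\<lambda>n. sqrt c * (sqrt (1/2)) ^ n" 0 "\<lambda>n. f (Suc n) x - f n x"]
      by blast
    then have "convergent (\<lambda>n. f n x - f 0 x)"
      by (simp add: summable_iff_convergent sum_lessThan_telescope[of "\<lambda>n. f n x"])
    then show ?case
      using convergent_diff_const_right_iff by blast
  qed
qed

text \<open>Riesz-Fischer: the almost everywhere limit of such a subsequence is the limit in the mean,
  by Fatou's lemma.\<close>

instance L2 :: (euclidean_space) banach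
proof
  fix X :: "nat \<Rightarrow> 'a L2"
  assume "Cauchy X"
  then obtain r where r: "strict_mono r" "\<And>n. norm (X (r (Suc n)) - X (r n)) \<le> (1/2) ^ n"
    using Cauchy_imp_geometric_subsequence by metis
  have "\<exists>f. square_integrable f \<and> X (r n) = to_L2 f" for n
    by (metis L2_representative)
  then obtain f where sq: "\<And>n. square_integrable (f n)" and f: "\<And>n. X (r n) = to_L2 (f n)"
    by metis
  have [measurable]: "f n \<in> borel_measurable borel" for n
    using sq by (auto simp: square_integrable_def)
  define g where "g x = lim (\<lambda>n. f n x)" for x
  have g_meas [measurable]: "g \<in> borel_measurable borel"
    unfolding g_def by (rule borel_measurable_lim_metric) simp
  have conv: "AE x in lborel. (\<lambda>n. f n x) \<longlonglongrightarrow> g x"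
    using AE_convergent_if_geometric[OF sq] r(2)
    by (auto simp: f g_def convergent_LIMSEQ_iff elim!: eventually_mono)
  have fatou: "(\<integral>\<^sup>+x. ennreal ((cmod (g x - f n x))\<^sup>2) \<partial>lborel) \<le> ennreal (c\<^sup>2)"
    if c: "0 \<le> c" "\<And>m. m \<ge> n \<Longrightarrow> norm (X (r m) - X (r n)) \<le> c" for n c
  proof -
    have "(\<integral>\<^sup>+x. ennreal ((cmod (g x - f n x))\<^sup>2) \<partial>lborel)
        = (\<integral>\<^sup>+x. liminf (\<lambda>m. ennreal ((cmod (f m x - f n x))\<^sup>2)) \<partial>lborel)"
    proof (rule nn_integral_cong_AE)
      show "AE x in lborel. ennreal ((cmod (g x - f n x))\<^sup>2)
          = liminf (\<lambda>m. ennreal ((cmod (f m x - f n x))\<^sup>2))"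
        using conv
      proof eventually_elim
        case (elim x)
        have "(\<lambda>m. ennreal ((cmod (f m x - f n x))\<^sup>2)) \<longlonglongrightarrow> ennreal ((cmod (g x - f n x))\<^sup>2)"
          by (intro tendsto_ennrealI tendsto_intros elim)
        then show ?case
          using lim_imp_Liminf[OF sequentially_bot] by metis
      qed
    qed
    also have "\<dots> \<le> liminf (\<lambda>m. \<integral>\<^sup>+x. ennreal ((cmod (f m x - f n x))\<^sup>2) \<partial>lborel)"
      by (rule nn_integral_liminf) simp
    also have "\<dots> = liminf (\<lambda>m. ennreal ((norm (X (r m) - X (r n)))\<^sup>2))"
      by (simp add: nn_integral_to_L2 square_integrable_diff sq to_L2_diff f)
    also have "\<dots> \<le> limsup (\<lambda>m. ennreal ((norm (X (r m) - X (r n)))\<^sup>2))"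
      by (rule Liminf_le_Limsup) simp
    also have "\<dots> \<le> ennreal (c\<^sup>2)"
      using c by (intro Limsup_bounded eventually_sequentiallyI[of n] ennreal_leI power_mono) auto
    finally show ?thesis .
  qed
  have sq_diff: "square_integrable (\<lambda>x. g x - f n x)"
    if c: "0 \<le> c" "\<And>m. m \<ge> n \<Longrightarrow> norm (X (r m) - X (r n)) \<le> c" for n c
    using fatou[OF c] le_less_trans[OF fatou[OF c], of \<infinity>]
    by (auto simp: square_integrable_def integrable_iff_bounded)
  have Cauchy_r: "\<exists>N. \<forall>n\<ge>N. \<forall>m\<ge>n. norm (X (r m) - X (r n)) \<le> e" if "0 < e" for e
  proof -
    obtain N where "\<And>m n. m \<ge> N \<Longrightarrow> n \<ge> N \<Longrightarrow> norm (X m - X n) < e"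
      using \<open>Cauchy X\<close> \<open>0 < e\<close> unfolding Cauchy_def dist_norm by metis
    then show ?thesis
      using seq_suble[OF r(1)] by (meson less_imp_le order_trans)
  qed
  have g: "square_integrable g"
  proof -
    obtain N where "\<And>m. m \<ge> N \<Longrightarrow> norm (X (r m) - X (r N)) \<le> 1"
      using Cauchy_r[of 1] by auto
    then have "square_integrable (\<lambda>x. (g x - f N x) + f N x)"
      by (intro square_integrable_add sq sq_diff[of 1]) auto
    then show ?thesis by simp
  qed
  have "(\<lambda>n. X (r n)) \<longlonglongrightarrow> to_L2 g"
  proof (rule LIMSEQ_I)
    fix e :: real
    assume "0 < e"
    then obtain N where N: "\<And>n m. n \<ge> N \<Longrightarrow> m \<ge> n \<Longrightarrow> norm (X (r m) - X (r n)) \<le> e / 2"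
      using Cauchy_r[of "e / 2"] by auto
    have "norm (X (r n) - to_L2 g) < e" if "n \<ge> N" for n
    proof -
      have "ennreal ((norm (to_L2 g - X (r n)))\<^sup>2) \<le> ennreal ((e / 2)\<^sup>2)"
        using fatou[of "e / 2" n] N[OF that] \<open>0 < e\<close>
        by (simp add: f to_L2_diff[OF g sq, symmetric] square_integrable_diff[OF g sq]
            nn_integral_to_L2)
      then have "(norm (to_L2 g - X (r n)))\<^sup>2 \<le> (e / 2)\<^sup>2"
        by (simp add: ennreal_le_iff)
      then have "norm (to_L2 g - X (r n)) \<le> e / 2"
        by (rule power2_le_imp_le) (use \<open>0 < e\<close> in simp)
      then show ?thesis using \<open>0 < e\<close> by (simp add: norm_minus_commute)
    qed
    then show "\<exists>N. \<forall>n\<ge>N. norm (X (r n) - to_L2 g) < e" by blast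
  qed
  then have "X \<longlonglongrightarrow> to_L2 g"
    by (intro Cauchy_converges_subseq[OF \<open>Cauchy X\<close> r(1)]) (simp add: o_def)
  then show "convergent X" by (auto simp: convergent_def)
qed

section \<open>Orthonormal expansions\<close>

lemma bounded_clinear_sum:
  assumes "bounded_clinear T"
  shows "T (\<Sum>i\<in>I. c i *\<^sub>C g i) = (\<Sum>i\<in>I. c i *\<^sub>C T (g i))"
proof -
  have "bounded_linear T" "\<And>c f. T (c *\<^sub>C f) = c *\<^sub>C T f"
    using assms by (auto simp: bounded_clinear_def)
  then show ?thesis
    by (simp add: linear_sum bounded_linear.linear)
qed

text \<open>The orthogonal projection onto the span of \<open>F\<close>, when \<open>F\<close> is finite and orthonormal.\<close>

definition onb_proj :: "'a::euclidean_space L2 set \<Rightarrow> 'a L2 \<Rightarrow> 'a L2" where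
  "onb_proj F f = (\<Sum>e\<in>F. cinner e f *\<^sub>C e)"

lemma cinner_orthonormal_sum:
  assumes "orthonormal F" "finite F" "e \<in> F"
  shows "cinner e (\<Sum>i\<in>F. c i *\<^sub>C i) = c e"
proof -
  have "cinner e (\<Sum>i\<in>F. c i *\<^sub>C i) = (\<Sum>i\<in>F. if e = i then c i else 0)"
    using assms unfolding cinner_sum_right cinner_scaleC_right orthonormal_def
    by (intro sum.cong) auto
  then show ?thesis using assms by simp
qed

lemma norm_orthonormal_sum:
  assumes "orthonormal F" "finite F"
  shows "(norm (\<Sum>i\<in>F. c i *\<^sub>C i))\<^sup>2 = (\<Sum>i\<in>F. (cmod (c i))\<^sup>2)"
proof -
  have "cinner (\<Sum>i\<in>F. c i *\<^sub>C i) (\<Sum>i\<in>F. c i *\<^sub>C i) = (\<Sum>i\<in>F. cnj (c i) * c i)"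
    using assms by (subst cinner_sum_left) (auto simp: cinner_scaleC_left cinner_orthonormal_sum)
  also have "\<dots> = complex_of_real (\<Sum>i\<in>F. (cmod (c i))\<^sup>2)"
    by (simp add: complex_norm_square mult.commute del: of_real_power)
  finally show ?thesis
    unfolding cinner_self by (rule of_real_eq_iff[THEN iffD1])
qed

lemma norm_onb_proj:
  assumes "orthonormal F" "finite F"
  shows "(norm (onb_proj F f))\<^sup>2 = (\<Sum>e\<in>F. (cmod (cinner e f))\<^sup>2)"
  unfolding onb_proj_def by (rule norm_orthonormal_sum[OF assms])

lemma norm_minus_onb_proj:
  assumes "orthonormal F" "finite F"
  shows "(norm (f - onb_proj F f))\<^sup>2 = (norm f)\<^sup>2 - (\<Sum>e\<in>F. (cmod (cinner e f))\<^sup>2)"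
proof -
  have "cinner f (onb_proj F f) = (\<Sum>e\<in>F. cinner e f * cnj (cinner e f))"
    unfolding onb_proj_def cinner_sum_right cinner_scaleC_right
    using cinner_commute[of f] by (intro sum.cong) auto
  also have "\<dots> = complex_of_real (\<Sum>e\<in>F. (cmod (cinner e f))\<^sup>2)"
    by (simp add: complex_norm_square del: of_real_power)
  finally have "inner f (onb_proj F f) = (\<Sum>e\<in>F. (cmod (cinner e f))\<^sup>2)"
    by (metis Re_cinner Re_complex_of_real)
  then show ?thesis
    using norm_onb_proj[OF assms, of f]
    by (simp add: power2_norm_eq_inner inner_diff_left inner_diff_right inner_commute)
qed

lemma orthonormal_subset: "orthonormal B \<Longrightarrow> F \<subseteq> B \<Longrightarrow> orthonormal F"
  unfolding orthonormal_def by (meson subsetD)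

lemma finite_bessel:
  assumes "orthonormal F" "finite F"
  shows "(\<Sum>e\<in>F. (cmod (cinner e f))\<^sup>2) \<le> (norm f)\<^sup>2"
  using norm_minus_onb_proj[OF assms, of f] by (metis diff_ge_0_iff_ge zero_le_power2)

text \<open>Finite sets \<open>F n\<close> that nearly exhaust the supremum of the Bessel sums give projections that
  form a Cauchy sequence; its limit has the same coefficients as \<open>f\<close>, so maximality of the
  orthonormal set forces it to be \<open>f\<close>.\<close>

lemma orthonormal_basis_approximation:
  assumes B: "orthonormal_basis B" and "0 < \<epsilon>"
  obtains F where "finite F" "F \<subseteq> B" "norm (f - onb_proj F f) < \<epsilon>"
proof -
  have orth: "orthonormal F" if "F \<subseteq> B" for F
    using B that orthonormal_subset by (auto simp: orthonormal_basis_def)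
  define a where "a e = (cmod (cinner e f))\<^sup>2" for e
  define \<S> where "\<S> = {F. finite F \<and> F \<subseteq> B}"
  have bdd: "bdd_above (sum a ` \<S>)"
    using finite_bessel[OF orth] by (auto simp: a_def \<S>_def intro!: bdd_aboveI[of _ "(norm f)\<^sup>2"])
  have ne: "\<S> \<noteq> {}" by (auto simp: \<S>_def)
  have "\<exists>F\<in>\<S>. (SUP F\<in>\<S>. sum a F) - (1/2) ^ n < sum a F" for n :: nat
    using less_cSUP_iff[OF ne bdd] by (metis diff_less_eq less_add_same_cancel1
        zero_less_divide_1_iff zero_less_numeral zero_less_power)
  then obtain F where F: "\<And>n. F n \<in> \<S>"
    "\<And>n. (SUP F\<in>\<S>. sum a F) - (1/2) ^ n < sum a (F n)"
    by metis
  define G where "G n = (\<Union>k\<le>n. F k)" for n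
  have G: "finite (G n)" "G n \<subseteq> B" "G n \<in> \<S>" for n
    using F(1) by (auto simp: G_def \<S>_def)
  have G_mono: "G m \<subseteq> G n" if "m \<le> n" for m n
    using that by (auto simp: G_def intro: order_trans)
  have tail: "sum a E < (1/2) ^ n" if E: "finite E" "E \<subseteq> B" "E \<inter> G n = {}" for E n
  proof -
    have "sum a (F n) \<le> sum a (G n)"
      using G by (intro sum_mono2) (auto simp: a_def G_def)
    moreover have "sum a (G n) + sum a E = sum a (G n \<union> E)"
      using G E by (intro sum.union_disjoint[symmetric]) auto
    moreover have "sum a (G n \<union> E) \<le> (SUP F\<in>\<S>. sum a F)"
      using G E by (intro cSUP_upper bdd) (auto simp: \<S>_def)
    ultimately show ?thesis using F(2)[of n] by linarith
  qed
  define X where "X n = onb_proj (G n) f" for n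
  have step: "(norm (X m - X n))\<^sup>2 < (1/2) ^ n" if "n \<le> m" for m n
  proof -
    have "X m - X n = onb_proj (G m - G n) f"
      unfolding X_def onb_proj_def using G G_mono[OF that] by (simp add: sum_diff)
    moreover have "(\<Sum>e\<in>G m - G n. a e) < (1/2) ^ n"
      using G by (intro tail) auto
    moreover have "G m - G n \<subseteq> B" "finite (G m - G n)" using G by blast+
    ultimately show ?thesis
      using norm_onb_proj[OF orth, of "G m - G n" f] by (simp add: a_def)
  qed
  have "Cauchy X"
  proof (rule CauchyI')
    fix e :: real
    assume "0 < e"
    then obtain N :: nat where N: "(1/2) ^ N < e\<^sup>2"
      using real_arch_pow_inv[of "e\<^sup>2" "1/2"] by auto
    have "dist (X m) (X n) < e" if "m \<ge> N" "n > m" for m n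
    proof -
      have "(norm (X n - X m))\<^sup>2 < (1/2) ^ m" using step that by simp
      also have "(1/2) ^ m \<le> ((1/2) ^ N :: real)" using that by (intro power_decreasing) auto
      also note N
      finally show ?thesis
        using \<open>0 < e\<close> by (simp add: dist_norm norm_minus_commute power_less_imp_less_base)
    qed
    then show "\<exists>M. \<forall>m\<ge>M. \<forall>n>m. dist (X m) (X n) < e" by blast
  qed
  then obtain g where g: "X \<longlonglongrightarrow> g"
    using Cauchy_convergent convergent_def by blast
  have coeff: "cinner e g = cinner e f" if "e \<in> B" for e
  proof (rule LIMSEQ_unique)
    show "(\<lambda>n. cinner e (X n)) \<longlonglongrightarrow> cinner e g"
      by (intro bounded_linear.tendsto[OF bounded_linear_cinner_right] g)
    show "(\<lambda>n. cinner e (X n)) \<longlonglongrightarrow> cinner e f"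
    proof (cases "\<exists>n. e \<in> G n")
      case True
      then obtain n where "e \<in> G n" by blast
      then have "cinner e (X m) = cinner e f" if "m \<ge> n" for m
        unfolding X_def onb_proj_def using G G_mono[OF that] orth
        by (intro cinner_orthonormal_sum) auto
      then show ?thesis
        by (intro tendsto_eventually eventually_sequentiallyI[of n])
    next
      case False
      have "a e \<le> (1/2) ^ n" for n
        using tail[of "{e}" n] that False by auto
      then have "a e \<le> 0"
        by (intro LIMSEQ_le_const[OF LIMSEQ_realpow_zero[of "1/2"]]) auto
      then have "cinner e f = 0" by (simp add: a_def)
      moreover have "cinner e (X n) = 0" for n
      proof -
        have "cinner e i = 0" if "i \<in> G n" for i
          using that G False \<open>e \<in> B\<close> B unfolding orthonormal_basis_def orthonormal_def
          by (metis subsetD)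
        then show ?thesis
          by (auto simp: X_def onb_proj_def cinner_sum_right cinner_scaleC_right)
      qed
      ultimately show ?thesis by simp
    qed
  qed
  then have "f - g = 0"
    using B unfolding orthonormal_basis_def by (metis cinner_minus_right diff_self)
  then have "X \<longlonglongrightarrow> f" using g by simp
  then obtain n where "norm (X n - f) < \<epsilon>"
    using LIMSEQ_D[OF _ \<open>0 < \<epsilon>\<close>] by blast
  then show thesis
    using that[of "G n"] G by (simp add: X_def norm_minus_commute)
qed

lemma onb_proj_tendsto:
  assumes B: "orthonormal_basis B"
  shows "((\<lambda>F. onb_proj F f) \<longlongrightarrow> f) (finite_subsets_at_top B)"
proof (rule tendstoI)
  have orth: "orthonormal F" if "F \<subseteq> B" for F
    using B that orthonormal_subset by (auto simp: orthonormal_basis_def)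
  fix \<epsilon> :: real
  assume "0 < \<epsilon>"
  then obtain F where F: "finite F" "F \<subseteq> B" "norm (f - onb_proj F f) < \<epsilon>"
    using orthonormal_basis_approximation[OF B] by metis
  have "dist (onb_proj E f) f < \<epsilon>" if E: "finite E" "F \<subseteq> E" "E \<subseteq> B" for E
  proof -
    have "(norm (f - onb_proj E f))\<^sup>2 \<le> (norm (f - onb_proj F f))\<^sup>2"
      using E F norm_minus_onb_proj[OF orth] by (simp add: sum_mono2)
    then have "norm (f - onb_proj E f) \<le> norm (f - onb_proj F f)"
      by (rule power2_le_imp_le) simp
    then show ?thesis
      using F(3) by (simp add: dist_norm norm_minus_commute)
  qed
  then show "\<forall>\<^sub>F E in finite_subsets_at_top B. dist (onb_proj E f) f < \<epsilon>"
    unfolding eventually_finite_subsets_at_top using F(1,2) by blast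
qed

lemma parseval:
  assumes B: "orthonormal_basis B"
  shows "((\<lambda>e. (cmod (cinner e f))\<^sup>2) has_sum (norm f)\<^sup>2) B"
proof -
  have "((\<lambda>F. (norm (onb_proj F f))\<^sup>2) \<longlongrightarrow> (norm f)\<^sup>2) (finite_subsets_at_top B)"
    by (intro tendsto_intros onb_proj_tendsto[OF B])
  then show ?thesis
    unfolding has_sum_def
  proof (rule Lim_transform_eventually)
    have "\<forall>\<^sub>F F in finite_subsets_at_top B. finite F \<and> F \<subseteq> B"
      by (rule eventually_finite_subsets_at_top_weakI) simp
    then show "\<forall>\<^sub>F F in finite_subsets_at_top B.
        (norm (onb_proj F f))\<^sup>2 = (\<Sum>e\<in>F. (cmod (cinner e f))\<^sup>2)"
      by eventually_elim
        (use B norm_onb_proj orthonormal_subset in \<open>auto simp: orthonormal_basis_def\<close>)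
  qed
qed

section \<open>Bessel families and traces\<close>

text \<open>For a finite family of vectors, \<open>K\<close> bounds the frame operator from above; an orthonormal
  family has \<open>K = 1\<close>.\<close>

definition bessel_family :: "real \<Rightarrow> 'i set \<Rightarrow> ('i \<Rightarrow> 'a::euclidean_space L2) \<Rightarrow> bool" where
  "bessel_family K J \<phi> \<longleftrightarrow> (\<forall>f. (\<Sum>j\<in>J. (cmod (cinner (\<phi> j) f))\<^sup>2) \<le> K * (norm f)\<^sup>2)"

text \<open>Schur's test: if \<open>c j\<close> are the coefficients of \<open>f\<close> and \<open>g\<close> is the combination of the family
  with these coefficients, then the row sums of the Gram matrix bound \<open>norm g\<close>, while the inner
  product of \<open>g\<close> and \<open>f\<close> is the sum of the \<open>|c j|^2\<close>.\<close>

lemma bessel_family_if_almost_orthogonal: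
  assumes "finite J" "0 \<le> K"
    and row: "\<And>j. j \<in> J \<Longrightarrow> (\<Sum>k\<in>J. cmod (cinner (\<phi> j) (\<phi> k))) \<le> K"
  shows "bessel_family K J \<phi>"
  unfolding bessel_family_def
proof
  fix f
  define c where "c j = cinner (\<phi> j) f" for j
  define s where "s = (\<Sum>j\<in>J. (cmod (c j))\<^sup>2)"
  define g where "g = (\<Sum>j\<in>J. c j *\<^sub>C \<phi> j)"
  let ?a = "\<lambda>j k. cmod (cinner (\<phi> j) (\<phi> k))"
  have s0: "0 \<le> s" by (simp add: s_def sum_nonneg)
  have "cinner g f = (\<Sum>j\<in>J. cnj (c j) * c j)"
    by (simp add: g_def cinner_sum_left cinner_scaleC_left c_def)
  also have "\<dots> = complex_of_real s"
    by (simp add: s_def complex_norm_square mult.commute del: of_real_power)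
  finally have "s \<le> norm g * norm f"
    using cmod_cinner_le[of g f] s0 by simp
  have "(norm g)\<^sup>2 = cmod (cinner g g)"
    by (simp add: cinner_self norm_power)
  also have "cinner g g = (\<Sum>j\<in>J. \<Sum>k\<in>J. cnj (c j) * (c k * cinner (\<phi> j) (\<phi> k)))"
    unfolding g_def cinner_sum_left cinner_scaleC_left cinner_sum_right cinner_scaleC_right
    by (subst sum.swap) (simp add: sum_distrib_left mult.left_commute)
  also have "cmod \<dots> \<le> (\<Sum>j\<in>J. \<Sum>k\<in>J. cmod (c j) * cmod (c k) * ?a j k)"
    by (intro sum_norm_le) (simp add: norm_mult mult.assoc)
  also have "\<dots> \<le> (\<Sum>j\<in>J. \<Sum>k\<in>J. ((cmod (c j))\<^sup>2 / 2 + (cmod (c k))\<^sup>2 / 2) * ?a j k)"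
    using sum_squares_bound[of "cmod (c _)" "cmod (c _)"]
    by (intro sum_mono mult_right_mono) (auto simp: field_simps)
  also have "\<dots> = (\<Sum>j\<in>J. \<Sum>k\<in>J. (cmod (c j))\<^sup>2 / 2 * ?a j k)
      + (\<Sum>j\<in>J. \<Sum>k\<in>J. (cmod (c k))\<^sup>2 / 2 * ?a j k)"
    by (simp add: distrib_right sum.distrib)
  also have "(\<Sum>j\<in>J. \<Sum>k\<in>J. (cmod (c k))\<^sup>2 / 2 * ?a j k)
      = (\<Sum>j\<in>J. \<Sum>k\<in>J. (cmod (c j))\<^sup>2 / 2 * ?a j k)"
    by (subst sum.swap) (simp add: cmod_cinner_commute)
  also have "(\<Sum>j\<in>J. \<Sum>k\<in>J. (cmod (c j))\<^sup>2 / 2 * ?a j k)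
      = (\<Sum>j\<in>J. (cmod (c j))\<^sup>2 / 2 * (\<Sum>k\<in>J. ?a j k))"
    by (simp add: sum_distrib_left)
  also have "\<dots> + \<dots> = (\<Sum>j\<in>J. (cmod (c j))\<^sup>2 * (\<Sum>k\<in>J. ?a j k))"
    by (simp add: sum.distrib[symmetric])
  also have "\<dots> \<le> (\<Sum>j\<in>J. (cmod (c j))\<^sup>2 * K)"
    by (intro sum_mono mult_left_mono row) auto
  also have "\<dots> = K * s"
    by (simp add: s_def sum_distrib_left mult.commute)
  finally have "(norm g)\<^sup>2 \<le> K * s" .
  have "s * s \<le> (norm g * norm f) * (norm g * norm f)"
    using \<open>s \<le> norm g * norm f\<close> s0 by (intro mult_mono) auto
  also have "\<dots> = (norm g)\<^sup>2 * (norm f)\<^sup>2"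
    by (simp add: power2_eq_square)
  also have "\<dots> \<le> s * (K * (norm f)\<^sup>2)"
    using mult_right_mono[OF \<open>(norm g)\<^sup>2 \<le> K * s\<close>, of "(norm f)\<^sup>2"] by (simp add: mult_ac)
  finally have "s * s \<le> s * (K * (norm f)\<^sup>2)" .
  then show "(\<Sum>j\<in>J. (cmod (cinner (\<phi> j) f))\<^sup>2) \<le> K * (norm f)\<^sup>2"
    using s0 assms(2) unfolding c_def[symmetric] s_def[symmetric]
    by (cases "s = 0") (auto simp: mult_le_cancel_left)
qed

lemma has_sum_finite_sum:
  fixes a :: "'j \<Rightarrow> 'b :: topological_comm_monoid_add"
  assumes "\<And>j. j \<in> J \<Longrightarrow> (f j has_sum a j) B"
  shows "((\<lambda>x. \<Sum>j\<in>J. f j x) has_sum (\<Sum>j\<in>J. a j)) B"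
  using assms by (induction J rule: infinite_finite_induct) (auto intro: has_sum_add)

text \<open>By Parseval, both sides are sums over the basis of squares of coefficients. For a fixed
  basis vector \<open>e'\<close>, the functional \<open>f \<mapsto> \<langle>e', S f\<rangle>\<close> on the span of \<open>F\<close> is the product with a
  vector \<open>u\<close> whose norm is given by the coefficients of the \<open>S e\<close>, so the Bessel bound applies to
  \<open>u\<close>.\<close>

lemma sum_norm_onb_proj_le:
  assumes B: "orthonormal_basis B" and F: "finite F" "F \<subseteq> B" and J: "finite J"
    and bessel: "bessel_family K J \<phi>" and S: "bounded_clinear S"
  shows "(\<Sum>j\<in>J. (norm (S (onb_proj F (\<phi> j))))\<^sup>2) \<le> K * (\<Sum>e\<in>F. (norm (S e))\<^sup>2)"
proof (rule has_sum_mono)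
  have orth: "orthonormal F"
    using B F orthonormal_subset by (auto simp: orthonormal_basis_def)
  show "((\<lambda>e'. \<Sum>j\<in>J. (cmod (cinner e' (S (onb_proj F (\<phi> j)))))\<^sup>2)
      has_sum (\<Sum>j\<in>J. (norm (S (onb_proj F (\<phi> j))))\<^sup>2)) B"
    by (intro has_sum_finite_sum parseval[OF B])
  show "((\<lambda>e'. K * (\<Sum>e\<in>F. (cmod (cinner e' (S e)))\<^sup>2))
      has_sum K * (\<Sum>e\<in>F. (norm (S e))\<^sup>2)) B"
    by (intro has_sum_cmult_right has_sum_finite_sum parseval[OF B])
  fix e'
  define u where "u = (\<Sum>e\<in>F. cnj (cinner e' (S e)) *\<^sub>C e)"
  have "cinner e' (S (onb_proj F (\<phi> j))) = cinner u (\<phi> j)" for j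
    by (simp add: onb_proj_def bounded_clinear_sum[OF S] u_def cinner_sum_left cinner_sum_right
        cinner_scaleC_left cinner_scaleC_right mult.commute)
  then have "(\<Sum>j\<in>J. (cmod (cinner e' (S (onb_proj F (\<phi> j)))))\<^sup>2) \<le> K * (norm u)\<^sup>2"
    using bessel unfolding bessel_family_def by (simp add: cmod_cinner_commute[of u])
  also have "(norm u)\<^sup>2 = (\<Sum>e\<in>F. (cmod (cinner e' (S e)))\<^sup>2)"
    unfolding u_def norm_orthonormal_sum[OF orth F(1)] by simp
  finally show "(\<Sum>j\<in>J. (cmod (cinner e' (S (onb_proj F (\<phi> j)))))\<^sup>2)
      \<le> K * (\<Sum>e\<in>F. (cmod (cinner e' (S e)))\<^sup>2)" .
qed

text \<open>A Bessel family sees at most \<open>K\<close> times the trace. The \<open>\<phi> j\<close> are first projected onto the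
  span of a finite part of the basis, where the previous lemma can be integrated over \<open>t\<close>; then
  the finite part exhausts the basis. Writing \<open>T\<close> as an integral of \<open>S\<^sup>* S\<close> replaces the square
  root of \<open>T\<close>.\<close>

lemma sum_bessel_family_le_trace:
  assumes B: "orthonormal_basis B" and J: "finite J" "bessel_family K J \<phi>" "0 \<le> K"
    and T: "bounded_clinear T"
    and S: "\<And>t. bounded_clinear (S t)" "\<And>f. integrable \<mu> (\<lambda>t. (norm (S t f))\<^sup>2)"
      "\<And>f. Re (cinner f (T f)) = (LINT t|\<mu>. (norm (S t f))\<^sup>2)"
    and M: "\<And>F. finite F \<Longrightarrow> F \<subseteq> B \<Longrightarrow> (\<Sum>e\<in>F. Re (cinner e (T e))) \<le> M"
  shows "(\<Sum>j\<in>J. Re (cinner (\<phi> j) (T (\<phi> j)))) \<le> K * M"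
proof (rule tendsto_upperbound)
  let ?q = "\<lambda>f. inner f (T f)"
  have "bounded_linear T" using T by (simp add: bounded_clinear_def)
  then show "((\<lambda>F. \<Sum>j\<in>J. ?q (onb_proj F (\<phi> j))) \<longlongrightarrow> (\<Sum>j\<in>J. Re (cinner (\<phi> j) (T (\<phi> j)))))
      (finite_subsets_at_top B)"
    unfolding Re_cinner
    by (intro tendsto_intros onb_proj_tendsto[OF B] bounded_linear.tendsto[of T])
  have "\<forall>\<^sub>F F in finite_subsets_at_top B. finite F \<and> F \<subseteq> B"
    by (rule eventually_finite_subsets_at_top_weakI) simp
  then show "\<forall>\<^sub>F F in finite_subsets_at_top B. (\<Sum>j\<in>J. ?q (onb_proj F (\<phi> j))) \<le> K * M"
  proof eventually_elim
    case (elim F)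
    have "(\<Sum>j\<in>J. ?q (onb_proj F (\<phi> j)))
        = (LINT t|\<mu>. (\<Sum>j\<in>J. (norm (S t (onb_proj F (\<phi> j))))\<^sup>2))"
      by (simp add: Re_cinner[symmetric] S)
    also have "\<dots> \<le> (LINT t|\<mu>. K * (\<Sum>e\<in>F. (norm (S t e))\<^sup>2))"
      using elim by (intro integral_mono sum_norm_onb_proj_le[OF B] J S) (auto simp: S)
    also have "\<dots> = K * (\<Sum>e\<in>F. Re (cinner e (T e)))"
      by (simp add: S)
    also have "\<dots> \<le> K * M"
      using elim J by (intro mult_left_mono M) auto
    finally show ?case .
  qed
qed simp

section \<open>Moments of a positive operator\<close>

text \<open>The quadratic polynomial \<open>r \<mapsto> \<langle>f + r g, A (f + r g)\<rangle>\<close> is nonnegative, so its discriminant is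
  not positive.\<close>

lemma positive_form_cauchy_schwarz:
  fixes A :: "'a::real_inner \<Rightarrow> 'a"
  assumes "linear A" and sym: "\<And>f g. inner f (A g) = inner (A f) g"
    and pos: "\<And>f. 0 \<le> inner f (A f)"
  shows "(inner f (A g))\<^sup>2 \<le> inner f (A f) * inner g (A g)"
proof -
  define a b c where "a = inner f (A f)" and "b = inner f (A g)" and "c = inner g (A g)"
  have b': "inner g (A f) = b"
    unfolding b_def by (metis sym inner_commute)
  have quad: "0 \<le> a + 2 * r * b + r\<^sup>2 * c" for r
  proof -
    have "0 \<le> inner (f + r *\<^sub>R g) (A (f + r *\<^sub>R g))" by (rule pos)
    also have "\<dots> = a + 2 * r * b + r\<^sup>2 * c"
      using \<open>linear A\<close> b'
      by (simp add: linear_add linear_scale inner_add_left inner_add_right a_def b_def c_def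
          power2_eq_square algebra_simps)
    finally show ?thesis .
  qed
  have "0 \<le> c" unfolding c_def by (rule pos)
  have "b\<^sup>2 \<le> a * c"
  proof (cases "c = 0")
    case True
    have "b = 0"
    proof (rule ccontr)
      assume "b \<noteq> 0"
      then show False
        using quad[of "- (a + 1) / (2 * b)"] True by (simp add: field_simps)
    qed
    then show ?thesis using True by simp
  next
    case False
    then show ?thesis
      using quad[of "- b / c"] \<open>0 \<le> c\<close> by (simp add: field_simps power2_eq_square)
  qed
  then show ?thesis by (simp add: a_def b_def c_def)
qed

lemma inner_funpow_symmetric:
  fixes A :: "'a::real_inner \<Rightarrow> 'a"
  assumes sym: "\<And>f g. inner f (A g) = inner (A f) g"
  shows "inner ((A ^^ i) f) ((A ^^ j) g) = inner f ((A ^^ (i + j)) g)"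
proof (induction i arbitrary: j)
  case (Suc i)
  have "inner ((A ^^ Suc i) f) ((A ^^ j) g) = inner ((A ^^ i) f) ((A ^^ Suc j) g)"
    by (simp add: sym)
  then show ?case using Suc[of "Suc j"] by simp
qed simp

text \<open>Jensen's inequality for the spectral measure of \<open>\<phi>\<close>, without the spectral theorem. The
  moments \<open>m k = \<langle>\<phi>, A^k \<phi>\<rangle>\<close> are log-convex by Cauchy-Schwarz, for the inner product or for the
  form of \<open>A\<close> according to the parity of \<open>k\<close>; so the ratios \<open>m (k + 1) / m k\<close> increase from \<open>m
  1\<close>.\<close>

lemma power_inner_le_inner_funpow:
  fixes A :: "'a::real_inner \<Rightarrow> 'a"
  assumes A: "linear A" and sym: "\<And>f g. inner f (A g) = inner (A f) g"
    and pos: "\<And>f. 0 \<le> inner f (A f)" and "norm \<phi> = 1"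
  shows "(inner \<phi> (A \<phi>)) ^ n \<le> inner \<phi> ((A ^^ n) \<phi>)"
proof -
  define m where "m k = inner \<phi> ((A ^^ k) \<phi>)" for k
  have m: "inner ((A ^^ i) \<phi>) ((A ^^ j) \<phi>) = m (i + j)" for i j
    unfolding m_def by (rule inner_funpow_symmetric[OF sym])
  have m_pos: "0 \<le> m k" for k
  proof (cases "even k")
    case True
    then obtain i where "k = i + i" by (metis evenE mult_2)
    then show ?thesis by (simp flip: m)
  next
    case False
    then obtain i where "k = i + Suc i" by (metis oddE mult_2 add_Suc_right Suc_eq_plus1)
    then show ?thesis using pos[of "(A ^^ i) \<phi>"] m[of i "Suc i"] by simp
  qed
  have convex: "(m (Suc k))\<^sup>2 \<le> m k * m (Suc (Suc k))" for k
  proof (cases "even k")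
    case True
    then obtain i where k: "k = i + i" by (metis evenE mult_2)
    have "(inner ((A ^^ i) \<phi>) ((A ^^ Suc i) \<phi>))\<^sup>2
        \<le> inner ((A ^^ i) \<phi>) ((A ^^ i) \<phi>) * inner ((A ^^ Suc i) \<phi>) ((A ^^ Suc i) \<phi>)"
      by (rule Cauchy_Schwarz_ineq)
    then show ?thesis unfolding m k by simp
  next
    case False
    then obtain i where k: "k = i + Suc i" by (metis oddE mult_2 add_Suc_right Suc_eq_plus1)
    have "(inner ((A ^^ i) \<phi>) ((A ^^ Suc (Suc i)) \<phi>))\<^sup>2
        \<le> inner ((A ^^ i) \<phi>) ((A ^^ Suc i) \<phi>) * inner ((A ^^ Suc i) \<phi>) ((A ^^ Suc (Suc i)) \<phi>)"
      using positive_form_cauchy_schwarz[OF A sym pos, of "(A ^^ i) \<phi>" "(A ^^ Suc i) \<phi>"] by simp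
    then show ?thesis unfolding m k by simp
  qed
  have m0: "m 0 = 1"
    using \<open>norm \<phi> = 1\<close> by (simp add: m_def flip: power2_norm_eq_inner)
  have ratio: "m 1 * m k \<le> m (Suc k)" for k
  proof (induction k)
    case 0
    show ?case by (simp add: m0)
  next
    case (Suc k)
    show ?case
    proof (cases "m (Suc k) = 0")
      case True
      then show ?thesis by (simp add: m_pos)
    next
      case False
      then have pos': "0 < m (Suc k)" using m_pos[of "Suc k"] by simp
      then have "m k \<noteq> 0" using convex[of k] by auto
      then have "0 < m k" using m_pos[of k] by simp
      have "m k * (m 1 * m (Suc k)) \<le> (m (Suc k))\<^sup>2"
        using mult_right_mono[OF Suc, of "m (Suc k)"] pos' by (simp add: power2_eq_square mult_ac)
      also have "\<dots> \<le> m k * m (Suc (Suc k))" by (rule convex)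
      finally show ?thesis using \<open>0 < m k\<close> by simp
    qed
  qed
  have "m 1 ^ n \<le> m n"
  proof (induction n)
    case (Suc n)
    have "m 1 * m 1 ^ n \<le> m 1 * m n"
      by (intro mult_left_mono Suc m_pos)
    with ratio[of n] show ?case by simp
  qed (simp add: m0)
  then show ?thesis by (simp add: m_def)
qed

section \<open>Integration on Euclidean space\<close>

lemma integral_dominated_convergence_at_zero:
  fixes s :: "real \<Rightarrow> 'a \<Rightarrow> 'b::{banach, second_countable_topology}"
  assumes meas: "f \<in> borel_measurable M" "\<And>t. s t \<in> borel_measurable M" "integrable M w"
    and lim: "\<And>x. ((\<lambda>t. s t x) \<longlongrightarrow> f x) (at 0)"
    and bound: "\<And>t x. t \<noteq> 0 \<Longrightarrow> \<bar>t\<bar> \<le> 1 \<Longrightarrow> norm (s t x) \<le> w x"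
  shows "((\<lambda>t. integral\<^sup>L M (s t)) \<longlongrightarrow> integral\<^sup>L M f) (at 0)"
  unfolding tendsto_at_iff_sequentially
proof (intro allI impI)
  fix X :: "nat \<Rightarrow> real"
  assume X: "\<forall>i. X i \<in> UNIV - {0}" "X \<longlonglongrightarrow> 0"
  obtain N where N: "\<And>n. n \<ge> N \<Longrightarrow> \<bar>X n\<bar> < 1"
    using LIMSEQ_D[OF X(2), of 1] by auto
  have "(\<lambda>n. integral\<^sup>L M (s (X (n + N)))) \<longlonglongrightarrow> integral\<^sup>L M f"
  proof (rule integral_dominated_convergence[where w = w])
    show "AE x in M. (\<lambda>n. s (X (n + N)) x) \<longlonglongrightarrow> f x"
    proof (rule AE_I2)
      fix x
      have "((\<lambda>t. s t x) \<circ> X) \<longlonglongrightarrow> f x"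
        using lim[of x] X unfolding tendsto_at_iff_sequentially by blast
      then show "(\<lambda>n. s (X (n + N)) x) \<longlonglongrightarrow> f x"
        by (auto simp: o_def intro: LIMSEQ_ignore_initial_segment)
    qed
    show "AE x in M. norm (s (X (n + N)) x) \<le> w x" for n
      using N[of "n + N"] X(1) by (intro AE_I2 bound) auto
  qed (use meas in auto)
  then show "((\<lambda>t. integral\<^sup>L M (s t)) \<circ> X) \<longlonglongrightarrow> integral\<^sup>L M f"
    unfolding o_def by (rule LIMSEQ_offset)
qed

lemma has_vector_derivative_iff_quotient:
  "(f has_vector_derivative v) (at t) \<longleftrightarrow> ((\<lambda>s. (f (t + s) - f t) /\<^sub>R s) \<longlongrightarrow> v) (at 0)"
proof -
  have "norm (f (t + s) - f t - s *\<^sub>R v) / norm s = norm ((f (t + s) - f t) /\<^sub>R s - v)"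
    if "s \<noteq> 0" for s :: real
  proof -
    have "(f (t + s) - f t) /\<^sub>R s - v = (f (t + s) - f t - s *\<^sub>R v) /\<^sub>R s"
      using that by (simp add: scaleR_diff_right)
    then show ?thesis by (simp add: divide_inverse mult.commute)
  qed
  then have "((\<lambda>s. norm (f (t + s) - f t - s *\<^sub>R v) / norm s) \<longlongrightarrow> 0) (at 0) \<longleftrightarrow>
      ((\<lambda>s. norm ((f (t + s) - f t) /\<^sub>R s - v)) \<longlongrightarrow> 0) (at 0)"
    by (intro filterlim_cong refl) (auto simp: eventually_at_filter)
  then show ?thesis
    unfolding has_vector_derivative_def has_derivative_at tendsto_norm_zero_iff LIM_zero_iff
    by (simp add: bounded_linear_scaleR_left)
qed

lemma integral_translation:
  fixes f :: "'a::euclidean_space \<Rightarrow> 'b::{banach, second_countable_topology}"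
  assumes [measurable]: "f \<in> borel_measurable borel"
  shows "(LINT x|lborel. f (x + c)) = (LINT x|lborel. f x)"
    and "integrable lborel f \<Longrightarrow> integrable lborel (\<lambda>x. f (x + c))"
proof -
  have *: "lborel = distr lborel borel (\<lambda>x. x + c)"
    using lborel_distr_plus[of c] by (simp add: add.commute[of _ c] cong: distr_cong)
  show "(LINT x|lborel. f (x + c)) = (LINT x|lborel. f x)"
    by (subst (2) *, subst integral_distr) auto
  show "integrable lborel (\<lambda>x. f (x + c))" if "integrable lborel f"
    using that by (subst (asm) *, subst (asm) integrable_distr_eq) auto
qed

lemma compact_support_integrable:
  fixes f :: "'a::euclidean_space \<Rightarrow> 'b::{banach, second_countable_topology}"
  assumes "continuous_on UNIV f" "\<And>x. R < norm x \<Longrightarrow> f x = 0"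
  shows "integrable lborel f"
proof -
  have "integrable lborel (\<lambda>x. indicator (cball 0 R) x *\<^sub>R f x)"
    by (intro borel_integrable_compact continuous_on_subset[OF assms(1)]) auto
  moreover have "(\<lambda>x. indicator (cball 0 R) x *\<^sub>R f x) = f"
    using assms(2) by (force simp: indicator_def)
  ultimately show ?thesis by simp
qed

lemma compact_support_square_integrable:
  assumes "continuous_on UNIV f" "\<And>x. R < norm x \<Longrightarrow> f x = 0"
  shows "square_integrable f"
  unfolding square_integrable_def
proof
  show "f \<in> borel_measurable borel" using assms(1) by (rule borel_measurable_continuous_onI)
  show "integrable lborel (\<lambda>x. (cmod (f x))\<^sup>2)"
    using assms by (intro compact_support_integrable[where R = R] continuous_intros) auto
qed

lemma compact_support_bounded:
  fixes f :: "'a::euclidean_space \<Rightarrow> 'b::real_normed_vector"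
  assumes "continuous_on UNIV f" "\<And>x. R < norm x \<Longrightarrow> f x = 0"
  obtains C where "0 \<le> C" "\<And>x. norm (f x) \<le> C"
proof -
  have "bounded (f ` cball 0 R)"
    using assms(1) continuous_on_subset compact_continuous_image compact_imp_bounded
    by (metis compact_cball subset_UNIV)
  then obtain C where C: "\<And>x. x \<in> cball 0 R \<Longrightarrow> norm (f x) \<le> C"
    by (metis bounded_iff imageI)
  have "norm (f x) \<le> max C 0" for x
    using C[of x] assms(2)[of x] by (cases "R < norm x") (auto simp: le_max_iff_disj)
  then show thesis using that[of "max C 0"] by simp
qed

text \<open>The difference quotients of \<open>F\<close> have integral zero because Lebesgue measure is translation
  invariant, and they converge to the derivative boundedly on a fixed ball.\<close>

lemma integral_directional_derivative_zero:
  fixes F :: "'a::euclidean_space \<Rightarrow> complex"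
  assumes F: "continuous_on UNIV F" "\<And>x. R < norm x \<Longrightarrow> F x = 0"
    and F': "continuous_on UNIV F'" "\<And>x. R < norm x \<Longrightarrow> F' x = 0"
    and deriv: "\<And>x. ((\<lambda>s. F (x + s *\<^sub>R b)) has_vector_derivative F' x) (at 0)"
  shows "(LINT x|lborel. F' x) = 0"
proof -
  have [measurable]: "F \<in> borel_measurable borel" "F' \<in> borel_measurable borel"
    using F F' by (auto intro: borel_measurable_continuous_onI)
  obtain C where C: "0 \<le> C" "\<And>x. cmod (F' x) \<le> C"
    using compact_support_bounded[OF F'] by blast
  have deriv': "((\<lambda>s. F (x + s *\<^sub>R b)) has_vector_derivative F' (x + t *\<^sub>R b)) (at t)" for x t
  proof -
    have "((\<lambda>s. F (x + t *\<^sub>R b + (s - t) *\<^sub>R b)) has_vector_derivative 1 *\<^sub>R F' (x + t *\<^sub>R b)) (at t)"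
      by (rule vector_diff_chain_at[of "\<lambda>s. s - t" 1 t "\<lambda>s. F (x + t *\<^sub>R b + s *\<^sub>R b)", unfolded o_def])
        (auto intro!: derivative_eq_intros deriv)
    then show ?thesis by (simp add: algebra_simps)
  qed
  define q where "q s x = (F (x + s *\<^sub>R b) - F x) /\<^sub>R s - F' x" for s x
  have q_bound: "cmod (q s x) \<le> 2 * C * indicator (cball 0 (R + norm b)) x"
    if "s \<noteq> 0" "\<bar>s\<bar> \<le> 1" for s x
  proof (cases "x \<in> cball 0 (R + norm b)")
    case True
    have "norm (F (x + s *\<^sub>R b) - F (x + 0 *\<^sub>R b) - (s - 0) *\<^sub>R F' (x + 0 *\<^sub>R b)) \<le> norm (s - 0) *
        (2 * C)"
    proof (rule vector_differentiable_bound_linearization[where S = UNIV and f' = "\<lambda>t. F' (x + t *\<^sub>R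
        b)"])
      show "norm (F' (x + t *\<^sub>R b) - F' (x + 0 *\<^sub>R b)) \<le> 2 * C" for t
        using norm_triangle_ineq4[of "F' (x + t *\<^sub>R b)" "F' (x + 0 *\<^sub>R b)"]
          C(2)[of "x + t *\<^sub>R b"] C(2)[of "x + 0 *\<^sub>R b"] by linarith
    qed (auto intro: deriv')
    moreover have "q s x = (F (x + s *\<^sub>R b) - F x - s *\<^sub>R F' x) /\<^sub>R s"
      using that by (simp add: q_def scaleR_diff_right)
    ultimately show ?thesis
      using that True by (simp add: norm_divide divide_simps mult.commute)
  next
    case False
    have "norm (s *\<^sub>R b) \<le> norm b" using that by (simp add: mult_left_le_one_le)
    then have "norm (x + s *\<^sub>R b) \<ge> norm x - norm b"
      using norm_diff_ineq[of x "s *\<^sub>R b"] by linarith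
    moreover have "R + norm b < norm x" using False by simp
    ultimately have "R < norm (x + s *\<^sub>R b)" "R < norm x"
      using norm_ge_zero[of b] by linarith+
    then show ?thesis using False by (simp add: q_def F F')
  qed
  have "((\<lambda>s. LINT x|lborel. q s x) \<longlongrightarrow> (LINT x|(lborel :: 'a measure). 0)) (at 0)"
  proof (rule integral_dominated_convergence_at_zero)
    show "integrable lborel (\<lambda>x. 2 * C * indicator (cball (0::'a) (R + norm b)) x)"
      by (intro integrable_mult_right integrable_real_indicator) (use emeasure_bounded_finite[OF
          bounded_cball] in auto)
    show "((\<lambda>s. q s x) \<longlongrightarrow> 0) (at 0)" for x
      using tendsto_diff[OF deriv[of x, unfolded has_vector_derivative_iff_quotient]
          tendsto_const[of "F' x"]]
      by (simp add: q_def)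
    show "q s \<in> borel_measurable lborel" for s unfolding q_def by measurable
  qed (use q_bound in auto)
  moreover have "(LINT x|lborel. q s x) = - (LINT x|lborel. F' x)" for s
  proof -
    have int: "integrable lborel F" "integrable lborel F'"
      using compact_support_integrable[OF F] compact_support_integrable[OF F'] by auto
    have "(LINT x|lborel. q s x)
        = (LINT x|lborel. F (x + s *\<^sub>R b) - F x) /\<^sub>R s - (LINT x|lborel. F' x)"
      unfolding q_def using int integral_translation(2)[OF _ int(1)]
      by (subst Bochner_Integration.integral_diff) auto
    also have "(LINT x|lborel. F (x + s *\<^sub>R b) - F x) = 0"
      using int integral_translation[of F "s *\<^sub>R b"] by simp
    finally show ?thesis by simp
  qed
  ultimately have "((\<lambda>s::real. - (LINT x|lborel. F' x)) \<longlongrightarrow> 0) (at 0)" by simp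
  then show ?thesis by (simp add: tendsto_const_iff)
qed

text \<open>The Gaussian is a product over the coordinates, which reduces the claim to the normal
  density on the line.\<close>

lemma integrable_gaussian: "integrable lborel (\<lambda>x::'a::euclidean_space. exp (- (norm x)\<^sup>2))"
proof -
  have "integrable lborel (\<lambda>x::real. exp (- x\<^sup>2))"
  proof -
    have "integrable lborel (\<lambda>x::real. sqrt pi * normal_density 0 (sqrt (1/2)) x)" by simp
    moreover have "(\<lambda>x::real. sqrt pi * normal_density 0 (sqrt (1/2)) x) = (\<lambda>x. exp (- x\<^sup>2))"
      by (auto simp: normal_density_def field_simps)
    ultimately show ?thesis by simp
  qed
  then have fin: "(\<integral>\<^sup>+x. ennreal (exp (- x\<^sup>2)) \<partial>(lborel :: real measure)) < \<infinity>"
    by (simp add: integrable_iff_bounded)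
  have "(\<integral>\<^sup>+x. ennreal (exp (- (norm x)\<^sup>2)) \<partial>(lborel :: 'a measure))
      = (\<integral>\<^sup>+x. (\<Prod>b\<in>Basis. ennreal (exp (- (x \<bullet> b)\<^sup>2))) \<partial>(lborel :: 'a measure))"
  proof (rule nn_integral_cong)
    fix x :: 'a
    have "(norm x)\<^sup>2 = (\<Sum>b\<in>Basis. (x \<bullet> b)\<^sup>2)"
      unfolding power2_norm_eq_inner by (subst euclidean_inner) (simp add: power2_eq_square)
    then show "ennreal (exp (- (norm x)\<^sup>2)) = (\<Prod>b\<in>Basis. ennreal (exp (- (x \<bullet> b)\<^sup>2)))"
      by (simp add: prod_ennreal flip: exp_sum sum_negf)
  qed
  also have "\<dots> = (\<Prod>b\<in>(Basis :: 'a set). \<integral>\<^sup>+x. ennreal (exp (- x\<^sup>2)) \<partial>(lborel :: real measure))"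
    by (rule nn_integral_lborel_prod) auto
  also have "\<dots> < \<infinity>"
    using fin by (simp add: power_less_top_ennreal)
  finally show ?thesis
    by (simp add: integrable_iff_bounded)
qed

lemma square_integrable_if_gaussian_bound:
  assumes [measurable]: "f \<in> borel_measurable borel" and bound: "\<And>x. cmod (f x) \<le> C * exp (- (norm
      x)\<^sup>2)"
  shows "square_integrable f"
  unfolding square_integrable_def
proof
  have C: "0 \<le> C"
    using order_trans[OF norm_ge_zero bound[of 0]] by simp
  have "integrable lborel (\<lambda>x. C\<^sup>2 * exp (- (norm (x::'a))\<^sup>2))"
    by (intro integrable_mult_right integrable_gaussian)
  then show "integrable lborel (\<lambda>x. (cmod (f x))\<^sup>2)"
  proof (rule Bochner_Integration.integrable_bound, measurable, intro AE_I2)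
    fix x
    have "(cmod (f x))\<^sup>2 \<le> (C * exp (- (norm x)\<^sup>2))\<^sup>2"
      by (intro power_mono bound) simp
    also have "\<dots> = C\<^sup>2 * (exp (- (norm x)\<^sup>2) * exp (- (norm x)\<^sup>2))"
      by (simp add: power2_eq_square)
    also have "\<dots> \<le> C\<^sup>2 * (exp (- (norm x)\<^sup>2) * 1)"
      by (intro mult_left_mono) auto
    finally show "norm ((cmod (f x))\<^sup>2) \<le> norm (C\<^sup>2 * exp (- (norm x)\<^sup>2))" by simp
  qed
qed measurable

section \<open>Coherent states\<close>

text \<open>A point of phase space is a pair of a position \<open>a\<close> and a momentum \<open>b\<close>, thought of as the
  complex vector \<open>w = a + i b\<close>. This is \<open>w \<bullet> x\<close> for the complex bilinear extension of the inner
  product, and \<open>wsq\<close> below is \<open>w \<bullet> w\<close>.\<close>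

definition wdot :: "'a::euclidean_space \<Rightarrow> 'a \<Rightarrow> 'a \<Rightarrow> complex" where
  "wdot a b x = Complex (a \<bullet> x) (b \<bullet> x)"

definition wsq :: "'a::euclidean_space \<Rightarrow> 'a \<Rightarrow> complex" where
  "wsq a b = Complex (a \<bullet> a - b \<bullet> b) (2 * (a \<bullet> b))"

text \<open>The generating function of the Hermite functions, which is a coherent state up to a constant
  factor. Since it depends on \<open>w\<close> holomorphically, without a factor in \<open>|w|\<close>, the oscillator acts
  on it as \<open>d/2 + w \<bullet> \<partial>\<^sub>w\<close>; its flow is then \<open>w \<mapsto> e^it w\<close> with the phase \<open>e^(i d t / 2)\<close>.\<close>

definition packet :: "'a::euclidean_space \<Rightarrow> 'a \<Rightarrow> 'a \<Rightarrow> complex" where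
  "packet a b x = exp (2 * pi * wdot a b x - pi / 2 * wsq a b - pi * (norm x)\<^sup>2)"

text \<open>The oscillator acts on \<open>packet a b\<close> as multiplication by this function.\<close>

definition energy :: "'a::euclidean_space \<Rightarrow> 'a \<Rightarrow> 'a \<Rightarrow> complex" where
  "energy a b x = DIM('a) / 2 + 2 * pi * wdot a b x - pi * wsq a b"

text \<open>The real part of \<open>e^it (a + i b)\<close>. The imaginary part is \<open>rot t b (- a)\<close>, because \<open>- i (a +
  i b) = b - i a\<close>.\<close>

definition rot :: "real \<Rightarrow> 'a::euclidean_space \<Rightarrow> 'a \<Rightarrow> 'a" where
  "rot t a b = cos t *\<^sub>R a - sin t *\<^sub>R b"

lemma norm_rot: "(norm (rot t a b))\<^sup>2 + (norm (rot t b (- a)))\<^sup>2 = (norm a)\<^sup>2 + (norm b)\<^sup>2"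
proof -
  have "(norm (c *\<^sub>R a - s *\<^sub>R b))\<^sup>2 + (norm (c *\<^sub>R b - s *\<^sub>R (- a)))\<^sup>2
      = (c\<^sup>2 + s\<^sup>2) * ((norm a)\<^sup>2 + (norm b)\<^sup>2)" for c s :: real
    unfolding power2_norm_eq_inner
    by (simp add: inner_diff_left inner_diff_right inner_add_left inner_add_right inner_commute
        power2_eq_square algebra_simps)
  then show ?thesis by (simp add: rot_def)
qed

lemma wdot_rot: "wdot (rot t a b) (rot t b (- a)) x = cis t * wdot a b x"
  by (simp add: wdot_def rot_def complex_eq_iff inner_diff_left inner_add_left)

lemma wsq_rot: "wsq (rot t a b) (rot t b (- a)) = cis (2 * t) * wsq a b"
proof -
  have "wsq (c *\<^sub>R a - s *\<^sub>R b) (c *\<^sub>R b - s *\<^sub>R (- a)) = Complex (c\<^sup>2 - s\<^sup>2) (2 * s * c) * wsq a b"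
    for c s :: real
    by (simp add: wsq_def complex_eq_iff inner_diff_left inner_diff_right inner_add_left
        inner_add_right inner_commute power2_eq_square algebra_simps)
  moreover have "cis (2 * t) = Complex ((cos t)\<^sup>2 - (sin t)\<^sup>2) (2 * sin t * cos t)"
    by (simp add: complex_eq_iff cos_double sin_double)
  ultimately show ?thesis by (simp add: rot_def)
qed

lemma continuous_wdot [continuous_intros]: "continuous_on S (wdot a b)"
  unfolding wdot_def by (intro continuous_intros)

lemma continuous_packet [continuous_intros]: "continuous_on S (packet a b)"
  unfolding packet_def by (intro continuous_intros)

lemma continuous_energy [continuous_intros]: "continuous_on S (energy a b)"
  unfolding energy_def by (intro continuous_intros)

lemma borel_packet [measurable]: "packet a b \<in> borel_measurable borel"
  "energy a b \<in> borel_measurable borel"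
  by (intro borel_measurable_continuous_onI continuous_intros)+

lemma cmod_packet:
  "cmod (packet a b x) = exp (- pi * (norm (x - a))\<^sup>2 + pi / 2 * ((norm a)\<^sup>2 + (norm b)\<^sup>2))"
  unfolding packet_def norm_exp_eq_Re
  by (simp add: wdot_def wsq_def power2_norm_eq_inner inner_diff_left inner_diff_right inner_commute
      field_simps)

lemma cmod_wdot_le: "cmod (wdot a b x) \<le> (norm a + norm b) * norm x"
proof -
  have "cmod (wdot a b x) \<le> \<bar>a \<bullet> x\<bar> + \<bar>b \<bullet> x\<bar>"
    using cmod_le[of "wdot a b x"] by (simp add: wdot_def)
  also have "\<dots> \<le> norm a * norm x + norm b * norm x"
    by (intro add_mono Cauchy_Schwarz_ineq2)
  finally show ?thesis by (simp add: distrib_right)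
qed

lemma cmod_wsq_le: "cmod (wsq a b) \<le> (norm a + norm b)\<^sup>2"
proof -
  have "cmod (wsq a b) \<le> \<bar>(norm a)\<^sup>2 - (norm b)\<^sup>2\<bar> + 2 * \<bar>a \<bullet> b\<bar>"
    using cmod_le[of "wsq a b"] by (simp add: wsq_def power2_norm_eq_inner abs_mult)
  also have "\<dots> \<le> ((norm a)\<^sup>2 + (norm b)\<^sup>2) + 2 * (norm a * norm b)"
    by (intro add_mono mult_left_mono Cauchy_Schwarz_ineq2) (auto simp: abs_le_iff)
  finally show ?thesis by (simp add: power2_sum)
qed

subsection \<open>Inner products\<close>

text \<open>The square norm of \<open>packet 0 0\<close>, a common factor of all the Gaussian integrals below.\<close>

definition gauss_mass :: "'a::euclidean_space itself \<Rightarrow> real" where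
  "gauss_mass _ = (LINT x|(lborel :: 'a measure). exp (- 2 * pi * (norm x)\<^sup>2))"

lemma integrable_gauss:
  "integrable lborel (\<lambda>x::'a::euclidean_space. exp (- 2 * pi * (norm (x - c))\<^sup>2))"
proof -
  have "integrable lborel (\<lambda>x::'a. exp (- 2 * pi * (norm x)\<^sup>2))"
  proof (rule Bochner_Integration.integrable_bound[OF integrable_gaussian], measurable, intro AE_I2)
    fix x :: 'a
    have "1 * (norm x)\<^sup>2 \<le> 2 * pi * (norm x)\<^sup>2"
      using pi_gt3 by (intro mult_right_mono) auto
    then show "norm (exp (- 2 * pi * (norm x)\<^sup>2)) \<le> norm (exp (- (norm x)\<^sup>2))" by simp
  qed
  from integral_translation(2)[OF _ this, of "- c"] show ?thesis by simp
qed

lemma integral_gauss: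
  fixes c :: "'a::euclidean_space"
  shows "(LINT x|lborel. exp (- 2 * pi * (norm (x - c))\<^sup>2)) = gauss_mass TYPE('a)"
  using integral_translation(1)[of "\<lambda>x::'a. exp (- 2 * pi * (norm x)\<^sup>2)" "- c"]
  by (simp add: gauss_mass_def)

lemma gauss_mass_pos: "0 < gauss_mass TYPE('a::euclidean_space)"
proof -
  have nz: "\<not> (AE x in (lborel :: 'a measure). False)"
    by (simp add: AE_iff_null emeasure_lborel_UNIV null_sets_def)
  have "gauss_mass TYPE('a) \<noteq> 0"
  proof
    assume "gauss_mass TYPE('a) = 0"
    then have "AE x in (lborel :: 'a measure). exp (- 2 * pi * (norm (x - 0))\<^sup>2) = 0"
      using integrable_gauss[of "0 :: 'a"]
      by (subst (asm) integral_gauss[of 0, symmetric], subst (asm) integral_nonneg_eq_0_iff_AE) auto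
    then show False using nz by simp
  qed
  moreover have "0 \<le> gauss_mass TYPE('a)"
    unfolding gauss_mass_def by (rule Bochner_Integration.integral_nonneg) simp
  ultimately show ?thesis by simp
qed

lemma cmod_packet_sq:
  "(cmod (packet a b x))\<^sup>2
    = exp (pi * ((norm a)\<^sup>2 + (norm b)\<^sup>2)) * exp (- 2 * pi * (norm (x - a))\<^sup>2)"
  unfolding cmod_packet power2_eq_square[of "exp _"] exp_add[symmetric]
  by (simp add: algebra_simps)

lemma square_integrable_packet: "square_integrable (packet a b)"
  unfolding square_integrable_def cmod_packet_sq using integrable_gauss[of a] by simp

lemma norm_to_L2_packet:
  "(norm (to_L2 (packet a (b::'a::euclidean_space))))\<^sup>2
    = exp (pi * ((norm a)\<^sup>2 + (norm b)\<^sup>2)) * gauss_mass TYPE('a)"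
  unfolding norm_to_L2[OF square_integrable_packet] cmod_packet_sq
  using integral_gauss[of a] by simp

text \<open>By the parallelogram law, the product of the absolute values of two packets is a Gaussian
  centred at the midpoint of their positions.\<close>

lemma cmod_cinner_packet_le:
  fixes a :: "'a::euclidean_space"
  shows "cmod (cinner (to_L2 (packet a b)) (to_L2 (packet a' b')))
    \<le> norm (to_L2 (packet a b)) * norm (to_L2 (packet a' b')) * exp (- pi / 2 * (norm (a - a'))\<^sup>2)"
proof -
  let ?W = "(norm a)\<^sup>2 + (norm b)\<^sup>2" and ?W' = "(norm a')\<^sup>2 + (norm b')\<^sup>2"
  let ?c = "exp (pi / 2 * ?W) * exp (pi / 2 * ?W')"
  let ?m = "(1/2) *\<^sub>R (a + a')"
  have norms: "norm (to_L2 (packet a b)) = exp (pi / 2 * ((norm a)\<^sup>2 + (norm b)\<^sup>2)) * sqrt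
      (gauss_mass TYPE('a))"
    for a b :: 'a
    by (rule power2_eq_imp_eq)
      (use gauss_mass_pos[where 'a = 'a] in \<open>auto simp: norm_to_L2_packet power_mult_distrib
          exp_double[symmetric] less_imp_le\<close>)
  have par: "(norm (x - a))\<^sup>2 + (norm (x - a'))\<^sup>2 = 2 * (norm (x - ?m))\<^sup>2 + (norm (a - a'))\<^sup>2 / 2" for x
    unfolding power2_norm_eq_inner
    by (simp add: inner_diff_left inner_diff_right inner_add_left inner_add_right inner_commute
        field_simps)
  have prod: "cmod (cnj (packet a b x) * packet a' b' x)
      = ?c * exp (- pi / 2 * (norm (a - a'))\<^sup>2) * exp (- 2 * pi * (norm (x - ?m))\<^sup>2)" for x
  proof -
    have "cmod (cnj (packet a b x) * packet a' b' x)
        = exp (pi / 2 * ?W + pi / 2 * ?W' - pi * ((norm (x - a))\<^sup>2 + (norm (x - a'))\<^sup>2))"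
      by (simp add: norm_mult cmod_packet exp_add[symmetric] algebra_simps)
    then show ?thesis
      unfolding par exp_add[symmetric] by (simp add: algebra_simps)
  qed
  have "cmod (cinner (to_L2 (packet a b)) (to_L2 (packet a' b')))
      \<le> (LINT x|lborel. cmod (cnj (packet a b x) * packet a' b' x))"
    unfolding cinner_to_L2[OF square_integrable_packet square_integrable_packet]
    by (rule integral_norm_bound)
  also have "\<dots> = ?c * exp (- pi / 2 * (norm (a - a'))\<^sup>2) * gauss_mass TYPE('a)"
    unfolding prod using integral_gauss[of ?m] by simp
  also have "\<dots> = norm (to_L2 (packet a b)) * norm (to_L2 (packet a' b')) * exp (- pi / 2 * (norm (a
      - a'))\<^sup>2)"
    using gauss_mass_pos[where 'a = 'a] by (simp add: norms mult_ac)
  finally show ?thesis .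
qed

subsection \<open>The oscillator on coherent states\<close>

lemma packet_shift:
  assumes "e \<in> Basis"
  shows "packet a b (x + s *\<^sub>R e) = packet a b x * exp (s * (2 * pi * (wdot a b e - x \<bullet> e)) - pi * s\<^sup>2)"
proof -
  have n: "(norm (x + s *\<^sub>R e))\<^sup>2 = (norm x)\<^sup>2 + 2 * s * (x \<bullet> e) + s\<^sup>2"
    unfolding power2_norm_eq_inner using assms
    by (simp add: inner_add_left inner_add_right inner_commute power2_eq_square algebra_simps)
  have w: "wdot a b (x + s *\<^sub>R e) = wdot a b x + s * wdot a b e"
    by (simp add: wdot_def inner_add_right complex_eq_iff)
  show ?thesis
    unfolding packet_def n w exp_add[symmetric] by (simp add: algebra_simps)
qed

lemma packet_first_derivative:
  assumes "e \<in> Basis"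
  shows "((\<lambda>s. packet a b (x + s *\<^sub>R e)) has_vector_derivative
    2 * pi * (wdot a b e - x \<bullet> e) * packet a b x) (at 0)"
proof -
  define k where "k = 2 * pi * (wdot a b e - x \<bullet> e)"
  have "((\<lambda>z. packet a b x * exp (z * k - pi * z\<^sup>2)) has_field_derivative k * packet a b x)
      (at (complex_of_real 0))"
    by (auto intro!: derivative_eq_intros)
  from has_vector_derivative_real_field[OF this] show ?thesis
    unfolding packet_shift[OF assms] by (simp add: k_def)
qed

lemma packet_second_derivative:
  assumes "e \<in> Basis"
  shows "((\<lambda>s. 2 * pi * (wdot a b e - (x + s *\<^sub>R e) \<bullet> e) * packet a b (x + s *\<^sub>R e))
      has_vector_derivative
    ((2 * pi * (wdot a b e - x \<bullet> e))\<^sup>2 - 2 * pi) * packet a b x) (at 0)"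
proof -
  define k where "k = 2 * pi * (wdot a b e - x \<bullet> e)"
  have d: "((\<lambda>z. (k - 2 * pi * z) * (packet a b x * exp (z * k - pi * z\<^sup>2)))
      has_field_derivative (k\<^sup>2 - 2 * pi) * packet a b x) (at (complex_of_real 0))"
    by (auto intro!: derivative_eq_intros simp: power2_eq_square algebra_simps)
  have shift: "2 * pi * (wdot a b e - (x + s *\<^sub>R e) \<bullet> e) = k - 2 * pi * complex_of_real s" for s
    using assms by (simp add: k_def inner_add_left algebra_simps)
  show ?thesis
    using has_vector_derivative_real_field[OF d]
    unfolding packet_shift[OF assms] shift by (simp add: k_def)
qed

lemma test_function_support:
  assumes "test_function \<phi>"
  obtains R where "\<And>x. R < norm x \<Longrightarrow> \<phi> x = 0"
proof -
  have "bounded {x. \<phi> x \<noteq> 0}"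
    using assms bounded_subset[OF compact_imp_bounded closure_subset] by (auto simp: test_function_def)
  then obtain R where "\<And>x. \<phi> x \<noteq> 0 \<Longrightarrow> norm x \<le> R"
    by (auto simp: bounded_iff)
  then show thesis using that[of R] by force
qed

lemma partial_deriv_support:
  assumes "\<And>x. R < norm x \<Longrightarrow> f x = 0" "R < norm x"
  shows "partial_deriv b f x = 0"
proof -
  have "open {s. R < norm (x + s *\<^sub>R b)}"
    by (intro open_Collect_less continuous_intros)
  then have "((\<lambda>s. f (x + s *\<^sub>R b)) has_vector_derivative 0) (at 0)"
    by (rule has_vector_derivative_transform_within_open[OF has_vector_derivative_const])
      (use assms in auto)
  then show ?thesis
    unfolding partial_deriv_def by (rule vector_derivative_at)
qed

lemma test_function_derivatives:
  assumes "test_function \<phi>" "b \<in> Basis"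
  shows "continuous_on UNIV \<phi>" "continuous_on UNIV (partial_deriv b \<phi>)"
    "continuous_on UNIV (partial_deriv b (partial_deriv b \<phi>))"
    "((\<lambda>s. \<phi> (x + s *\<^sub>R b)) has_vector_derivative partial_deriv b \<phi> x) (at 0)"
    "((\<lambda>s. partial_deriv b \<phi> (x + s *\<^sub>R b)) has_vector_derivative
      partial_deriv b (partial_deriv b \<phi>) x) (at 0)"
proof -
  have C: "C_k 0 \<phi>" "C_k (Suc 0) \<phi>" "C_k (Suc (Suc 0)) \<phi>"
    using assms by (auto simp only: test_function_def)
  show "continuous_on UNIV \<phi>" "continuous_on UNIV (partial_deriv b \<phi>)"
    "continuous_on UNIV (partial_deriv b (partial_deriv b \<phi>))"
    using C assms(2) by auto
  show "((\<lambda>s. \<phi> (x + s *\<^sub>R b)) has_vector_derivative partial_deriv b \<phi> x) (at 0)"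
    "((\<lambda>s. partial_deriv b \<phi> (x + s *\<^sub>R b)) has_vector_derivative
      partial_deriv b (partial_deriv b \<phi>) x) (at 0)"
    using C(3) assms(2) unfolding partial_deriv_def[of b "\<phi>" x] partial_deriv_def[of b
        "partial_deriv b \<phi>" x]
    by (auto simp flip: vector_derivative_works)
qed

text \<open>Green's formula in one direction: the difference of the integrands is the derivative of \<open>\<phi>'
  G - \<phi> G'\<close>, which has compact support.\<close>

lemma integral_second_derivative_swap:
  assumes \<phi>: "test_function \<phi>" and e: "e \<in> Basis"
  shows "(LINT x|lborel. cnj (partial_deriv e (partial_deriv e \<phi>) x) * packet a b x)
    = (LINT x|lborel. cnj (\<phi> x) * (((2 * pi * (wdot a b e - x \<bullet> e))\<^sup>2 - 2 * pi) * packet a b x))"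
proof -
  note d = test_function_derivatives[OF \<phi> e]
  obtain R where R: "\<And>x. R < norm x \<Longrightarrow> \<phi> x = 0"
    using test_function_support[OF \<phi>] by blast
  note R1 = partial_deriv_support[of R \<phi>, OF R]
  note R2 = partial_deriv_support[of R "partial_deriv e \<phi>", OF R1]
  let ?G = "packet a b"
  let ?k = "\<lambda>x. 2 * pi * (wdot a b e - x \<bullet> e)"
  let ?F = "\<lambda>x. cnj (partial_deriv e \<phi> x) * ?G x - cnj (\<phi> x) * (?k x * ?G x)"
  let ?F1 = "\<lambda>x. cnj (partial_deriv e (partial_deriv e \<phi>) x) * ?G x"
  let ?F2 = "\<lambda>x. cnj (\<phi> x) * (((?k x)\<^sup>2 - 2 * pi) * ?G x)"
  have "(LINT x|lborel. ?F1 x - ?F2 x) = 0"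
  proof (rule integral_directional_derivative_zero[where F = ?F and R = R and b = e])
    fix x
    have "((\<lambda>s. ?F (x + s *\<^sub>R e)) has_vector_derivative
       (cnj (partial_deriv e \<phi> (x + 0 *\<^sub>R e)) * (?k x * ?G x) + cnj (partial_deriv e (partial_deriv
           e \<phi>) x) * ?G (x + 0 *\<^sub>R e))
       - (cnj (\<phi> (x + 0 *\<^sub>R e)) * (((?k x)\<^sup>2 - 2 * pi) * ?G x) + cnj (partial_deriv e \<phi> x) * (?k (x
           + 0 *\<^sub>R e) * ?G (x + 0 *\<^sub>R e)))) (at 0)"
      by (intro has_vector_derivative_diff has_vector_derivative_mult has_vector_derivative_cnj d
          packet_first_derivative packet_second_derivative e)
    then show "((\<lambda>s. ?F (x + s *\<^sub>R e)) has_vector_derivative ?F1 x - ?F2 x) (at 0)"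
      by simp
  qed (use d R R1 R2 in \<open>auto intro!: continuous_intros\<close>)
  moreover have "integrable lborel ?F1" "integrable lborel ?F2"
    using d R R1 R2 by (auto intro!: compact_support_integrable[where R = R] continuous_intros)
  ultimately show ?thesis by simp
qed

text \<open>A bound that is uniform over bounded sets of parameters. The factor \<open>1 + |x|\<close> is absorbed by
  \<open>exp |x|\<close>, and the linear terms of the exponent by the excess of \<open>\<pi>\<close> over 1.\<close>

lemma cmod_packet_le_gaussian:
  fixes x :: "'a::euclidean_space"
  defines "C \<equiv> \<lambda>W::real. exp (pi / 2 * W\<^sup>2 + (2 * pi * W + 1)\<^sup>2 / 8)"
  assumes "norm a + norm b \<le> W"
  shows "(1 + norm x) * cmod (packet a b x) \<le> C W * exp (- (norm x)\<^sup>2)"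
proof -
  let ?r = "norm x"
  have W: "0 \<le> W" using assms(2) norm_ge_zero[of a] norm_ge_zero[of b] by linarith
  have "(norm a)\<^sup>2 + (norm b)\<^sup>2 \<le> (norm a + norm b)\<^sup>2" by (simp add: power2_sum)
  also have "\<dots> \<le> W\<^sup>2" using assms(2) by (intro power_mono) auto
  finally have "- Re (wsq a b) \<le> W\<^sup>2"
    by (simp add: wsq_def power2_norm_eq_inner) (use inner_ge_zero[of a] in linarith)
  have "Re (wdot a b x) \<le> W * ?r"
  proof -
    have "Re (wdot a b x) \<le> (norm a + norm b) * ?r"
      using cmod_wdot_le[of a b x] complex_Re_le_cmod[of "wdot a b x"] by linarith
    also have "\<dots> \<le> W * ?r" using assms(2) by (intro mult_right_mono) auto
    finally show ?thesis .
  qed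
  have "2 * pi * Re (wdot a b x) - pi / 2 * Re (wsq a b) - pi * ?r\<^sup>2
      \<le> 2 * pi * (W * ?r) + pi / 2 * W\<^sup>2 - pi * ?r\<^sup>2"
  proof -
    have "2 * pi * Re (wdot a b x) \<le> 2 * pi * (W * ?r)"
      using \<open>Re (wdot a b x) \<le> W * ?r\<close> by (intro mult_left_mono) auto
    moreover have "pi / 2 * (- Re (wsq a b)) \<le> pi / 2 * W\<^sup>2"
      using \<open>- Re (wsq a b) \<le> W\<^sup>2\<close> by (intro mult_left_mono) auto
    ultimately show ?thesis by linarith
  qed
  then have "cmod (packet a b x) \<le> exp (2 * pi * (W * ?r) + pi / 2 * W\<^sup>2 - pi * ?r\<^sup>2)"
    unfolding packet_def norm_exp_eq_Re by simp
  moreover have "1 + ?r \<le> exp ?r" by (rule exp_ge_add_one_self)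
  ultimately have "(1 + ?r) * cmod (packet a b x)
      \<le> exp ?r * exp (2 * pi * (W * ?r) + pi / 2 * W\<^sup>2 - pi * ?r\<^sup>2)"
    by (intro mult_mono) auto
  also have "\<dots> = exp (pi / 2 * W\<^sup>2 + (2 * pi * W + 1) * ?r - pi * ?r\<^sup>2)"
    by (simp add: algebra_simps flip: exp_add)
  also have "\<dots> \<le> exp (pi / 2 * W\<^sup>2 + (2 * pi * W + 1)\<^sup>2 / 8 - ?r\<^sup>2)"
  proof -
    have "3 * ?r\<^sup>2 \<le> pi * ?r\<^sup>2" using pi_gt3 by (intro mult_right_mono) auto
    moreover have "c * r \<le> c\<^sup>2 / 8 + 2 * r\<^sup>2" for c r :: real
    proof -
      have "0 \<le> (c - 4 * r)\<^sup>2" by simp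
      then show ?thesis by (simp add: power2_eq_square algebra_simps)
    qed
    from this[of "2 * pi * W + 1" ?r]
    have "(2 * pi * W + 1) * ?r \<le> (2 * pi * W + 1)\<^sup>2 / 8 + 2 * ?r\<^sup>2" .
    ultimately show ?thesis by simp
  qed
  also have "\<dots> = C W * exp (- ?r\<^sup>2)"
    by (simp add: C_def flip: exp_add)
  finally show ?thesis .
qed

lemma cmod_energy_packet_le_gaussian:
  assumes "0 \<le> W"
  obtains C where "\<And>a b x :: 'a::euclidean_space. norm a + norm b \<le> W \<Longrightarrow>
    cmod (energy a b x * packet a b x) \<le> C * exp (- (norm x)\<^sup>2)"
proof
  fix a b x :: 'a
  assume ab: "norm a + norm b \<le> W"
  let ?B = "DIM('a) / 2 + 2 * pi * W + pi * W\<^sup>2"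
  let ?C = "exp (pi / 2 * W\<^sup>2 + (2 * pi * W + 1)\<^sup>2 / 8)"
  have "cmod (energy a b x) \<le> DIM('a) / 2 + 2 * pi * cmod (wdot a b x) + pi * cmod (wsq a b)"
    unfolding energy_def
    by (rule order_trans[OF norm_triangle_ineq4 add_mono[OF norm_triangle_le]]) (auto simp:
        norm_mult norm_divide)
  also have "\<dots> \<le> DIM('a) / 2 + 2 * pi * (W * norm x) + pi * W\<^sup>2"
  proof (intro add_mono mult_left_mono)
    show "cmod (wdot a b x) \<le> W * norm x"
      using cmod_wdot_le[of a b x] mult_right_mono[OF ab norm_ge_zero[of x]] by linarith
    show "cmod (wsq a b) \<le> W\<^sup>2"
      using cmod_wsq_le[of a b] power_mono[OF ab, of 2] by simp
  qed auto
  also have "\<dots> \<le> ?B * (1 + norm x)"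
  proof -
    have "0 \<le> 2 * pi * W" "0 \<le> DIM('a) / 2 * norm x" "0 \<le> pi * W\<^sup>2 * norm x"
      using \<open>0 \<le> W\<close> by simp_all
    then show ?thesis unfolding distrib_left distrib_right mult.assoc mult_1_right by linarith
  qed
  finally have "cmod (energy a b x * packet a b x) \<le> ?B * ((1 + norm x) * cmod (packet a b x))"
    by (simp add: norm_mult mult.assoc[symmetric] mult_right_mono)
  also have "\<dots> \<le> ?B * (?C * exp (- (norm x)\<^sup>2))"
    using \<open>0 \<le> W\<close> by (intro mult_left_mono cmod_packet_le_gaussian ab) auto
  finally show "cmod (energy a b x * packet a b x) \<le> (?B * ?C) * exp (- (norm x)\<^sup>2)"
    by (simp only: mult.assoc)
qed

lemma square_integrable_energy_packet: "square_integrable (\<lambda>x. energy a b x * packet a b x)"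
proof -
  obtain C where "\<And>x. cmod (energy a b x * packet a b x) \<le> C * exp (- (norm x)\<^sup>2)"
    using cmod_energy_packet_le_gaussian[of "norm a + norm b"]
    by (metis add_nonneg_nonneg norm_ge_zero order_refl)
  then show ?thesis by (intro square_integrable_if_gaussian_bound) measurable
qed

text \<open>Green's formula moves the derivatives from the test function to the packet, whose second
  derivatives are explicit; the sum over the directions gives the energy.\<close>

lemma packet_in_oscillator:
  fixes a :: "'a::euclidean_space"
  shows "(to_L2 (packet a b), to_L2 (\<lambda>x. energy a b x * packet a b x)) \<in> oscillator"
  unfolding oscillator_def
proof (clarify)
  fix \<phi> :: "'a \<Rightarrow> complex"
  assume \<phi>: "test_function \<phi>"
  let ?G = "packet a b"
  let ?k = "\<lambda>e x. 2 * pi * (wdot a b e - x \<bullet> e)"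
  obtain R where R: "\<And>x. R < norm x \<Longrightarrow> \<phi> x = 0"
    using test_function_support[OF \<phi>] by blast
  have R2: "R < norm x \<Longrightarrow> partial_deriv e (partial_deriv e \<phi>) x = 0" for e x
    using partial_deriv_support[of R] R by metis
  have cont: "continuous_on UNIV \<phi>"
    using test_function_derivatives(1)[OF \<phi> SOME_Basis] .
  have cont2: "e \<in> Basis \<Longrightarrow> continuous_on UNIV (partial_deriv e (partial_deriv e \<phi>))" for e
    by (rule test_function_derivatives(3)[OF \<phi>])
  have sq1: "square_integrable \<phi>"
    using cont R by (rule compact_support_square_integrable)
  have sq2: "square_integrable (oscillator_expr \<phi>)"
    unfolding oscillator_expr_def laplacian_def using R R2
    by (intro compact_support_square_integrable[where R = R] continuous_intros cont cont2) auto
  have int2: "integrable lborel (\<lambda>x. cnj (partial_deriv e (partial_deriv e \<phi>) x) * ?G x)" if "e \<in>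
      Basis" for e
    using R2 by (intro compact_support_integrable[where R = R] continuous_intros cont2 that) auto
  have int3: "integrable lborel (\<lambda>x. cnj (\<phi> x) * (((?k e x)\<^sup>2 - 2 * pi) * ?G x))" for e
    using R by (intro compact_support_integrable[where R = R] continuous_intros cont) auto
  have int4: "integrable lborel (\<lambda>x. pi * (norm x)\<^sup>2 * (cnj (\<phi> x) * ?G x))"
    using R by (intro compact_support_integrable[where R = R] continuous_intros cont) auto
  have sum_k: "(\<Sum>e\<in>Basis. (?k e x)\<^sup>2 - 2 * pi)
      = 4 * pi\<^sup>2 * (wsq a b - 2 * wdot a b x + (norm x)\<^sup>2) - 2 * pi * DIM('a)" for x
  proof -
    have inner_sum: "(\<Sum>e\<in>Basis. (u \<bullet> e) * (v \<bullet> e)) = u \<bullet> v" for u v :: 'a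
      by (rule euclidean_inner[symmetric])
    have "(\<Sum>e\<in>Basis. (wdot a b e - x \<bullet> e)\<^sup>2) = wsq a b - 2 * wdot a b x + (norm x)\<^sup>2"
    proof (rule complex_eqI)
      show "Re (\<Sum>e\<in>Basis. (wdot a b e - x \<bullet> e)\<^sup>2) = Re (wsq a b - 2 * wdot a b x + (norm x)\<^sup>2)"
      proof -
        have "Re (\<Sum>e\<in>Basis. (wdot a b e - x \<bullet> e)\<^sup>2)
            = (\<Sum>e\<in>Basis. (a \<bullet> e) * (a \<bullet> e) - 2 * ((a \<bullet> e) * (x \<bullet> e)) + (x \<bullet> e) * (x \<bullet> e) - (b \<bullet> e) *
                (b \<bullet> e))"
          by (simp add: wdot_def power2_eq_square algebra_simps)
        also have "\<dots> = a \<bullet> a - 2 * (a \<bullet> x) + x \<bullet> x - b \<bullet> b"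
          by (simp only: sum.distrib sum_subtractf sum_distrib_left[symmetric] inner_sum)
        also have "\<dots> = Re (wsq a b - 2 * wdot a b x + (norm x)\<^sup>2)"
          by (simp add: wsq_def wdot_def power2_norm_eq_inner flip: of_real_power)
        finally show ?thesis .
      qed
      show "Im (\<Sum>e\<in>Basis. (wdot a b e - x \<bullet> e)\<^sup>2) = Im (wsq a b - 2 * wdot a b x + (norm x)\<^sup>2)"
      proof -
        have "Im (\<Sum>e\<in>Basis. (wdot a b e - x \<bullet> e)\<^sup>2)
            = (\<Sum>e\<in>Basis. 2 * ((a \<bullet> e) * (b \<bullet> e)) - 2 * ((b \<bullet> e) * (x \<bullet> e)))"
          by (simp add: wdot_def power2_eq_square algebra_simps)
        also have "\<dots> = 2 * (a \<bullet> b) - 2 * (b \<bullet> x)"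
          by (simp only: sum.distrib sum_subtractf sum_distrib_left[symmetric] inner_sum)
        also have "\<dots> = Im (wsq a b - 2 * wdot a b x + (norm x)\<^sup>2)"
          by (simp add: wsq_def wdot_def flip: of_real_power)
        finally show ?thesis .
      qed
    qed
    moreover have "(\<Sum>e\<in>Basis. (?k e x)\<^sup>2 - 2 * pi)
        = 4 * pi\<^sup>2 * (\<Sum>e\<in>Basis. (wdot a b e - x \<bullet> e)\<^sup>2) - 2 * pi * DIM('a)"
      by (simp add: sum_subtractf sum_distrib_left power_mult_distrib)
    ultimately show ?thesis by simp
  qed
  have "cinner (to_L2 (oscillator_expr \<phi>)) (to_L2 ?G)
      = (LINT x|lborel. cnj (oscillator_expr \<phi> x) * ?G x)"
    by (rule cinner_to_L2[OF sq2 square_integrable_packet])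
  also have "\<dots> = (LINT x|lborel. - 1 / (4 * pi) * (\<Sum>e\<in>Basis. cnj (partial_deriv e (partial_deriv e
      \<phi>) x) * ?G x)
      + pi * (norm x)\<^sup>2 * (cnj (\<phi> x) * ?G x))"
  proof (intro Bochner_Integration.integral_cong refl)
    fix x
    have lap: "(\<Sum>e\<in>Basis. cnj (partial_deriv e (partial_deriv e \<phi>) x) * ?G x) = cnj (laplacian \<phi> x)
        * ?G x"
      by (simp add: laplacian_def sum_distrib_right)
    show "cnj (oscillator_expr \<phi> x) * ?G x
        = - 1 / (4 * pi) * (\<Sum>e\<in>Basis. cnj (partial_deriv e (partial_deriv e \<phi>) x) * ?G x)
          + pi * (norm x)\<^sup>2 * (cnj (\<phi> x) * ?G x)"
      unfolding lap by (simp add: oscillator_expr_def algebra_simps)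
  qed
  also have "\<dots> = - 1 / (4 * pi) * (\<Sum>e\<in>Basis. LINT x|lborel. cnj (partial_deriv e (partial_deriv e \<phi>)
      x) * ?G x)
      + (LINT x|lborel. pi * (norm x)\<^sup>2 * (cnj (\<phi> x) * ?G x))"
    using int2 int4 by simp
  also have "(\<Sum>e\<in>Basis. LINT x|lborel. cnj (partial_deriv e (partial_deriv e \<phi>) x) * ?G x)
      = (\<Sum>e\<in>Basis. LINT x|lborel. cnj (\<phi> x) * (((?k e x)\<^sup>2 - 2 * pi) * ?G x))"
    by (intro sum.cong refl integral_second_derivative_swap \<phi>)
  also have "- 1 / (4 * pi) * \<dots> + (LINT x|lborel. pi * (norm x)\<^sup>2 * (cnj (\<phi> x) * ?G x))
      = (LINT x|lborel. - 1 / (4 * pi) * (\<Sum>e\<in>Basis. cnj (\<phi> x) * (((?k e x)\<^sup>2 - 2 * pi) * ?G x))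
      + pi * (norm x)\<^sup>2 * (cnj (\<phi> x) * ?G x))"
    using int3 int4 by simp
  also have "\<dots> = (LINT x|lborel. cnj (\<phi> x) * (energy a b x * ?G x))"
  proof (intro Bochner_Integration.integral_cong refl)
    fix x
    have "- 1 / (4 * pi) * (\<Sum>e\<in>Basis. (?k e x)\<^sup>2 - 2 * pi) + pi * (norm x)\<^sup>2 = energy a b x"
      unfolding sum_k energy_def by (simp add: field_simps power2_eq_square)
    then have "cnj (\<phi> x) * (energy a b x * ?G x) = cnj (\<phi> x) * ((- 1 / (4 * pi) * (\<Sum>e\<in>Basis. (?k e
        x)\<^sup>2 - 2 * pi) + pi * (norm x)\<^sup>2) * ?G x)"
      by simp
    then show "- 1 / (4 * pi) * (\<Sum>e\<in>Basis. cnj (\<phi> x) * (((?k e x)\<^sup>2 - 2 * pi) * ?G x))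
      + pi * (norm x)\<^sup>2 * (cnj (\<phi> x) * ?G x) = cnj (\<phi> x) * (energy a b x * ?G x)"
      unfolding sum_distrib_left[symmetric] sum_distrib_right[symmetric]
      by (simp add: algebra_simps)
  qed
  also have "\<dots> = cinner (to_L2 \<phi>) (to_L2 (\<lambda>x. energy a b x * ?G x))"
    by (rule cinner_to_L2[OF sq1 square_integrable_energy_packet, symmetric])
  finally show "cinner (to_L2 (oscillator_expr \<phi>)) (to_L2 ?G)
      = cinner (to_L2 \<phi>) (to_L2 (\<lambda>x. energy a b x * ?G x))" .
qed

subsection \<open>The flow\<close>

lemma rot_add:
  "rot (t + s) a b = rot s (rot t a b) (rot t b (- a))"
  "rot (t + s) b (- a) = rot s (rot t b (- a)) (- rot t a b)"
  by (simp_all add: rot_def cos_add sin_add algebra_simps)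

lemma rot_minus: "rot t (- a) (- b) = - rot t a b"
  by (simp add: rot_def)

lemma rot_zero [simp]: "rot 0 a b = a"
  by (simp add: rot_def)

lemma norm_rot_le: "norm (rot t a b) \<le> norm a + norm b"
proof -
  have "norm (rot t a b) \<le> \<bar>cos t\<bar> * norm a + \<bar>sin t\<bar> * norm b"
    unfolding rot_def using norm_triangle_ineq4[of "cos t *\<^sub>R a" "sin t *\<^sub>R b"] by simp
  also have "\<dots> \<le> 1 * norm a + 1 * norm b"
    by (intro add_mono mult_right_mono) auto
  finally show ?thesis by simp
qed

text \<open>The solution of the Schroedinger equation of the oscillator with initial value \<open>packet a
  b\<close>.\<close>

definition moving_packet :: "'a::euclidean_space \<Rightarrow> 'a \<Rightarrow> real \<Rightarrow> 'a \<Rightarrow> complex" where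
  "moving_packet a b t x = cis (DIM('a) / 2 * t) * packet (rot t a b) (rot t b (- a)) x"

lemma borel_moving_packet [measurable]: "moving_packet a b t \<in> borel_measurable borel"
  unfolding moving_packet_def by measurable

lemma square_integrable_moving_packet: "square_integrable (moving_packet a b t)"
  unfolding moving_packet_def by (intro square_integrable_scale square_integrable_packet)

lemma to_L2_moving_packet:
  "to_L2 (moving_packet a (b::'a::euclidean_space) t) = cis (DIM('a) / 2 * t) *\<^sub>C to_L2 (packet (rot
      t a b) (rot t b (- a)))"
  unfolding moving_packet_def by (intro to_L2_scaleC square_integrable_packet)

lemma moving_packet_has_vector_derivative:
  fixes a :: "'a::euclidean_space"
  shows "((\<lambda>t. moving_packet a b t x) has_vector_derivative
    \<i> * energy (rot t a b) (rot t b (- a)) x * moving_packet a b t x) (at t)"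
proof -
  define \<alpha> \<beta> D where "\<alpha> = wdot a b x" and "\<beta> = wsq a b" and "D = complex_of_real (DIM('a) / 2)"
  define E where "E z = exp (\<i> * D * z + 2 * pi * (exp (\<i> * z) * \<alpha>) - pi / 2 * (exp (\<i> * (2 * z)) *
      \<beta>) - pi * (norm x)\<^sup>2)" for z
  have eq: "moving_packet a b t x = E (complex_of_real t)" for t
    unfolding moving_packet_def packet_def wdot_rot wsq_rot cis_conv_exp E_def exp_add[symmetric]
    by (simp add: \<alpha>_def \<beta>_def D_def algebra_simps)
  have en: "energy (rot t a b) (rot t b (- a)) x
      = D + 2 * pi * (exp (\<i> * t) * \<alpha>) - pi * (exp (\<i> * (2 * t)) * \<beta>)"
    unfolding energy_def wdot_rot wsq_rot cis_conv_exp by (simp add: \<alpha>_def \<beta>_def D_def)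
  have "(E has_field_derivative \<i> * (D + 2 * pi * (exp (\<i> * z) * \<alpha>) - pi * (exp (\<i> * (2 * z)) * \<beta>))
      * E z) (at z)" for z
    unfolding E_def by (auto intro!: derivative_eq_intros simp: algebra_simps)
  from has_vector_derivative_real_field[OF this, of t]
  show ?thesis unfolding eq en by simp
qed

text \<open>The difference quotients converge pointwise, and the mean value inequality with the uniform
  Gaussian bound on the time derivative makes the convergence dominated.\<close>

lemma to_L2_moving_packet_derivative:
  fixes a :: "'a::euclidean_space"
  shows "((\<lambda>s. (to_L2 (moving_packet a b s) - to_L2 (packet a b)) /\<^sub>R s)
    \<longlongrightarrow> \<i> *\<^sub>C to_L2 (\<lambda>x. energy a b x * packet a b x)) (at 0)"
proof -
  have zero: "moving_packet a b 0 = packet a b"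
    by (simp add: moving_packet_def fun_eq_iff)
  define v where "v t x = \<i> * energy (rot t a b) (rot t b (- a)) x * moving_packet a b t x" for t x
  have v0: "v 0 x = \<i> * (energy a b x * packet a b x)" for x
    by (simp add: v_def zero)
  define q where "q s x = of_real (inverse s) * (moving_packet a b s x - packet a b x) - v 0 x" for s x
  obtain C where C: "\<And>a' b' x :: 'a. norm a' + norm b' \<le> 2 * (norm a + norm b) \<Longrightarrow>
      cmod (energy a' b' x * packet a' b' x) \<le> C * exp (- (norm x)\<^sup>2)"
    using cmod_energy_packet_le_gaussian[of "2 * (norm a + norm b)"] by auto
  have v_le: "cmod (v t x) \<le> C * exp (- (norm x)\<^sup>2)" for t x
  proof -
    have "norm (rot t a b) + norm (rot t b (- a)) \<le> 2 * (norm a + norm b)"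
      using norm_rot_le[of t a b] norm_rot_le[of t b "- a"] by simp
    from C[OF this, of x] show ?thesis
      by (simp add: v_def moving_packet_def norm_mult)
  qed
  have q_le: "cmod (q s x) \<le> 2 * C * exp (- (norm x)\<^sup>2)" if "s \<noteq> 0" for s x
  proof -
    have "norm (moving_packet a b s x - moving_packet a b 0 x - (s - 0) *\<^sub>R v 0 x)
        \<le> norm (s - 0) * (2 * C * exp (- (norm x)\<^sup>2))"
    proof (rule vector_differentiable_bound_linearization[where S = UNIV and f' = "\<lambda>t. v t x"])
      show "norm (v t x - v 0 x) \<le> 2 * C * exp (- (norm x)\<^sup>2)" for t
        using norm_triangle_ineq4[of "v t x" "v 0 x"] v_le[of t x] v_le[of 0 x] by linarith
    qed (auto simp: v_def intro: moving_packet_has_vector_derivative)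
    moreover have "q s x = (moving_packet a b s x - moving_packet a b 0 x - s *\<^sub>R v 0 x) /\<^sub>R s"
      using that by (simp add: q_def zero scaleR_conv_of_real right_diff_distrib)
    ultimately show ?thesis
      using that by (simp add: norm_divide divide_simps mult.commute)
  qed
  have [measurable]: "q s \<in> borel_measurable borel" for s
    unfolding q_def v0 by measurable
  have q_sq: "square_integrable (q s)" for s
    unfolding q_def v0
    by (intro square_integrable_diff square_integrable_scale square_integrable_moving_packet
        square_integrable_packet square_integrable_energy_packet)
  have q_L2: "to_L2 (q s) = (to_L2 (moving_packet a b s) - to_L2 (packet a b)) /\<^sub>R s
      - \<i> *\<^sub>C to_L2 (\<lambda>x. energy a b x * packet a b x)" for s
    unfolding q_def v0
    by (subst to_L2_diff to_L2_scaleC,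
        (intro square_integrable_diff square_integrable_scale square_integrable_moving_packet
        square_integrable_packet square_integrable_energy_packet)+)+
      (simp add: scaleR_scaleC)
  have "((\<lambda>s. LINT x|lborel. (cmod (q s x))\<^sup>2) \<longlongrightarrow> (LINT x|(lborel :: 'a measure). 0)) (at 0)"
  proof (rule integral_dominated_convergence_at_zero)
    show "integrable lborel (\<lambda>x::'a. 4 * C\<^sup>2 * exp (- (norm x)\<^sup>2))"
      by (intro integrable_mult_right integrable_gaussian)
    show "((\<lambda>s. (cmod (q s x))\<^sup>2) \<longlongrightarrow> 0) (at 0)" for x
    proof -
      have "((\<lambda>s. (moving_packet a b (0 + s) x - moving_packet a b 0 x) /\<^sub>R s) \<longlongrightarrow> v 0 x) (at 0)"
        using moving_packet_has_vector_derivative[of a b x 0]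
        unfolding has_vector_derivative_iff_quotient v_def .
      then have "((\<lambda>s. q s x) \<longlongrightarrow> v 0 x - v 0 x) (at 0)"
        unfolding q_def by (intro tendsto_diff tendsto_const) (simp add: zero scaleR_conv_of_real)
      then have "((\<lambda>s. (cmod (q s x))\<^sup>2) \<longlongrightarrow> (cmod (v 0 x - v 0 x))\<^sup>2) (at 0)"
        by (intro tendsto_intros)
      then show ?thesis by simp
    qed
    show "norm ((cmod (q s x))\<^sup>2) \<le> 4 * C\<^sup>2 * exp (- (norm x)\<^sup>2)" if "s \<noteq> 0" for s x
    proof -
      have "(cmod (q s x))\<^sup>2 \<le> (2 * C * exp (- (norm x)\<^sup>2))\<^sup>2"
        using that by (intro power_mono q_le) auto
      also have "\<dots> = 4 * C\<^sup>2 * (exp (- (norm x)\<^sup>2) * exp (- (norm x)\<^sup>2))"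
        by (simp add: power2_eq_square)
      also have "\<dots> \<le> 4 * C\<^sup>2 * (exp (- (norm x)\<^sup>2) * 1)"
        by (intro mult_left_mono) auto
      finally show ?thesis by simp
    qed
  qed measurable
  then have "((\<lambda>s. (norm (to_L2 (q s)))\<^sup>2) \<longlongrightarrow> 0) (at 0)"
    by (simp add: norm_to_L2[OF q_sq])
  then have "((\<lambda>s. sqrt ((norm (to_L2 (q s)))\<^sup>2)) \<longlongrightarrow> sqrt 0) (at 0)"
    by (rule tendsto_real_sqrt)
  then have "((\<lambda>s. to_L2 (q s)) \<longlongrightarrow> 0) (at 0)"
    by (simp add: tendsto_norm_zero_iff)
  then show ?thesis
    unfolding q_L2 by (rule LIM_zero_cancel)
qed

lemma unitary_group_bounded_clinear: "unitary_group U \<Longrightarrow> bounded_clinear (U t)"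
  by (simp add: unitary_group_def unitary_def)

lemma unitary_group_linear: "unitary_group U \<Longrightarrow> linear (U t)"
  using unitary_group_bounded_clinear[of U t] by (simp add: bounded_clinear_def bounded_linear.linear)

lemma unitary_group_scaleC: "unitary_group U \<Longrightarrow> U t (c *\<^sub>C f) = c *\<^sub>C U t f"
  using unitary_group_bounded_clinear[of U t] by (simp add: bounded_clinear_def)

lemma unitary_group_cinner: "unitary_group U \<Longrightarrow> cinner (U t f) (U t g) = cinner f g"
  by (simp add: unitary_group_def unitary_def)

lemma unitary_group_norm: "unitary_group U \<Longrightarrow> norm (U t f) = norm f"
  using unitary_group_cinner[of U t f f] by (metis cinner_self norm_ge_zero of_real_eq_iff
      power2_eq_iff_nonneg)

lemma unitary_group_add: "unitary_group U \<Longrightarrow> U s (U t f) = U (s + t) f"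
  by (simp add: unitary_group_def)

lemma unitary_group_zero: "unitary_group U \<Longrightarrow> U 0 f = f"
  by (simp add: unitary_group_def)

lemma unitary_group_continuous: "unitary_group U \<Longrightarrow> continuous_on S (\<lambda>t. U t f)"
  unfolding unitary_group_def by (meson continuous_on_subset subset_UNIV)

text \<open>Started from the packet of any given time, \<open>U\<close> and the explicit flow have the same
  derivative: the first by the definition of the generator, as the packet lies in its domain.
  Hence the derivative of \<open>U (- t)\<close> applied to the moving packet vanishes everywhere.\<close>

lemma packet_flow:
  fixes U :: "real \<Rightarrow> 'a::euclidean_space L2 \<Rightarrow> 'a L2"
  assumes "unitary_group_generated_by oscillator U"
  shows "U t (to_L2 (packet a b)) = to_L2 (moving_packet a b t)"
proof -
  have U: "unitary_group U"
    and gen: "\<And>u v. (u, v) \<in> oscillator \<Longrightarrow> ((\<lambda>t. (U t u - u) /\<^sub>R t) \<longlongrightarrow> \<i> *\<^sub>C v) (at 0)"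
    using assms by (auto simp: unitary_group_generated_by_def)
  let ?P = "\<lambda>a b. to_L2 (packet a b)" and ?\<Psi> = "\<lambda>a b t. to_L2 (moving_packet a b t)"
  define h where "h t = U (- t) (?\<Psi> a b t)" for t
  have "(h has_vector_derivative 0) (at t)" for t
  proof -
    define a' b' where "a' = rot t a b" and "b' = rot t b (- a)"
    define c where "c = cis (DIM('a) / 2 * t)"
    have "((\<lambda>s. (?\<Psi> a' b' s - ?P a' b') /\<^sub>R s - (U s (?P a' b') - ?P a' b') /\<^sub>R s) \<longlongrightarrow>
        \<i> *\<^sub>C to_L2 (\<lambda>x. energy a' b' x * packet a' b' x) - \<i> *\<^sub>C to_L2 (\<lambda>x. energy a' b' x * packet
            a' b' x)) (at 0)"
      by (intro tendsto_diff to_L2_moving_packet_derivative gen packet_in_oscillator)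
    then have "((\<lambda>s. (?\<Psi> a' b' s - U s (?P a' b')) /\<^sub>R s) \<longlongrightarrow> 0) (at 0)"
      by (simp flip: scaleR_diff_right)
    then have lim: "((\<lambda>s. norm ((?\<Psi> a' b' s - U s (?P a' b')) /\<^sub>R s)) \<longlongrightarrow> 0) (at 0)"
      by (rule tendsto_norm_zero)
    have eq: "norm ((h (t + s) - h t) /\<^sub>R s) = norm ((?\<Psi> a' b' s - U s (?P a' b')) /\<^sub>R s)" for s
    proof -
      have "?\<Psi> a b (t + s) = c *\<^sub>C ?\<Psi> a' b' s"
        by (simp add: to_L2_moving_packet rot_add rot_minus a'_def b'_def c_def cis_mult distrib_left)
      moreover have "h t = U (- (t + s)) (c *\<^sub>C U s (?P a' b'))"
        by (simp add: h_def to_L2_moving_packet a'_def b'_def c_def unitary_group_scaleC[OF U,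
            symmetric]
            unitary_group_add[OF U])
      ultimately have "h (t + s) - h t = U (- (t + s)) (c *\<^sub>C (?\<Psi> a' b' s - U s (?P a' b')))"
        unfolding h_def
        by (simp add: linear_diff[OF unitary_group_linear[OF U], symmetric]
            linear_diff[OF bounded_linear.linear[OF bounded_linear_scaleC], symmetric])
      then have "norm (h (t + s) - h t) = norm (?\<Psi> a' b' s - U s (?P a' b'))"
        by (simp add: unitary_group_norm[OF U] c_def)
      then show ?thesis by simp
    qed
    show ?thesis
      unfolding has_vector_derivative_iff_quotient
      by (rule tendsto_norm_zero_cancel) (simp only: eq lim)
  qed
  then obtain c where "\<And>t. h t = c"
    using has_vector_derivative_zero_constant[of UNIV h] by auto
  then have "h t = h 0" by simp
  also have "h 0 = ?P a b"
    by (simp add: h_def unitary_group_zero[OF U] to_L2_moving_packet)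
  finally have "U t (U (- t) (?\<Psi> a b t)) = U t (?P a b)"
    by (simp add: h_def)
  then show ?thesis
    by (simp add: unitary_group_add[OF U] unitary_group_zero[OF U])
qed

definition unit_packet :: "'a::euclidean_space \<Rightarrow> 'a \<Rightarrow> 'a L2" where
  "unit_packet a b = to_L2 (packet a b) /\<^sub>R norm (to_L2 (packet a b))"

lemma norm_to_L2_packet_pos: "0 < norm (to_L2 (packet a (b::'a::euclidean_space)))"
proof -
  have "0 < (norm (to_L2 (packet a b)))\<^sup>2"
    using gauss_mass_pos[where 'a = 'a] by (simp add: norm_to_L2_packet)
  then show ?thesis by simp
qed

lemma norm_unit_packet: "norm (unit_packet a b) = 1"
  using norm_to_L2_packet_pos[of a b] by (simp add: unit_packet_def)

lemma norm_to_L2_packet_rot: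
  "norm (to_L2 (packet (rot t a b) (rot t b (- a)))) = norm (to_L2 (packet a b))"
proof -
  have "(norm (to_L2 (packet (rot t a b) (rot t b (- a)))))\<^sup>2 = (norm (to_L2 (packet a b)))\<^sup>2"
    unfolding norm_to_L2_packet norm_rot ..
  then show ?thesis by simp
qed

lemma unit_packet_flow:
  fixes U :: "real \<Rightarrow> 'a::euclidean_space L2 \<Rightarrow> 'a L2"
  assumes gen: "unitary_group_generated_by oscillator U"
  shows "U t (unit_packet a b) = cis (DIM('a) / 2 * t) *\<^sub>C unit_packet (rot t a b) (rot t b (- a))"
proof -
  have U: "unitary_group U" using gen by (simp add: unitary_group_generated_by_def)
  show ?thesis
    unfolding unit_packet_def norm_to_L2_packet_rot scaleR_scaleC unitary_group_scaleC[OF U]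
      packet_flow[OF gen] to_L2_moving_packet
    by (simp add: mult.commute)
qed

text \<open>Overlaps decay in position by the product of absolute values, but the decay in momentum
  comes from oscillation. The evolution by \<open>\<pi>/2\<close>, which is the Fourier transform, exchanges the
  two and preserves overlaps, so the bound in position also gives the one in momentum. The better
  of the two bounds is at most their geometric mean.\<close>

lemma cmod_cinner_unit_packet_le:
  fixes U :: "real \<Rightarrow> 'a::euclidean_space L2 \<Rightarrow> 'a L2" and a a' b b' :: 'a
  assumes gen: "unitary_group_generated_by oscillator U"
  shows "cmod (cinner (unit_packet a b) (unit_packet a' b'))
    \<le> exp (- pi / 4 * ((norm (a - a'))\<^sup>2 + (norm (b - b'))\<^sup>2))"
proof -
  have U: "unitary_group U" using gen by (simp add: unitary_group_generated_by_def)
  have pos: "cmod (cinner (unit_packet a b) (unit_packet a' b')) \<le> exp (- pi / 2 * (norm (a - a'))\<^sup>2)"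
    for a b a' b' :: 'a
  proof -
    let ?n = "norm (to_L2 (packet a b)) * norm (to_L2 (packet a' b'))"
    have "cmod (cinner (unit_packet a b) (unit_packet a' b'))
        = cmod (cinner (to_L2 (packet a b)) (to_L2 (packet a' b'))) / ?n"
      unfolding unit_packet_def scaleR_scaleC cinner_scaleC_left cinner_scaleC_right
      by (simp add: norm_mult norm_inverse divide_inverse)
    moreover have "0 < ?n" by (intro mult_pos_pos norm_to_L2_packet_pos)
    ultimately show ?thesis
      using cmod_cinner_packet_le[of a b a' b'] by (simp add: pos_divide_le_eq mult_ac)
  qed
  have "cinner (unit_packet a b) (unit_packet a' b')
      = cinner (U (pi / 2) (unit_packet a b)) (U (pi / 2) (unit_packet a' b'))"
    by (simp add: unitary_group_cinner[OF U])
  also have "cmod \<dots> = cmod (cinner (unit_packet (- b) a) (unit_packet (- b') a'))"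
    unfolding unit_packet_flow[OF gen] cinner_scaleC_left cinner_scaleC_right
    by (simp add: norm_mult rot_def)
  also have "\<dots> \<le> exp (- pi / 2 * (norm (b - b'))\<^sup>2)"
    using pos[of "- b" a "- b'" a'] by (simp add: norm_minus_commute)
  finally have mom: "cmod (cinner (unit_packet a b) (unit_packet a' b')) \<le> exp (- pi / 2 * (norm (b
      - b'))\<^sup>2)" .
  let ?X = "(norm (a - a'))\<^sup>2" and ?Y = "(norm (b - b'))\<^sup>2"
  have "- pi / 2 * max ?X ?Y \<le> - pi / 4 * (?X + ?Y)"
  proof -
    have "pi / 4 * (?X + ?Y) \<le> pi / 4 * (2 * max ?X ?Y)" by (intro mult_left_mono) auto
    then show ?thesis by simp
  qed
  moreover have "cmod (cinner (unit_packet a b) (unit_packet a' b')) \<le> exp (- pi / 2 * max ?X ?Y)"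
    using pos mom by (auto simp: max_def)
  ultimately show ?thesis
    by (meson exp_le_cancel_iff order_trans)
qed

section \<open>Time averages of observables\<close>

lemma bounded_clinear_compose:
  assumes "bounded_clinear S" "bounded_clinear T"
  shows "bounded_clinear (\<lambda>f. S (T f))"
  using assms by (auto simp: bounded_clinear_def bounded_linear_compose)

lemma bounded_clinear_funpow: "bounded_clinear T \<Longrightarrow> bounded_clinear (T ^^ n)"
proof (induction n)
  case 0
  show ?case by (auto simp: bounded_clinear_def bounded_linear_ident)
next
  case (Suc n)
  then show ?case by (auto simp: o_def intro: bounded_clinear_compose)
qed

lemma bounded_clinear_zero: "bounded_clinear (\<lambda>_. 0)"
  by (auto simp: bounded_clinear_def bounded_linear_zero)

definition cutoff :: "real \<Rightarrow> 'a::euclidean_space L2 \<Rightarrow> 'a L2" where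
  "cutoff R = mult_op (\<lambda>x. complex_of_real (indicator (cball 0 R) x))"

lemma cutoff_to_L2:
  assumes "square_integrable f"
  shows "cutoff R (to_L2 f) = to_L2 (\<lambda>x. complex_of_real (indicator (cball 0 R) x) * f x)"
    and "square_integrable (\<lambda>x. complex_of_real (indicator (cball 0 R) x) * f x)"
proof -
  have m: "(\<lambda>x::'a. complex_of_real (indicator (cball 0 R) x)) \<in> borel_measurable borel"
  proof -
    have [measurable]: "cball (0::'a) R \<in> sets borel" by (rule borel_closed) simp
    show ?thesis by measurable
  qed
  have b: "cmod (complex_of_real (indicator (cball 0 R) x)) \<le> 1" for x :: 'a
    by (simp add: indicator_def)
  show "cutoff R (to_L2 f) = to_L2 (\<lambda>x. complex_of_real (indicator (cball 0 R) x) * f x)"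
    unfolding cutoff_def using m b by (intro mult_op_to_L2 assms) (auto simp: bounded_iff)
  show "square_integrable (\<lambda>x. complex_of_real (indicator (cball 0 R) x) * f x)"
    by (rule square_integrable_mult_bounded[OF assms m b])
qed

lemma norm_cutoff:
  assumes "square_integrable f"
  shows "(norm (cutoff R (to_L2 f)))\<^sup>2 = (LINT x:cball 0 R|lborel. (cmod (f x))\<^sup>2)"
  unfolding cutoff_to_L2(1)[OF assms] norm_to_L2[OF cutoff_to_L2(2)[OF assms]] set_lebesgue_integral_def
  by (intro Bochner_Integration.integral_cong) (auto simp: indicator_def)

lemma norm_cutoff_le: "norm (cutoff R f) \<le> norm f"
proof -
  obtain g where g: "square_integrable g" "f = to_L2 g" by (rule L2_representative)
  have "(norm (cutoff R f))\<^sup>2 \<le> (norm f)\<^sup>2"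
    unfolding g(2) cutoff_to_L2(1)[OF g(1)] norm_to_L2[OF cutoff_to_L2(2)[OF g(1)]] norm_to_L2[OF g(1)]
    using g(1) cutoff_to_L2(2)[OF g(1), of R]
    by (intro integral_mono) (auto simp: square_integrable_def indicator_def)
  then show ?thesis by (rule power2_le_imp_le) simp
qed

lemma bounded_clinear_cutoff: "bounded_clinear (cutoff R :: 'a::euclidean_space L2 \<Rightarrow> 'a L2)"
proof -
  have add: "cutoff R (f + g) = cutoff R f + cutoff R g" for f g :: "'a L2"
  proof -
    obtain f' g' where f: "square_integrable f'" "f = to_L2 f'" and g: "square_integrable g'" "g =
        to_L2 g'"
      by (metis L2_representative)
    show ?thesis
      unfolding f(2) g(2) to_L2_add[OF f(1) g(1), symmetric]
        cutoff_to_L2(1)[OF square_integrable_add[OF f(1) g(1)]] cutoff_to_L2(1)[OF f(1)]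
            cutoff_to_L2(1)[OF g(1)]
        to_L2_add[OF cutoff_to_L2(2)[OF f(1)] cutoff_to_L2(2)[OF g(1)], symmetric]
      by (simp add: distrib_left)
  qed
  have scale: "cutoff R (c *\<^sub>C f) = c *\<^sub>C cutoff R f" for c and f :: "'a L2"
  proof -
    obtain f' where f: "square_integrable f'" "f = to_L2 f'" by (rule L2_representative)
    show ?thesis
      unfolding f(2) to_L2_scaleC[OF f(1), symmetric] cutoff_to_L2(1)[OF square_integrable_scale[OF
          f(1)]]
        cutoff_to_L2(1)[OF f(1)] to_L2_scaleC[OF cutoff_to_L2(2)[OF f(1)], symmetric]
      by (simp add: mult.left_commute)
  qed
  have "bounded_linear (cutoff R :: 'a L2 \<Rightarrow> 'a L2)"
    by (rule bounded_linear_intro[where K = 1])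
      (auto simp: add scale scaleR_scaleC norm_cutoff_le)
  then show ?thesis by (simp add: bounded_clinear_def scale)
qed

lemma cinner_cutoff_commute: "cinner f (cutoff R g) = cinner (cutoff R f) g"
proof -
  obtain f' g' where f: "square_integrable f'" "f = to_L2 f'" and g: "square_integrable g'" "g =
      to_L2 g'"
    by (metis L2_representative)
  show ?thesis
    unfolding f(2) g(2) cutoff_to_L2(1)[OF f(1)] cutoff_to_L2(1)[OF g(1)]
      cinner_to_L2[OF f(1) cutoff_to_L2(2)[OF g(1)]] cinner_to_L2[OF cutoff_to_L2(2)[OF f(1)] g(1)]
    by (simp add: mult_ac)
qed

lemma cutoff_cutoff: "cutoff R (cutoff R f) = cutoff R f"
proof -
  obtain g where g: "square_integrable g" "f = to_L2 g" by (rule L2_representative)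
  show ?thesis
    unfolding g(2) cutoff_to_L2(1)[OF g(1)] cutoff_to_L2(1)[OF cutoff_to_L2(2)[OF g(1)]]
    by (rule arg_cong[where f = to_L2]) (auto simp: indicator_def)
qed

lemma cinner_cutoff_self: "cinner f (cutoff R f) = complex_of_real ((norm (cutoff R f))\<^sup>2)"
  by (metis cinner_cutoff_commute cinner_self cutoff_cutoff)

text \<open>The multiplication by the indicator of \<open>cball 0 R\<close> in the Heisenberg picture.\<close>

definition heisenberg :: "(real \<Rightarrow> 'a::euclidean_space L2 \<Rightarrow> 'a L2) \<Rightarrow> real \<Rightarrow> real \<Rightarrow> 'a L2 \<Rightarrow> 'a L2" where
  "heisenberg U R t f = U (- t) (cutoff R (U t f))"

text \<open>A Riemann integral of a continuous function with values in the Banach space \<open>L\<^sup>2\<close>.\<close>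

definition time_average :: "(real \<Rightarrow> 'a::euclidean_space L2 \<Rightarrow> 'a L2) \<Rightarrow> real \<Rightarrow> 'a L2 \<Rightarrow> 'a L2" where
  "time_average U R f = integral {0..1/2} (\<lambda>t. heisenberg U R t f)"

lemma unitary_group_adjoint:
  assumes U: "unitary_group U"
  shows "cinner f (U (- t) g) = cinner (U t f) g"
proof -
  have "cinner f (U (- t) g) = cinner (U t f) (U t (U (- t) g))"
    by (simp add: unitary_group_cinner[OF U])
  then show ?thesis by (simp add: unitary_group_add[OF U] unitary_group_zero[OF U])
qed

lemma cinner_heisenberg:
  "unitary_group U \<Longrightarrow> cinner g (heisenberg U R t f) = cinner (U t g) (cutoff R (U t f))"
  by (simp add: heisenberg_def unitary_group_adjoint)

text \<open>The group is isometric, so strong continuity survives in products although it is not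
  uniform.\<close>

lemma continuous_heisenberg:
  assumes U: "unitary_group U"
  shows "continuous_on S (\<lambda>t. heisenberg U R t f)"
  unfolding continuous_on_def
proof
  fix t assume "t \<in> S"
  let ?g = "\<lambda>s. cutoff R (U s f)"
  have cont: "((\<lambda>s. U s h) \<longlongrightarrow> U t h) (at t within S)" for h
    using unitary_group_continuous[OF U, of S h] \<open>t \<in> S\<close> by (simp add: continuous_on_def)
  have "((\<lambda>s. U (- s) h) \<longlongrightarrow> U (- t) h) (at t within S)" for h
  proof -
    have "continuous_on S (\<lambda>s. U (- s) h)"
      by (rule continuous_on_compose2[OF unitary_group_continuous[OF U, of UNIV]])
        (auto intro!: continuous_intros)
    then show ?thesis using \<open>t \<in> S\<close> by (simp add: continuous_on_def)
  qed
  then have neg: "((\<lambda>s. norm (U (- s) (?g t) - U (- t) (?g t))) \<longlongrightarrow> 0) (at t within S)"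
    by (intro tendsto_norm_zero) (simp add: LIM_zero)
  have "((\<lambda>s. ?g s) \<longlongrightarrow> ?g t) (at t within S)"
    by (rule bounded_linear.tendsto[OF _ cont]) (use bounded_clinear_cutoff[of R] in \<open>auto simp:
        bounded_clinear_def\<close>)
  then have pos: "((\<lambda>s. norm (?g s - ?g t)) \<longlongrightarrow> 0) (at t within S)"
    by (intro tendsto_norm_zero) (simp add: LIM_zero)
  have "((\<lambda>s. heisenberg U R s f - heisenberg U R t f) \<longlongrightarrow> 0) (at t within S)"
  proof (rule Lim_null_comparison)
    show "((\<lambda>s. norm (?g s - ?g t) + norm (U (- s) (?g t) - U (- t) (?g t))) \<longlongrightarrow> 0) (at t within S)"
      using tendsto_add[OF pos neg] by simp
    have "norm (heisenberg U R s f - heisenberg U R t f)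
        \<le> norm (?g s - ?g t) + norm (U (- s) (?g t) - U (- t) (?g t))" for s
    proof -
      have "heisenberg U R s f - heisenberg U R t f
          = U (- s) (?g s - ?g t) + (U (- s) (?g t) - U (- t) (?g t))"
        by (simp add: heisenberg_def linear_diff[OF unitary_group_linear[OF U]])
      then show ?thesis
        using norm_triangle_ineq[of "U (- s) (?g s - ?g t)" "U (- s) (?g t) - U (- t) (?g t)"]
        by (simp add: unitary_group_norm[OF U])
    qed
    then show "\<forall>\<^sub>F s in at t within S. norm (heisenberg U R s f - heisenberg U R t f)
        \<le> norm (?g s - ?g t) + norm (U (- s) (?g t) - U (- t) (?g t))"
      by simp
  qed
  then show "((\<lambda>s. heisenberg U R s f) \<longlongrightarrow> heisenberg U R t f) (at t within S)"
    by (rule LIM_zero_cancel)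
qed

lemma heisenberg_integrable:
  "unitary_group U \<Longrightarrow> (\<lambda>t. heisenberg U R t f) integrable_on {0..1/2}"
  by (intro integrable_continuous_real continuous_heisenberg)

lemma cinner_time_average:
  assumes U: "unitary_group U"
  shows "set_integrable lborel {0..1/2} (\<lambda>t. cinner g (heisenberg U R t f))"
    "cinner g (time_average U R f) = (LINT t:{0..1/2}|lborel. cinner g (heisenberg U R t f))"
proof -
  have "continuous_on {0..1/2} (\<lambda>t. cinner g (heisenberg U R t f))"
    by (intro bounded_linear.continuous_on[OF bounded_linear_cinner_right] continuous_heisenberg U)
  then show int: "set_integrable lborel {0..1/2} (\<lambda>t. cinner g (heisenberg U R t f))"
    by (rule borel_integrable_atLeastAtMost')
  have "cinner g (time_average U R f) = integral {0..1/2} (\<lambda>t. cinner g (heisenberg U R t f))"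
    unfolding time_average_def
    using integral_linear[OF heisenberg_integrable[OF U, of R f] bounded_linear_cinner_right[of g]]
    by (simp add: o_def)
  also have "\<dots> = (LINT t:{0..1/2}|lborel. cinner g (heisenberg U R t f))"
    by (rule set_borel_integral_eq_integral(2)[OF int, symmetric])
  finally show "cinner g (time_average U R f) = (LINT t:{0..1/2}|lborel. cinner g (heisenberg U R t
      f))" .
qed

lemma bounded_clinear_heisenberg:
  "unitary_group U \<Longrightarrow> bounded_clinear (heisenberg U R t)"
  unfolding heisenberg_def[abs_def]
  by (rule bounded_clinear_compose[OF unitary_group_bounded_clinear
        bounded_clinear_compose[OF bounded_clinear_cutoff unitary_group_bounded_clinear]])

lemma bounded_clinear_time_average:
  assumes U: "unitary_group U"
  shows "bounded_clinear (time_average U R)"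
proof -
  note H = bounded_clinear_heisenberg[OF U, of R, unfolded bounded_clinear_def]
  have lin: "linear (heisenberg U R t)" for t
    using H by (simp add: bounded_linear.linear)
  have scale: "time_average U R (c *\<^sub>C f) = c *\<^sub>C time_average U R f" for c f
    unfolding time_average_def
    using integral_linear[OF heisenberg_integrable[OF U, of R f] bounded_linear_scaleC[of c]] H
    by (simp add: o_def)
  have "bounded_linear (time_average U R)"
  proof (rule bounded_linear_intro[where K = "1/2"])
    show "time_average U R (f + g) = time_average U R f + time_average U R g" for f g
      unfolding time_average_def
      by (simp add: linear_add[OF lin] integral_add heisenberg_integrable[OF U])
    show "time_average U R (r *\<^sub>R f) = r *\<^sub>R time_average U R f" for r f
      by (simp add: scaleR_scaleC scale)
    show "norm (time_average U R f) \<le> norm f * (1/2)" for f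
    proof -
      have "norm (heisenberg U R t f) \<le> norm f" for t
        using norm_cutoff_le[of R "U t f"] by (simp add: heisenberg_def unitary_group_norm[OF U])
      then have "norm (integral {0..1/2} (\<lambda>t. heisenberg U R t f)) \<le> norm f * (1/2 - 0)"
        by (intro integral_bound continuous_heisenberg U) auto
      then show ?thesis by (simp add: time_average_def)
    qed
  qed
  then show ?thesis by (simp add: bounded_clinear_def scale)
qed

lemma time_average_symmetric:
  assumes U: "unitary_group U"
  shows "cinner f (time_average U R g) = cinner (time_average U R f) g"
proof -
  have "cinner (heisenberg U R t f) g = cinner f (heisenberg U R t g)" for t
    by (metis U cinner_commute cinner_cutoff_commute cinner_heisenberg)
  moreover have "cinner (time_average U R f) g = (LINT t:{0..1/2}|lborel. cinner (heisenberg U R t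
      f) g)"
  proof -
    have "cinner (time_average U R f) g = cnj (LINT t:{0..1/2}|lborel. cinner g (heisenberg U R t f))"
      unfolding cinner_time_average(2)[OF U, symmetric] by (rule cinner_commute)
    also have "\<dots> = (LINT t:{0..1/2}|lborel. cnj (cinner g (heisenberg U R t f)))"
      unfolding set_lebesgue_integral_def by (simp flip: Bochner_Integration.integral_cnj)
    finally show ?thesis by (simp flip: cinner_commute)
  qed
  ultimately show ?thesis
    by (simp add: cinner_time_average(2)[OF U])
qed

lemma Re_cinner_time_average:
  assumes U: "unitary_group U"
  shows "set_integrable lborel {0..1/2} (\<lambda>t. (norm (cutoff R (U t f)))\<^sup>2)"
    "Re (cinner f (time_average U R f)) = (LINT t:{0..1/2}|lborel. (norm (cutoff R (U t f)))\<^sup>2)"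
proof -
  have eq: "cinner f (heisenberg U R t f) = complex_of_real ((norm (cutoff R (U t f)))\<^sup>2)" for t
    by (simp only: cinner_heisenberg[OF U] cinner_cutoff_self)
  note I = cinner_time_average[OF U, of f R f, unfolded eq set_integrable_def set_lebesgue_integral_def]
  have sc: "indicator A t *\<^sub>R complex_of_real y = complex_of_real (indicator A t *\<^sub>R y)" for A and t
      y :: real
    by (simp add: scaleR_conv_of_real)
  show "set_integrable lborel {0..1/2} (\<lambda>t. (norm (cutoff R (U t f)))\<^sup>2)"
    using I(1) unfolding sc complex_of_real_integrable_eq set_integrable_def by simp
  show "Re (cinner f (time_average U R f)) = (LINT t:{0..1/2}|lborel. (norm (cutoff R (U t f)))\<^sup>2)"
    unfolding I(2) sc integral_complex_of_real set_lebesgue_integral_def by simp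
qed

lemma positive_op_funpow:
  assumes A: "bounded_clinear A" and sym: "\<And>f g. cinner f (A g) = cinner (A f) g"
    and pos: "\<And>f. 0 \<le> Re (cinner f (A f))"
  shows "positive_op (A ^^ n)"
  unfolding positive_op_def
proof (intro conjI allI)
  show "bounded_clinear (A ^^ n)" by (rule bounded_clinear_funpow[OF A])
  fix f
  have pw: "cinner ((A ^^ i) f) ((A ^^ j) g) = cinner f ((A ^^ (i + j)) g)" for i j g
  proof (induction i arbitrary: j)
    case (Suc i)
    have "cinner ((A ^^ Suc i) f) ((A ^^ j) g) = cinner ((A ^^ i) f) ((A ^^ Suc j) g)"
      by (simp add: sym)
    then show ?case using Suc[of "Suc j"] by simp
  qed simp
  have "cinner f ((A ^^ n) f) = cnj (cinner f ((A ^^ n) f))"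
    using pw[of n 0 f] cinner_commute[of "(A ^^ n) f" f] by simp
  then show "cinner f ((A ^^ n) f) \<in> \<real>" by (metis Reals_cnj_iff)
  show "0 \<le> Re (cinner f ((A ^^ n) f))"
  proof (cases "even n")
    case True
    then obtain i where "n = i + i" by (metis evenE mult_2)
    then show ?thesis using pw[of i i f] by (simp add: Re_cinner_self flip: pw)
  next
    case False
    then obtain i where "n = i + Suc i" by (metis oddE mult_2 add_Suc_right Suc_eq_plus1)
    then show ?thesis using pw[of i "Suc i" f] pos[of "(A ^^ i) f"] by simp
  qed
qed

text \<open>For even \<open>n\<close> the form of \<open>A^n\<close> is a square norm, for odd \<open>n\<close> it is an integral of square
  norms; both have the shape that the comparison with Bessel families requires.\<close>

lemma sum_bessel_family_time_average_le:
  assumes U: "unitary_group U" and B: "orthonormal_basis B"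
    and J: "finite J" "bessel_family K J \<phi>" "0 \<le> K"
    and M: "\<And>F. finite F \<Longrightarrow> F \<subseteq> B \<Longrightarrow> (\<Sum>e\<in>F. Re (cinner e ((time_average U R ^^ n) e))) \<le> M"
  shows "(\<Sum>j\<in>J. Re (cinner (\<phi> j) ((time_average U R ^^ n) (\<phi> j)))) \<le> K * M"
proof -
  let ?A = "time_average U R"
  note A = bounded_clinear_time_average[OF U, of R]
  note sym = time_average_symmetric[OF U, of _ R]
  have pw: "inner ((?A ^^ i) f) ((?A ^^ j) g) = inner f ((?A ^^ (i + j)) g)" for i j f g
    by (rule inner_funpow_symmetric) (simp add: inner_L2_def sym)
  show ?thesis
  proof (cases "even n")
    case True
    then obtain i where n: "n = i + i" by (metis evenE mult_2)
    have "Re (cinner f ((?A ^^ n) f)) = (LINT t|count_space {()}. (norm ((?A ^^ i) f))\<^sup>2)" for f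
      unfolding n Re_cinner pw[symmetric] by (simp add: power2_norm_eq_inner
          lebesgue_integral_count_space_finite)
    then show ?thesis
      by (intro sum_bessel_family_le_trace[OF B J _ _ _ _ M, where S = "\<lambda>_. ?A ^^ i" and \<mu> =
          "count_space {()}"]
          bounded_clinear_funpow A) (auto simp: integrable_count_space)
  next
    case False
    then obtain i where n: "n = i + Suc i" by (metis oddE mult_2 add_Suc_right Suc_eq_plus1)
    define S where "S t = (if t \<in> {0..1/2} then (\<lambda>f. cutoff R (U t ((?A ^^ i) f))) else (\<lambda>_. 0))" for t
    have "bounded_clinear (\<lambda>f. cutoff R (U t ((?A ^^ i) f)))" for t
      by (rule bounded_clinear_compose[OF bounded_clinear_cutoff
            bounded_clinear_compose[OF unitary_group_bounded_clinear[OF U] bounded_clinear_funpow[OF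
                A]]])
    then have S: "bounded_clinear (S t)" for t
      by (simp add: S_def bounded_clinear_zero)
    have norm_S: "(norm (S t f))\<^sup>2 = indicator {0..1/2} t *\<^sub>R (norm (cutoff R (U t ((?A ^^ i)
        f))))\<^sup>2" for t f
      by (simp add: S_def)
    have "integrable lborel (\<lambda>t. (norm (S t f))\<^sup>2)" for f
      unfolding norm_S using Re_cinner_time_average(1)[OF U] unfolding set_integrable_def .
    moreover have "Re (cinner f ((?A ^^ n) f)) = (LINT t|lborel. (norm (S t f))\<^sup>2)" for f
    proof -
      have "Re (cinner f ((?A ^^ n) f)) = Re (cinner ((?A ^^ i) f) (?A ((?A ^^ i) f)))"
        unfolding n Re_cinner using pw[of i f "Suc i" f] by simp
      then show ?thesis
        unfolding Re_cinner_time_average(2)[OF U] norm_S set_lebesgue_integral_def .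
    qed
    ultimately show ?thesis
      by (intro sum_bessel_family_le_trace[OF B J _ S _ _ M] bounded_clinear_funpow A)
  qed
qed

text \<open>Otherwise \<open>K\<close> times the trace would bound all the sums in the hypothesis, by Jensen's
  inequality for each vector and the comparison of the Bessel family with the basis.\<close>

lemma op_trace_time_average_infinite:
  assumes U: "unitary_group U" and K: "0 \<le> K"
    and ex: "\<And>M. \<exists>J \<phi>. finite (J :: 'i set) \<and> bessel_family K J \<phi> \<and> (\<forall>j\<in>J. norm (\<phi> j) = 1) \<and>
      M < (\<Sum>j\<in>J. (Re (cinner (\<phi> j) (time_average U R (\<phi> j)))) ^ n)"
  shows "op_trace (time_average U R ^^ n) = \<infinity>"
proof (rule ccontr)
  let ?A = "time_average U R"
  note A = bounded_clinear_time_average[OF U, of R]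
  note sym = time_average_symmetric[OF U, of _ R]
  have pos: "0 \<le> Re (cinner f (?A f))" for f
    unfolding Re_cinner_time_average(2)[OF U] set_lebesgue_integral_def
    by (rule Bochner_Integration.integral_nonneg) simp
  define B where "B = (SOME B. orthonormal_basis (B :: 'a L2 set))"
  have B: "orthonormal_basis B"
    unfolding B_def by (rule someI_ex) (rule ex_orthonormal_basis)
  have An_pos: "0 \<le> Re (cinner f ((?A ^^ n) f))" for f
    using positive_op_funpow[OF A sym pos, of n] by (simp add: positive_op_def)
  assume "op_trace (?A ^^ n) \<noteq> \<infinity>"
  then obtain M where M: "0 \<le> M" "op_trace (?A ^^ n) = ennreal M"
    by (cases "op_trace (?A ^^ n)") auto
  have bound: "(\<Sum>e\<in>F. Re (cinner e ((?A ^^ n) e))) \<le> M" if F: "finite F" "F \<subseteq> B" for F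
  proof -
    have "ennreal (\<Sum>e\<in>F. Re (cinner e ((?A ^^ n) e))) = (\<Sum>e\<in>F. ennreal (Re (cinner e ((?A ^^ n) e))))"
      using An_pos by (simp add: sum_ennreal)
    also have "\<dots> \<le> op_trace (?A ^^ n)"
      unfolding op_trace_def B_def[symmetric]
      by (subst infsum_finite[OF F(1), symmetric], rule infsum_mono_neutral)
        (use F in \<open>auto intro: nonneg_summable_on_complete\<close>)
    finally show ?thesis using M by (simp add: ennreal_le_iff)
  qed
  obtain J :: "'i set" and \<phi> where J: "finite J" "bessel_family K J \<phi>" "\<And>j. j \<in> J \<Longrightarrow> norm (\<phi> j) = 1"
    and large: "K * M < (\<Sum>j\<in>J. (Re (cinner (\<phi> j) (?A (\<phi> j)))) ^ n)"
    using ex[of "K * M"] by blast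
  have "(\<Sum>j\<in>J. (Re (cinner (\<phi> j) (?A (\<phi> j)))) ^ n) \<le> (\<Sum>j\<in>J. Re (cinner (\<phi> j) ((?A ^^ n) (\<phi> j))))"
    unfolding Re_cinner using A pos
    by (intro sum_mono power_inner_le_inner_funpow J(3))
      (auto simp: bounded_clinear_def bounded_linear.linear inner_L2_def sym)
  also have "\<dots> \<le> K * M"
    by (rule sum_bessel_family_time_average_le[OF U B J(1,2) K bound])
  finally show False using large by simp
qed

section \<open>A logarithmically divergent family\<close>

subsection \<open>Dwell time\<close>

text \<open>The mass that a normalized packet has within distance 1 of its position.\<close>

definition bump :: "'a::euclidean_space itself \<Rightarrow> real" where
  "bump _ = (LINT x:cball (0::'a) 1|lborel. exp (- 2 * pi * (norm x)\<^sup>2)) / gauss_mass TYPE('a)"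

lemma bump_pos: "0 < bump TYPE('a::euclidean_space)"
proof -
  have "exp (- 2 * pi) * measure lborel (cball (0::'a) 1)
      = (LINT x:cball (0::'a) 1|lborel. exp (- 2 * pi))"
    by (subst set_integral_const) (use emeasure_bounded_finite[OF bounded_cball] in \<open>auto simp:
        less_top\<close>)
  also have "\<dots> \<le> (LINT x:cball (0::'a) 1|lborel. exp (- 2 * pi * (norm x)\<^sup>2))"
  proof (rule set_integral_mono)
    show "set_integrable lborel (cball (0::'a) 1) (\<lambda>x. exp (- 2 * pi))"
      by (intro borel_integrable_compact[folded set_integrable_def] continuous_intros compact_cball)
    show "set_integrable lborel (cball (0::'a) 1) (\<lambda>x. exp (- 2 * pi * (norm x)\<^sup>2))"
      by (intro borel_integrable_compact[folded set_integrable_def] continuous_intros compact_cball)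
    show "exp (- 2 * pi) \<le> exp (- 2 * pi * (norm x)\<^sup>2)" if "x \<in> cball 0 1" for x :: 'a
    proof -
      have "(norm x)\<^sup>2 \<le> 1" using that by (simp add: power_le_one)
      then show ?thesis using mult_left_mono[of "(norm x)\<^sup>2" 1 "2 * pi"] by simp
    qed
  qed
  finally have "exp (- 2 * pi) * measure lborel (cball (0::'a) 1)
      \<le> (LINT x:cball (0::'a) 1|lborel. exp (- 2 * pi * (norm x)\<^sup>2))" .
  moreover have "0 < measure lborel (cball (0::'a) 1)"
    by (simp add: content_cball)
  ultimately show ?thesis
    unfolding bump_def using gauss_mass_pos[where 'a = 'a]
    by (intro divide_pos_pos) (auto intro: less_le_trans[rotated])
qed

lemma norm_cutoff_unit_packet_ge:
  fixes a :: "'a::euclidean_space"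
  assumes "norm a + 1 \<le> R"
  shows "bump TYPE('a) \<le> (norm (cutoff R (unit_packet a b)))\<^sup>2"
proof -
  let ?W = "exp (pi * ((norm a)\<^sup>2 + (norm b)\<^sup>2))"
  let ?g = "\<lambda>x::'a. exp (- 2 * pi * (norm x)\<^sup>2)"
  have int: "integrable lborel (\<lambda>x. indicator A x *\<^sub>R ?g (x - a))" if "A \<in> sets borel" for A
    using that by (intro integrable_mult_indicator integrable_gauss) auto
  have "(LINT x:cball 0 1|lborel. ?g x) = (LINT x|lborel. indicator (cball 0 1) (x + (- a)) *\<^sub>R ?g
      (x + (- a)))"
    unfolding set_lebesgue_integral_def
    by (rule integral_translation(1)[symmetric])
      (intro borel_measurable_scaleR borel_measurable_indicator borel_closed
        borel_measurable_continuous_onI continuous_intros closed_cball)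
  also have "\<dots> = (LINT x|lborel. indicator (cball a 1) x *\<^sub>R ?g (x - a))"
    by (intro Bochner_Integration.integral_cong) (auto simp: indicator_def dist_norm norm_minus_commute)
  also have "\<dots> \<le> (LINT x|lborel. indicator (cball 0 R) x *\<^sub>R ?g (x - a))"
  proof (rule integral_mono[OF int int])
    fix x
    have "cball a 1 \<subseteq> cball 0 R"
      using assms by (simp add: cball_subset_cball_iff dist_norm)
    then show "indicator (cball a 1) x *\<^sub>R ?g (x - a) \<le> indicator (cball 0 R) x *\<^sub>R ?g (x - a)"
      by (auto simp: indicator_def)
  qed auto
  finally have le: "(LINT x:cball 0 1|lborel. ?g x) \<le> (LINT x:cball 0 R|lborel. ?g (x - a))"
    unfolding set_lebesgue_integral_def .
  have "(norm (cutoff R (unit_packet a b)))\<^sup>2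
      = (norm (cutoff R (to_L2 (packet a b))))\<^sup>2 / (norm (to_L2 (packet a b)))\<^sup>2"
  proof -
    have "bounded_linear (cutoff R :: 'a L2 \<Rightarrow> 'a L2)"
      using bounded_clinear_cutoff[of R] by (auto simp: bounded_clinear_def)
    then have "cutoff R (unit_packet a b) = cutoff R (to_L2 (packet a b)) /\<^sub>R norm (to_L2 (packet a b))"
      unfolding unit_packet_def by (rule linear_scale[OF bounded_linear.linear])
    then show ?thesis by (simp add: power_mult_distrib power_inverse divide_inverse mult.commute)
  qed
  also have "(norm (cutoff R (to_L2 (packet a b))))\<^sup>2 = ?W * (LINT x:cball 0 R|lborel. ?g (x - a))"
    unfolding norm_cutoff[OF square_integrable_packet] cmod_packet_sq by simp
  also have "\<dots> / (norm (to_L2 (packet a b)))\<^sup>2 = (LINT x:cball 0 R|lborel. ?g (x - a)) / gauss_mass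
      TYPE('a)"
    unfolding norm_to_L2_packet by simp
  finally show ?thesis
    unfolding bump_def using le gauss_mass_pos[where 'a = 'a] by (simp add: divide_right_mono)
qed

text \<open>During the interval of length \<open>\<delta>\<close>, the unit ball around the position of the packet lies in
  \<open>cball 0 R\<close>.\<close>

lemma Re_cinner_time_average_unit_packet_ge:
  fixes U :: "real \<Rightarrow> 'a::euclidean_space L2 \<Rightarrow> 'a L2"
  assumes gen: "unitary_group_generated_by oscillator U"
    and t: "0 \<le> t0" "t0 + \<delta> \<le> 1/2" "0 \<le> \<delta>"
    and near: "\<And>t. t0 \<le> t \<Longrightarrow> t \<le> t0 + \<delta> \<Longrightarrow> norm (rot t a b) + 1 \<le> R"
  shows "bump TYPE('a) * \<delta> \<le> Re (cinner (unit_packet a b) (time_average U R (unit_packet a b)))"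
proof -
  have U: "unitary_group U" using gen by (simp add: unitary_group_generated_by_def)
  let ?f = "\<lambda>t. (norm (cutoff R (U t (unit_packet a b))))\<^sup>2"
  have f: "?f t = (norm (cutoff R (unit_packet (rot t a b) (rot t b (- a)))))\<^sup>2" for t
  proof -
    have "cutoff R (c *\<^sub>C g) = c *\<^sub>C cutoff R g" for c and g :: "'a L2"
      using bounded_clinear_cutoff[of R] by (auto simp: bounded_clinear_def)
    then show ?thesis by (simp add: unit_packet_flow[OF gen])
  qed
  have "bump TYPE('a) * \<delta> = (LINT t:{t0..t0 + \<delta>}|lborel. bump TYPE('a))"
    using t by (subst set_integral_const) auto
  also have "\<dots> = (LINT t|lborel. indicator {t0..t0 + \<delta>} t *\<^sub>R bump TYPE('a))"
    by (simp add: set_lebesgue_integral_def)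
  also have "\<dots> \<le> (LINT t|lborel. indicator {0..1/2} t *\<^sub>R ?f t)"
  proof (rule integral_mono)
    show "integrable lborel (\<lambda>t. indicator {t0..t0 + \<delta>} t *\<^sub>R bump TYPE('a))"
      by (intro borel_integrable_compact continuous_intros compact_Icc)
    show "integrable lborel (\<lambda>t. indicator {0..1/2} t *\<^sub>R ?f t)"
      using Re_cinner_time_average(1)[OF U] by (simp add: set_integrable_def)
    fix t
    show "indicator {t0..t0 + \<delta>} t *\<^sub>R bump TYPE('a) \<le> indicator {0..1/2} t *\<^sub>R ?f t"
      using t near[of t] norm_cutoff_unit_packet_ge[of "rot t a b" R "rot t b (- a)"]
      unfolding f by (auto simp: indicator_def)
  qed
  also have "\<dots> = Re (cinner (unit_packet a b) (time_average U R (unit_packet a b)))"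
    unfolding Re_cinner_time_average(2)[OF U] set_lebesgue_integral_def ..
  finally show ?thesis .
qed

subsection \<open>The family\<close>

definition lattice_vec :: "('n \<Rightarrow> nat) \<Rightarrow> real ^ 'n" where
  "lattice_vec \<beta> = (\<chi> i. real (\<beta> i))"

text \<open>The point \<open>(m / \<beta> k) \<beta>\<close> of the ray through \<open>\<beta>\<close>, with its coordinates rounded down. Its
  coordinate \<open>k\<close> is exactly \<open>m\<close>, so that different \<open>m\<close> give different points.\<close>

definition ray_point :: "'n \<Rightarrow> nat \<Rightarrow> ('n \<Rightarrow> nat) \<Rightarrow> 'n \<Rightarrow> nat" where
  "ray_point k m \<beta> i = m * \<beta> i div \<beta> k"

text \<open>On the ray through the momentum, the motion is \<open>\<beta> (s cos t - sin t)\<close> with \<open>s = m / \<beta> k\<close>,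
  which vanishes at \<open>t = arctan s\<close> and has slope at most 2.\<close>

lemma norm_rot_ray_le:
  fixes \<beta> :: "'n::finite \<Rightarrow> nat"
  assumes n: "0 < \<beta> k" "\<And>i. \<beta> i \<le> \<beta> k" and m: "4 * m \<le> \<beta> k"
    and t: "arctan (m / \<beta> k) \<le> t" "t \<le> arctan (m / \<beta> k) + 1 / \<beta> k"
  shows "norm (rot t (lattice_vec (ray_point k m \<beta>)) (lattice_vec \<beta>)) \<le> 3 * CARD('n)"
proof -
  define s where "s = real m / real (\<beta> k)"
  have s: "0 \<le> s" "s \<le> 1" using n(1) m by (auto simp: s_def divide_simps)
  have slope: "\<bar>s * cos t - sin t\<bar> \<le> 2 / \<beta> k"
  proof -
    have "s * cos t - sin t = sin (arctan s - t) * sqrt (1 + s\<^sup>2)"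
    proof -
      have "0 < sqrt (1 + s\<^sup>2)" by (simp add: add_pos_nonneg)
      then show ?thesis by (simp add: sin_diff sin_arctan cos_arctan field_simps)
    qed
    then have "\<bar>s * cos t - sin t\<bar> = \<bar>sin (arctan s - t)\<bar> * sqrt (1 + s\<^sup>2)"
      by (simp add: abs_mult)
    also have "\<dots> \<le> \<bar>arctan s - t\<bar> * 2"
    proof (intro mult_mono)
      show "\<bar>sin (arctan s - t)\<bar> \<le> \<bar>arctan s - t\<bar>" by (rule abs_sin_x_le_abs_x)
      have "1 + s\<^sup>2 \<le> 2\<^sup>2" using power_le_one[OF s, of 2] by simp
      then show "sqrt (1 + s\<^sup>2) \<le> 2" by (rule real_le_lsqrt[rotated]) auto
    qed auto
    also have "\<dots> \<le> (1 / \<beta> k) * 2"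
      using t by (intro mult_right_mono) (auto simp: s_def)
    finally show ?thesis by simp
  qed
  \<comment> \<open>The rounding in \<open>ray_point\<close> contributes 1, and the motion along the ray contributes 2.\<close>
  have comp: "\<bar>rot t (lattice_vec (ray_point k m \<beta>)) (lattice_vec \<beta>) $ i\<bar> \<le> 3" for i
  proof -
    define p where "p = real (ray_point k m \<beta> i)"
    have "m * \<beta> i = \<beta> k * ray_point k m \<beta> i + m * \<beta> i mod \<beta> k"
      unfolding ray_point_def by simp
    then have "real m * real (\<beta> i) = real (\<beta> k) * p + real (m * \<beta> i mod \<beta> k)"
      unfolding p_def by (metis of_nat_add of_nat_mult)
    moreover have "real (m * \<beta> i mod \<beta> k) \<le> real (\<beta> k)"
      using n(1) by (simp add: less_imp_le)
    ultimately have p: "\<bar>s * \<beta> i - p\<bar> \<le> 1"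
      using n(1) unfolding s_def by (simp add: field_simps abs_le_iff)
    have "rot t (lattice_vec (ray_point k m \<beta>)) (lattice_vec \<beta>) $ i
        = \<beta> i * (s * cos t - sin t) - (s * \<beta> i - p) * cos t"
      by (simp add: rot_def lattice_vec_def p_def algebra_simps)
    also have "\<bar>\<dots>\<bar> \<le> \<bar>\<beta> i * (s * cos t - sin t)\<bar> + \<bar>(s * \<beta> i - p) * cos t\<bar>"
      by (rule abs_triangle_ineq4)
    also have "\<dots> \<le> \<beta> k * (2 / \<beta> k) + 1 * 1"
      unfolding abs_mult using n slope p by (intro add_mono mult_mono) auto
    also have "\<dots> = 3" using n(1) by simp
    finally show ?thesis .
  qed
  have "norm (rot t (lattice_vec (ray_point k m \<beta>)) (lattice_vec \<beta>))
      \<le> (\<Sum>i\<in>UNIV. \<bar>rot t (lattice_vec (ray_point k m \<beta>)) (lattice_vec \<beta>) $ i\<bar>)"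
    by (rule norm_le_l1_cart)
  also have "\<dots> \<le> (\<Sum>i\<in>(UNIV :: 'n set). 3)"
    by (intro sum_mono comp)
  finally show ?thesis by simp
qed

text \<open>The coordinate \<open>k\<close> of the momentum dominates and fixes the scale. The bounds by 4 ensure
  that the packet crosses the origin within \<open>[0, 1/2]\<close>: it does so at \<open>arctan (m / \<beta> k) \<le> 1/4\<close> and
  stays near for a time \<open>1 / \<beta> k \<le> 1/4\<close>.\<close>

definition ray_index :: "'n \<Rightarrow> nat \<Rightarrow> (nat \<times> ('n \<Rightarrow> nat)) set" where
  "ray_index k N = (SIGMA m:{..N}. {\<beta>. 4 \<le> \<beta> k \<and> \<beta> k \<le> N \<and> (\<forall>i. \<beta> i \<le> \<beta> k) \<and> 4 * m \<le> \<beta> k})"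

definition ray_packet :: "'n \<Rightarrow> nat \<times> ('n \<Rightarrow> nat) \<Rightarrow> (real ^ 'n::finite) L2" where
  "ray_packet k = (\<lambda>(m, \<beta>). unit_packet (lattice_vec (ray_point k m \<beta>)) (lattice_vec \<beta>))"

lemma ray_packet_time_average_ge:
  fixes U :: "real \<Rightarrow> (real ^ 'n) L2 \<Rightarrow> (real ^ 'n) L2"
  assumes gen: "unitary_group_generated_by oscillator U" and j: "(m, \<beta>) \<in> ray_index k N"
    and R: "R = real (3 * CARD('n) + 1)"
  shows "bump TYPE(real ^ 'n) / \<beta> k
    \<le> Re (cinner (ray_packet k (m, \<beta>)) (time_average U R (ray_packet k (m, \<beta>))))"
proof -
  have \<beta>: "4 \<le> \<beta> k" "\<And>i. \<beta> i \<le> \<beta> k" "4 * m \<le> \<beta> k"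
    using j by (auto simp: ray_index_def)
  have "m / \<beta> k \<le> 1/4" using \<beta> by (simp add: divide_simps)
  moreover have "1 / \<beta> k \<le> 1/4" using \<beta> by (simp add: divide_simps)
  moreover have "arctan (m / \<beta> k) \<le> m / \<beta> k" by (rule arctan_le_self) simp
  ultimately have time: "arctan (m / \<beta> k) + 1 / \<beta> k \<le> 1/2" by linarith
  have "bump TYPE(real ^ 'n) * (1 / \<beta> k)
    \<le> Re (cinner (ray_packet k (m, \<beta>)) (time_average U R (ray_packet k (m, \<beta>))))"
    unfolding ray_packet_def prod.case using norm_rot_ray_le[of \<beta> k m] \<beta>
    by (intro Re_cinner_time_average_unit_packet_ge[OF gen _ time]) (auto simp: R)
  then show ?thesis by simp
qed

subsection \<open>Almost orthogonality\<close>

text \<open>Twice a geometric series of ratio \<open>exp (- \<pi>/4)\<close>, which dominates the Gaussian because \<open>d \<le>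
  d^2\<close> for integers.\<close>

definition lattice_const :: real where
  "lattice_const = 2 / (1 - exp (- pi / 4))"

lemma sum_gaussian_lattice_le:
  "(\<Sum>k\<le>L. exp (- pi / 4 * (real x - real k)\<^sup>2)) \<le> lattice_const"
proof -
  define r where "r = exp (- pi / 4)"
  have r: "0 < r" "r < 1" by (auto simp: r_def)
  have geo: "(\<Sum>k\<in>S. r ^ f k) \<le> 1 / (1 - r)" if "finite S" "inj_on f S" for f :: "nat \<Rightarrow> nat" and S
  proof -
    have "(\<Sum>k\<in>S. r ^ f k) = (\<Sum>i\<in>f ` S. r ^ i)"
      using that by (simp add: sum.reindex)
    also have "\<dots> \<le> (\<Sum>i. r ^ i)"
      using that r by (intro sum_le_suminf summable_geometric) auto
    finally show ?thesis using r by (simp add: suminf_geometric)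
  qed
  have "(\<Sum>k\<le>L. exp (- pi / 4 * (real x - real k)\<^sup>2))
      \<le> (\<Sum>k\<le>L. (if k \<le> x then r ^ (x - k) else r ^ (k - x)))"
  proof (rule sum_mono)
    fix k
    have *: "exp (- pi / 4 * (real d)\<^sup>2) \<le> r ^ d" for d :: nat
    proof -
      have "real d \<le> (real d)\<^sup>2"
        by (simp add: power2_eq_square flip: of_nat_mult)
      then have "pi / 4 * real d \<le> pi / 4 * (real d)\<^sup>2" by (intro mult_left_mono) auto
      then show ?thesis by (simp add: r_def mult.commute flip: exp_of_nat_mult)
    qed
    show "exp (- pi / 4 * (real x - real k)\<^sup>2) \<le> (if k \<le> x then r ^ (x - k) else r ^ (k - x))"
      using *[of "x - k"] *[of "k - x"] by (auto simp: of_nat_diff power2_commute)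
  qed
  also have "\<dots> = (\<Sum>k\<in>{..L} \<inter> {k. k \<le> x}. r ^ (x - k)) + (\<Sum>k\<in>{..L} \<inter> - {k. k \<le> x}. r ^ (k - x))"
    by (simp add: sum.If_cases)
  also have "\<dots> \<le> 1 / (1 - r) + 1 / (1 - r)"
    by (intro add_mono geo) (auto simp: inj_on_def)
  finally show ?thesis by (simp add: lattice_const_def r_def)
qed

lemma sum_gaussian_lattice_vec_le:
  fixes \<alpha> :: "'n::finite \<Rightarrow> nat"
  shows "(\<Sum>\<gamma>\<in>Pi\<^sub>E UNIV (\<lambda>_. {..L}). exp (- pi / 4 * (norm (lattice_vec \<alpha> - lattice_vec \<gamma>))\<^sup>2))
    \<le> lattice_const ^ CARD('n)"
proof -
  have "exp (- pi / 4 * (norm (lattice_vec \<alpha> - lattice_vec \<gamma>))\<^sup>2)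
      = (\<Prod>i\<in>UNIV. exp (- pi / 4 * (real (\<alpha> i) - real (\<gamma> i))\<^sup>2))" for \<gamma> :: "'n \<Rightarrow> nat"
    unfolding power2_norm_eq_inner inner_vec_def
    by (simp add: lattice_vec_def power2_eq_square sum_distrib_left flip: exp_sum sum_negf)
  then have "(\<Sum>\<gamma>\<in>Pi\<^sub>E UNIV (\<lambda>_. {..L}). exp (- pi / 4 * (norm (lattice_vec \<alpha> - lattice_vec \<gamma>))\<^sup>2))
      = (\<Prod>i\<in>UNIV. \<Sum>k\<le>L. exp (- pi / 4 * (real (\<alpha> i) - real k)\<^sup>2))"
    by (simp add: prod_sum_PiE)
  also have "\<dots> \<le> (\<Prod>i\<in>(UNIV :: 'n set). lattice_const)"
    by (intro prod_mono conjI sum_gaussian_lattice_le sum_nonneg) auto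
  finally show ?thesis by simp
qed

lemma finite_ray_index: "finite (ray_index (k :: 'n::finite) N)"
proof (rule finite_subset)
  show "ray_index k N \<subseteq> {..N} \<times> Pi\<^sub>E UNIV (\<lambda>_. {..N})"
    by (auto simp: ray_index_def intro: order_trans)
qed (auto intro!: finite_PiE)

text \<open>The positions and momenta are lattice points and determine the packet, so a row sum of the
  Gram matrix is at most the sum of the overlap bound over the whole lattice of phase space, which
  factorizes over the coordinates.\<close>

lemma bessel_family_ray_packet:
  fixes U :: "real \<Rightarrow> (real ^ 'n) L2 \<Rightarrow> (real ^ 'n) L2"
  assumes gen: "unitary_group_generated_by oscillator U"
  shows "bessel_family ((lattice_const ^ CARD('n))\<^sup>2) (ray_index k N) (ray_packet (k :: 'n))"
proof (rule bessel_family_if_almost_orthogonal)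
  show "finite (ray_index k N)" by (rule finite_ray_index)
  fix j assume "j \<in> ray_index k N"
  let ?F = "Pi\<^sub>E (UNIV :: 'n set) (\<lambda>_. {..N})"
  let ?h = "\<lambda>(m, \<beta>). (ray_point k m \<beta>, \<beta>)"
  let ?g = "\<lambda>(\<alpha> :: 'n \<Rightarrow> nat) \<gamma>. exp (- pi / 4 * (norm (lattice_vec \<alpha> - lattice_vec \<gamma>))\<^sup>2)"
  obtain m \<beta> where j: "j = (m, \<beta>)" by (cases j)
  \<comment> \<open>The coordinate \<open>k\<close> of the position recovers \<open>m\<close>.\<close>
  have inj: "inj_on ?h (ray_index k N)"
  proof (rule inj_onI, clarsimp)
    fix m m' \<gamma>
    assume *: "(m, \<gamma>) \<in> ray_index k N" "ray_point k m \<gamma> = ray_point k m' \<gamma>"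
    then have "0 < \<gamma> k" by (auto simp: ray_index_def)
    then show "m = m'" using fun_cong[OF *(2), of k] by (simp add: ray_point_def)
  qed
  have sub: "?h ` ray_index k N \<subseteq> ?F \<times> ?F"
  proof
    fix p assume "p \<in> ?h ` ray_index k N"
    then obtain m \<gamma> where p: "p = (ray_point k m \<gamma>, \<gamma>)"
      and *: "m \<le> N" "4 \<le> \<gamma> k" "\<gamma> k \<le> N" "\<And>i. \<gamma> i \<le> \<gamma> k"
      by (auto simp: ray_index_def)
    have "ray_point k m \<gamma> i \<le> N" for i
    proof -
      have "ray_point k m \<gamma> i \<le> m * \<gamma> k div \<gamma> k"
        unfolding ray_point_def using * by (intro div_le_mono mult_le_mono2) auto
      then show ?thesis using * by auto
    qed
    moreover have "\<gamma> i \<le> N" for i using * order_trans by blast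
    ultimately show "p \<in> ?F \<times> ?F" by (auto simp: p PiE_UNIV_domain)
  qed
  have "(\<Sum>l\<in>ray_index k N. cmod (cinner (ray_packet k j) (ray_packet k l)))
      \<le> (\<Sum>l\<in>ray_index k N. case ?h l of (\<alpha>, \<gamma>) \<Rightarrow> ?g (ray_point k m \<beta>) \<alpha> * ?g \<beta> \<gamma>)"
  proof (rule sum_mono)
    fix l :: "nat \<times> ('n \<Rightarrow> nat)"
    obtain m' \<gamma> where l: "l = (m', \<gamma>)" by (cases l)
    show "cmod (cinner (ray_packet k j) (ray_packet k l))
        \<le> (case ?h l of (\<alpha>, \<gamma>) \<Rightarrow> ?g (ray_point k m \<beta>) \<alpha> * ?g \<beta> \<gamma>)"
      using cmod_cinner_unit_packet_le[OF gen, of "lattice_vec (ray_point k m \<beta>)" "lattice_vec \<beta>"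
          "lattice_vec (ray_point k m' \<gamma>)" "lattice_vec \<gamma>"]
      by (simp add: ray_packet_def j l distrib_left flip: exp_add)
  qed
  also have "\<dots> = (\<Sum>(\<alpha>, \<gamma>)\<in>?h ` ray_index k N. ?g (ray_point k m \<beta>) \<alpha> * ?g \<beta> \<gamma>)"
    by (subst sum.reindex[OF inj]) (simp add: o_def)
  also have "\<dots> \<le> (\<Sum>(\<alpha>, \<gamma>)\<in>?F \<times> ?F. ?g (ray_point k m \<beta>) \<alpha> * ?g \<beta> \<gamma>)"
    by (rule sum_mono2) (use sub in \<open>auto intro!: finite_PiE\<close>)
  also have "\<dots> = (\<Sum>\<alpha>\<in>?F. ?g (ray_point k m \<beta>) \<alpha>) * (\<Sum>\<gamma>\<in>?F. ?g \<beta> \<gamma>)"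
    by (simp add: sum_product sum.cartesian_product)
  also have "\<dots> \<le> lattice_const ^ CARD('n) * lattice_const ^ CARD('n)"
    by (intro mult_mono sum_gaussian_lattice_vec_le sum_nonneg) (auto simp: lattice_const_def)
  finally show "(\<Sum>l\<in>ray_index k N. cmod (cinner (ray_packet k j) (ray_packet k l)))
      \<le> (lattice_const ^ CARD('n))\<^sup>2"
    by (simp add: power2_eq_square)
qed simp

subsection \<open>Counting\<close>

text \<open>For leading momentum \<open>n\<close> there are \<open>n div 4 + 1\<close> positions on the ray and \<open>(n + 1)^(d - 1)\<close>
  choices of the other coordinates of the momentum, that is, at least \<open>n^d / 4\<close> packets.\<close>

lemma sum_ray_index_ge:
  fixes k :: "'n::finite"
  assumes "0 \<le> c"
  shows "c ^ (CARD('n) + 1) / 4 * (\<Sum>n=4..N. 1 / real n)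
    \<le> (\<Sum>(m, \<beta>)\<in>ray_index k N. (c / real (\<beta> k)) ^ (CARD('n) + 1))"
proof -
  define d where "d = CARD('n)"
  define f where "f n = (c / real n) ^ (d + 1)" for n :: nat
  define Q where "Q n = (SIGMA m:{..n div 4}. Pi\<^sub>E UNIV (\<lambda>i. if i = k then {n} else {..n}))" for n
      :: nat
  have d: "0 < d" by (simp add: d_def)
  have card_Q: "real n ^ d / 4 \<le> card (Q n)" for n
  proof -
    have "card (Pi\<^sub>E UNIV (\<lambda>i. if i = k then {n} else {..n})) = (\<Prod>i\<in>UNIV. if i = k then 1 else n + 1)"
      by (subst card_PiE) (auto intro!: prod.cong)
    also have "\<dots> = (n + 1) ^ (d - 1)"
      by (simp add: prod.If_cases Collect_neg_eq[symmetric] Compl_eq_Diff_UNIV card_Diff_singleton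
          d_def)
    finally have "card (Q n) = (n div 4 + 1) * (n + 1) ^ (d - 1)"
      by (simp add: Q_def card_cartesian_product)
    then have "real (card (Q n)) = (real (n div 4) + 1) * (real n + 1) ^ (d - 1)"
      by (simp add: algebra_simps)
    also have "\<dots> \<ge> real n / 4 * real n ^ (d - 1)"
      by (intro mult_mono power_mono zero_le_power) linarith+
    finally show ?thesis
      using d by (simp add: power_eq_if[of _ d])
  qed
  have "c ^ (d + 1) / 4 * (\<Sum>n=4..N. 1 / real n) = (\<Sum>n=4..N. c ^ (d + 1) / 4 * (1 / real n))"
    by (rule sum_distrib_left)
  also have "\<dots> \<le> (\<Sum>n=4..N. card (Q n) * f n)"
  proof (rule sum_mono)
    fix n assume "n \<in> {4..N}"
    then have "c ^ (d + 1) / 4 * (1 / real n) = real n ^ d / 4 * f n"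
      by (simp add: f_def power_divide)
    also have "\<dots> \<le> card (Q n) * f n"
      using assms by (intro mult_right_mono card_Q) (simp add: f_def)
    finally show "c ^ (d + 1) / 4 * (1 / real n) \<le> card (Q n) * f n" .
  qed
  also have "\<dots> = (\<Sum>n=4..N. \<Sum>(m, \<beta>)\<in>Q n. f (\<beta> k))"
  proof (rule sum.cong[OF refl])
    fix n
    have "(\<Sum>(m, \<beta>)\<in>Q n. f (\<beta> k)) = (\<Sum>j\<in>Q n. f n)"
      by (rule sum.cong) (auto simp: Q_def PiE_iff split: if_splits)
    then show "card (Q n) * f n = (\<Sum>(m, \<beta>)\<in>Q n. f (\<beta> k))" by simp
  qed
  also have "\<dots> = (\<Sum>(m, \<beta>)\<in>(\<Union>n\<in>{4..N}. Q n). f (\<beta> k))"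
  proof (rule sum.UNION_disjoint[symmetric])
    show "\<forall>n\<in>{4..N}. finite (Q n)"
      by (auto simp: Q_def intro!: finite_PiE)
    have "\<beta> k = n" if "(m, \<beta>) \<in> Q n" for m n \<beta>
    proof -
      have "\<beta> k \<in> (if k = k then {n} else {..n})"
        using that unfolding Q_def by (auto simp: PiE_iff split: if_splits)
      then show ?thesis by simp
    qed
    then show "\<forall>i\<in>{4..N}. \<forall>j\<in>{4..N}. i \<noteq> j \<longrightarrow> Q i \<inter> Q j = {}"
      by (metis disjoint_iff prod.collapse)
  qed simp
  also have "\<dots> \<le> (\<Sum>(m, \<beta>)\<in>ray_index k N. f (\<beta> k))"
  proof (rule sum_mono2[OF finite_ray_index])
    show "(\<Union>n\<in>{4..N}. Q n) \<subseteq> ray_index k N"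
    proof clarify
      fix n m \<beta> assume n: "n \<in> {4..N}" and Q: "(m, \<beta>) \<in> Q n"
      have \<beta>: "\<beta> i \<in> (if i = k then {n} else {..n})" for i
        using Q by (auto simp: Q_def PiE_iff)
      have "\<beta> k = n" "\<beta> i \<le> n" for i
        using \<beta>[of k] \<beta>[of i] by (auto split: if_splits)
      moreover have "m \<le> n div 4" using Q by (simp add: Q_def)
      ultimately show "(m, \<beta>) \<in> ray_index k N"
        using n by (auto simp: ray_index_def)
    qed
  qed (use assms in \<open>auto simp: f_def\<close>)
  finally show ?thesis by (simp add: f_def d_def)
qed

lemma harmonic_tail_unbounded: "\<exists>N. M < (\<Sum>n=4..N. 1 / real n)"
proof (rule ccontr)
  assume "\<not> ?thesis"
  then have le: "(\<Sum>n=4..N. 1 / real n) \<le> M" for N by (simp add: not_less)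
  have "summable (\<lambda>n. 1 / real (n + 4))"
  proof (rule summableI_nonneg_bounded)
    show "(\<Sum>i<N. 1 / real (i + 4)) \<le> M" for N
    proof -
      have "(\<Sum>i<N. 1 / real (i + 4)) = (\<Sum>n=4..<N + 4. 1 / real n)"
        using sum.shift_bounds_nat_ivl[of "\<lambda>n. 1 / real n" 0 4 N] by (simp add: lessThan_atLeast0)
      also have "\<dots> \<le> (\<Sum>n=4..N + 4. 1 / real n)"
        by (rule sum_mono2) auto
      finally show ?thesis using le[of "N + 4"] by linarith
    qed
  qed simp
  then have "summable (\<lambda>n. 1 / real n)"
    by (subst (asm) summable_iff_shift)
  then show False
    using not_summable_harmonic[where 'a = real] by (simp add: inverse_eq_divide)
qed

theorem proposition5p4:
  fixes U :: "real \<Rightarrow> (real ^ 'n) L2 \<Rightarrow> (real ^ 'n) L2"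
  assumes "unitary_group_generated_by oscillator U"
  shows "\<exists>V \<in> Linf_c {- pi / 4 <..< pi / 4}. \<exists>A.
    has_op_integral
      (\<lambda>t. U (- t) \<circ> mult_op (\<lambda>x. complex_of_real (V (t, x))) \<circ> U t)
      A {- pi / 4 <..< pi / 4} \<and>
    positive_op (A ^^ (CARD('n) + 1)) \<and> op_trace (A ^^ (CARD('n) + 1)) = \<infinity>"
proof -
  have U: "unitary_group U" using assms by (simp add: unitary_group_generated_by_def)
  \<comment> \<open>The packets pass the origin at distance at most \<open>3 d\<close>; the ball leaves room for their width.\<close>
  define R where "R = real (3 * CARD('n) + 1)"
  define V :: "real \<times> (real ^ 'n) \<Rightarrow> real" where "V = indicator ({0..1/2} \<times> cball 0 R)"
  define A where "A = time_average U R"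
  have supp: "{p. V p \<noteq> 0} = {0..1/2} \<times> cball 0 R"
    by (auto simp: V_def indicator_def)
  have cl: "closed ({0..1/2::real} \<times> cball (0 :: real ^ 'n) R)"
    by (intro closed_Times) auto
  have half: "1/2 < pi / 4" using pi_gt3 by simp
  have sub: "{0..1/2} \<subseteq> {- pi / 4 <..< pi / 4}"
    using half by auto
  have V: "V \<in> Linf_c {- pi / 4 <..< pi / 4}"
    unfolding Linf_c_def mem_Collect_eq supp closure_closed[OF cl]
  proof (intro conjI)
    show "V \<in> borel_measurable borel"
      unfolding V_def by (intro borel_measurable_indicator borel_closed cl)
    show "bounded (range V)"
      unfolding bounded_iff by (intro exI[of _ 1]) (auto simp: V_def indicator_def)
    show "compact ({0..1/2::real} \<times> cball (0 :: real ^ 'n) R)"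
      by (intro compact_Times) auto
    show "{0..1/2} \<times> cball (0 :: real ^ 'n) R \<subseteq> {- pi / 4 <..< pi / 4} \<times> UNIV"
      using sub by blast
  qed
  have mult_zero: "mult_op (\<lambda>_. 0) f = 0" for f :: "(real ^ 'n) L2"
  proof -
    obtain g where g: "square_integrable g" "f = to_L2 g" by (rule L2_representative)
    have "mult_op (\<lambda>_. 0) f = to_L2 (\<lambda>x. 0 * g x)"
      unfolding g(2) by (rule mult_op_to_L2) (use g in auto)
    also have "\<dots> = 0 *\<^sub>C to_L2 g" by (rule to_L2_scaleC[OF g(1)])
    finally show ?thesis by simp
  qed
  have F: "(U (- t) \<circ> mult_op (\<lambda>x. complex_of_real (V (t, x))) \<circ> U t) f
      = (if t \<in> {0..1/2} then heisenberg U R t f else 0)" for t f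
  proof (cases "t \<in> {0..1/2}")
    case True
    then have "(\<lambda>x. complex_of_real (V (t, x))) = (\<lambda>x. complex_of_real (indicator (cball 0 R) x))"
      by (auto simp: V_def indicator_def)
    then show ?thesis using True by (simp add: heisenberg_def cutoff_def)
  next
    case False
    then have "(\<lambda>x. complex_of_real (V (t, x))) = (\<lambda>_. 0)"
      by (auto simp: V_def indicator_def)
    then show ?thesis
      unfolding if_not_P[OF False] by (simp add: mult_zero linear_0[OF unitary_group_linear[OF U]])
  qed
  have ind: "indicator {- pi / 4 <..< pi / 4} t *\<^sub>R cinner g (if t \<in> {0..1/2} then heisenberg U R t
      f else 0)
      = indicator {0..1/2} t *\<^sub>R cinner g (heisenberg U R t f)" for t f g
    using sub by (auto simp: indicator_def)
  have integral: "has_op_integral (\<lambda>t. U (- t) \<circ> mult_op (\<lambda>x. complex_of_real (V (t, x))) \<circ> U t)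
      A {- pi / 4 <..< pi / 4}"
    unfolding has_op_integral_def
  proof (intro conjI allI)
    show "bounded_clinear A"
      unfolding A_def by (rule bounded_clinear_time_average[OF U])
    fix f g
    show "set_integrable lborel {- pi / 4 <..< pi / 4}
        (\<lambda>t. cinner g ((U (- t) \<circ> mult_op (\<lambda>x. complex_of_real (V (t, x))) \<circ> U t) f))"
      using cinner_time_average(1)[OF U, of g R f] unfolding F set_integrable_def ind .
    show "cinner g (A f) = (LINT t:{- pi / 4 <..< pi / 4}|lborel.
        cinner g ((U (- t) \<circ> mult_op (\<lambda>x. complex_of_real (V (t, x))) \<circ> U t) f))"
      using cinner_time_average(2)[OF U, of g R f] unfolding F set_lebesgue_integral_def ind A_def .
  qed
  have pos: "positive_op (A ^^ (CARD('n) + 1))"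
    unfolding A_def
  proof (rule positive_op_funpow)
    show "0 \<le> Re (cinner f (time_average U R f))" for f
      unfolding Re_cinner_time_average(2)[OF U] set_lebesgue_integral_def
      by (rule Bochner_Integration.integral_nonneg) simp
  qed (rule bounded_clinear_time_average[OF U], rule time_average_symmetric[OF U])
  \<comment> \<open>An arbitrary coordinate.\<close>
  let ?k = "undefined :: 'n"
  let ?c = "bump TYPE(real ^ 'n)"
  have c: "0 < ?c" by (rule bump_pos)
  have "op_trace (A ^^ (CARD('n) + 1)) = \<infinity>"
    unfolding A_def
  proof (rule op_trace_time_average_infinite[OF U, where K = "(lattice_const ^ CARD('n))\<^sup>2"])
    fix M
    obtain N where N: "M / (?c ^ (CARD('n) + 1) / 4) < (\<Sum>n=4..N. 1 / real n)"
      using harmonic_tail_unbounded by blast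
    then have "M < ?c ^ (CARD('n) + 1) / 4 * (\<Sum>n=4..N. 1 / real n)"
      using c by (simp add: pos_divide_less_eq mult.commute)
    also have "\<dots> \<le> (\<Sum>(m, \<beta>)\<in>ray_index ?k N. (?c / real (\<beta> ?k)) ^ (CARD('n) + 1))"
      using c by (intro sum_ray_index_ge) simp
    also have "\<dots> \<le> (\<Sum>j\<in>ray_index ?k N.
        (Re (cinner (ray_packet ?k j) (time_average U R (ray_packet ?k j)))) ^ (CARD('n) + 1))"
    proof (rule sum_mono)
      fix j assume "j \<in> ray_index ?k N"
      moreover obtain m \<beta> where j: "j = (m, \<beta>)" by (cases j)
      ultimately have "?c / real (\<beta> ?k) \<le> Re (cinner (ray_packet ?k j) (time_average U R (ray_packet
          ?k j)))"
        using ray_packet_time_average_ge[OF assms, of m \<beta> ?k N R] by (simp add: R_def)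
      then show "(case j of (m, \<beta>) \<Rightarrow> (?c / real (\<beta> ?k)) ^ (CARD('n) + 1))
          \<le> (Re (cinner (ray_packet ?k j) (time_average U R (ray_packet ?k j)))) ^ (CARD('n) + 1)"
        unfolding j prod.case using c by (intro power_mono) auto
    qed
    finally have "M < (\<Sum>j\<in>ray_index ?k N.
        (Re (cinner (ray_packet ?k j) (time_average U R (ray_packet ?k j)))) ^ (CARD('n) + 1))" .
    then show "\<exists>J \<phi>. finite (J :: (nat \<times> ('n \<Rightarrow> nat)) set) \<and> bessel_family ((lattice_const ^
        CARD('n))\<^sup>2) J \<phi> \<and>
        (\<forall>j\<in>J. norm (\<phi> j) = 1) \<and>
        M < (\<Sum>j\<in>J. (Re (cinner (\<phi> j) (time_average U R (\<phi> j)))) ^ (CARD('n) + 1))"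
      using finite_ray_index bessel_family_ray_packet[OF assms]
      by (intro exI[of _ "ray_index ?k N"] exI[of _ "ray_packet ?k"])
        (auto simp: ray_packet_def norm_unit_packet)
  qed simp
  with V integral pos show ?thesis by blast
qed

end
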